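(* Consider the single-resource loss model (capacity $b$, $m$ classes with parameters $(\lambda_i,\mu_i,b_i,r_i)$, $\rho_i=\lambda_i/\mu_i$) controlled by the penalty policy $\bar\pi$ with parameters $\varepsilon,\beta,(\mathbf c^0,\mathbf c^1)$ and initial fictitious load $\bar{\mathbf y}(0^-)$. Suppose $0<\varepsilon<\frac14$; let $\alpha^\varepsilon$ be an optimal solution of the perturbed linear program $$\max_\alpha\ \sum_{i=1}^m r_i\rho_i\alpha_i\quad\text{s.t.}\quad\sum_{i=1}^m b_i\rho_i\alpha_i\le\frac{b}{1+4\varepsilon},\quad 0\le\alpha_i\le1,\ i=1,\dots,m;$$ let $$c_i^0=(1+4\varepsilon)\alpha_i^\varepsilon b_i\rho_i,\qquad c_i^1=(1+4\varepsilon)(1-\alpha_i^\varepsilon)b_i\rho_i,\qquad i=1,\dots,m;$$ let $\beta>0$ satisfy $$\beta\le\varepsilon\min\Big\{\min_{1\le i\le m}\frac{c_i^0}{b_i},\ \min_{i:\,\alpha_i^\varepsilon<1}\frac{c_i^1}{b_i}\Big\};$$ and let the initial state be $\bar{\mathbf s}(0^-)=(\mathbf 0,\bar{\mathbf y}(0^-))$ with $\bar y_i(0^-)=(1-\alpha_i^\varepsilon)\rho_i$, $i=1,\dots,m$. Then for all $t\ge0$ the reward rate $\bar R(t)=\sum_{i=1}^m r_i\bar x_i(t)$ of $\bar\pi$ satisfies $$\mathbf E[\bar R(t)]\ge\max\Big\{\sum_{i=1}^m\alpha_i^\varepsilon r_i\rho_i(1-e^{-\mu_it})-\zeta\sum_{i=1}^m(1-\alpha_i^\varepsilon)r_i\rho_i-2e^{-\frac{\varepsilon}{2}(\beta-4)}\sum_{i=1}^m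 r_i\rho_i(1-e^{-\mu_it}),\ 0\Big\},$$ where $\zeta=\big(\frac{\log 2}{\beta}+1-\frac{\varepsilon}{2}\big)(1+4\varepsilon)-1$.
   Context: Single-resource loss model. One resource has capacity $b\in(0,\infty)$. There are $m$ independent Poisson arrival streams; class $i$ requests arrive at rate $\lambda_i>0$, each requests capacity $b_i>0$, has an independent service duration $S_i\sim\exp(\mu_i)$ (rate $\mu_i>0$), and pays reward $r_i\ge0$ per unit time while in service. There is no waiting room: each arriving request is immediately accepted (occupying $b_i$ units of capacity until it departs) or rejected. The system is initially empty. Standing assumption: classes with $\alpha_i^*=0$ have been dropped, where $\alpha^*$ is an optimal solution of $\max\sum_i r_i\rho_i\alpha_i$ s.t. $\sum_i b_i\rho_i\alpha_i\le b$, $0\le\alpha_i\le1$; so $\alpha_i^*>0$ for all $i$. Penalty policy $\bar\pi$. Besides the original system ("system 0") there is a fictitious infinite-capacity system ("system 1"). The state is $\bar{\mathbf s}(t)=(\bar{\mathbf x}(t),\bar{\mathbf y}(t))$, where $\bar x_i(t)$ and $\bar y_i(t)$ are the numbers of class $i$ requests at time $t$ in systems 0 and 1. At time $0^-$ system 0 is empty and system 1 is loaded with $\bar y_i(0^-)$ class $i$ requests, each with an independent $\exp(\mu_i)$ service time. Let $$\Psi_i(x_i,y_i)=\exp\Big(\beta\frac{b_ix_i}{c_i^0}\Big)+\exp\Big(\beta\frac{b_iy_i}{c_i^1}\Big).$$ A class $i$ request arriving when the state is $(\mathbf x,\mathbf y)$ is accepted (routed to system 0) if $\frac{\partial\Psi_i}{\partial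 x_i}(x_i,y_i)\le\frac{\partial\Psi_i}{\partial y_i}(x_i,y_i)$ and $\sum_{j=1}^m b_jx_j+b_i\le b$; otherwise it is rejected, i.e. routed to system 1 and given an independent $\exp(\mu_i)$ service time there. Convention when $c_i^1=0$ (i.e. $\alpha_i^\varepsilon=1$): the second exponential equals $1$ if $y_i=0$ and $+\infty$ if $y_i>0$, and the condition $\partial\Psi_i/\partial x_i\le\partial\Psi_i/\partial y_i$ is regarded as always satisfied. *)

theory Defs
  imports "HOL-Probability.Probability"
begin

text \<open>The classes of requests are the elements of a finite type \<open>'i\<close>.\<close>

section \<open>The linear program\<close>

definition lp_feasible ::
  "('i::finite \<Rightarrow> real) \<Rightarrow> ('i \<Rightarrow> real) \<Rightarrow> real \<Rightarrow> ('i \<Rightarrow> real) \<Rightarrow> bool" where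
  "lp_feasible b \<rho> cap a \<longleftrightarrow>
     (\<Sum>i\<in>UNIV. b i * \<rho> i * a i) \<le> cap \<and> (\<forall>i. 0 \<le> a i \<and> a i \<le> 1)"

definition lp_optimal ::
  "('i::finite \<Rightarrow> real) \<Rightarrow> ('i \<Rightarrow> real) \<Rightarrow> ('i \<Rightarrow> real) \<Rightarrow> real \<Rightarrow> ('i \<Rightarrow> real) \<Rightarrow> bool" where
  "lp_optimal r b \<rho> cap a \<longleftrightarrow>
     lp_feasible b \<rho> cap a \<and>
     (\<forall>a'. lp_feasible b \<rho> cap a' \<longrightarrow>
        (\<Sum>i\<in>UNIV. r i * \<rho> i * a' i) \<le> (\<Sum>i\<in>UNIV. r i * \<rho> i * a i))"

section \<open>Random primitives of the two systems\<close>

text \<open>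
  Requests of class \<open>i\<close> are numbered \<open>0, 1, \<dots>\<close> in order of arrival.  \<open>Service i n\<close> is the service
  duration of the \<open>n\<close>-th request in the original system and \<open>Fict_Service i n\<close> the one it is given
  in the fictitious system; only the one belonging to the system it is routed to is used.
  \<open>Init_Service i k\<close> belongs to the \<open>k\<close>-th class \<open>i\<close> request initially loaded in the fictitious
  system.
\<close>

datatype 'i primitive =
    Interarrival 'i nat
  | Service 'i nat
  | Fict_Service 'i nat
  | Init_Service 'i nat

definition primitives :: "('i \<Rightarrow> nat) \<Rightarrow> 'i primitive set" where
  "primitives y0 =
     {Interarrival i n |i n. True} \<union> {Service i n |i n. True} \<union>
     {Fict_Service i n |i n. True} \<union> {Init_Service i k |i k. k < y0 i}"

fun primitive_rate :: "('i \<Rightarrow> real) \<Rightarrow> ('i \<Rightarrow> real) \<Rightarrow> 'i primitive \<Rightarrow> real" where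
  "primitive_rate lam mu (Interarrival i n) = lam i"
| "primitive_rate lam mu (Service i n) = mu i"
| "primitive_rate lam mu (Fict_Service i n) = mu i"
| "primitive_rate lam mu (Init_Service i k) = mu i"

text \<open>
  Independent Poisson streams are given by their independent exponential interarrival times.
\<close>

definition loss_primitives ::
  "'w measure \<Rightarrow> ('i \<Rightarrow> real) \<Rightarrow> ('i \<Rightarrow> real) \<Rightarrow> ('i \<Rightarrow> nat) \<Rightarrow> ('i primitive \<Rightarrow> 'w \<Rightarrow> real) \<Rightarrow> bool" where
  "loss_primitives M lam mu y0 Z \<longleftrightarrow>
     prob_space M \<and>
     prob_space.indep_vars M (\<lambda>_. borel) Z (primitives y0) \<and>
     (\<forall>p\<in>primitives y0.
        distributed M lborel (Z p) (exponential_density (primitive_rate lam mu p)))"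

definition arrival_time :: "('i primitive \<Rightarrow> 'w \<Rightarrow> real) \<Rightarrow> 'i \<Rightarrow> nat \<Rightarrow> 'w \<Rightarrow> real" where
  "arrival_time Z i n w = (\<Sum>k\<le>n. Z (Interarrival i k) w)"

section \<open>State of the two systems under given routing decisions\<close>

text \<open>
  \<open>acc i n w\<close> says that the \<open>n\<close>-th class \<open>i\<close> request is routed to the original system.
  \<open>x_state\<close> and \<open>y_state\<close> are the right-continuous numbers of requests at time \<open>t\<close> in the original
  and the fictitious system; \<open>x_before\<close> and \<open>y_before\<close> are their left limits, that is, what a request
  arriving at time \<open>t\<close> finds.
\<close>

definition x_state ::
  "('i primitive \<Rightarrow> 'w \<Rightarrow> real) \<Rightarrow> ('i \<Rightarrow> nat \<Rightarrow> 'w \<Rightarrow> bool) \<Rightarrow> 'i \<Rightarrow> real \<Rightarrow> 'w \<Rightarrow> nat" where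
  "x_state Z acc i t w =
     card {n. acc i n w \<and> arrival_time Z i n w \<le> t \<and>
              t < arrival_time Z i n w + Z (Service i n) w}"

definition y_state ::
  "('i primitive \<Rightarrow> 'w \<Rightarrow> real) \<Rightarrow> ('i \<Rightarrow> nat \<Rightarrow> 'w \<Rightarrow> bool) \<Rightarrow> ('i \<Rightarrow> nat) \<Rightarrow> 'i \<Rightarrow> real \<Rightarrow> 'w \<Rightarrow> nat" where
  "y_state Z acc y0 i t w =
     card {k. k < y0 i \<and> t < Z (Init_Service i k) w} +
     card {n. \<not> acc i n w \<and> arrival_time Z i n w \<le> t \<and>
              t < arrival_time Z i n w + Z (Fict_Service i n) w}"

definition x_before ::
  "('i primitive \<Rightarrow> 'w \<Rightarrow> real) \<Rightarrow> ('i \<Rightarrow> nat \<Rightarrow> 'w \<Rightarrow> bool) \<Rightarrow> 'i \<Rightarrow> real \<Rightarrow> 'w \<Rightarrow> nat" where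
  "x_before Z acc i t w =
     card {n. acc i n w \<and> arrival_time Z i n w < t \<and>
              t \<le> arrival_time Z i n w + Z (Service i n) w}"

definition y_before ::
  "('i primitive \<Rightarrow> 'w \<Rightarrow> real) \<Rightarrow> ('i \<Rightarrow> nat \<Rightarrow> 'w \<Rightarrow> bool) \<Rightarrow> ('i \<Rightarrow> nat) \<Rightarrow> 'i \<Rightarrow> real \<Rightarrow> 'w \<Rightarrow> nat" where
  "y_before Z acc y0 i t w =
     card {k. k < y0 i \<and> t \<le> Z (Init_Service i k) w} +
     card {n. \<not> acc i n w \<and> arrival_time Z i n w < t \<and>
              t \<le> arrival_time Z i n w + Z (Fict_Service i n) w}"

definition reward_rate ::
  "('i::finite \<Rightarrow> real) \<Rightarrow> ('i primitive \<Rightarrow> 'w \<Rightarrow> real) \<Rightarrow> ('i \<Rightarrow> nat \<Rightarrow> 'w \<Rightarrow> bool) \<Rightarrow> real \<Rightarrow> 'w \<Rightarrow> real" where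
  "reward_rate r Z acc t w = (\<Sum>i\<in>UNIV. r i * real (x_state Z acc i t w))"

section \<open>The penalty policy\<close>

definition Psi :: "real \<Rightarrow> real \<Rightarrow> real \<Rightarrow> real \<Rightarrow> real \<Rightarrow> real \<Rightarrow> real" where
  "Psi \<beta> bi c0 c1 x y = exp (\<beta> * (bi * x / c0)) + exp (\<beta> * (bi * y / c1))"

text \<open>
  If \<open>c1 = 0\<close>, the second exponential is by convention \<open>1\<close> for \<open>y = 0\<close> and infinite for \<open>y > 0\<close>, and
  the penalty condition counts as satisfied.  As \<^term>\<open>Psi\<close> is used only through this condition, the
  convention appears as a separate disjunct (\<^term>\<open>Psi\<close> itself is meaningful for nonzero \<open>c1\<close> only).
\<close>

definition penalty_condition :: "real \<Rightarrow> real \<Rightarrow> real \<Rightarrow> real \<Rightarrow> real \<Rightarrow> real \<Rightarrow> bool" where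
  "penalty_condition \<beta> bi c0 c1 x y \<longleftrightarrow>
     c1 = 0 \<or>
     deriv (\<lambda>u. Psi \<beta> bi c0 c1 u y) x \<le> deriv (\<lambda>v. Psi \<beta> bi c0 c1 x v) y"

text \<open>
  The routing decisions are random variables that almost surely obey the acceptance rule for the state
  found on arrival.  Almost surely arrivals are distinct and do not accumulate, so the rule determines
  all decisions recursively in time; it is only required almost surely because it need not be
  solvable on the exceptional null set.
\<close>

definition penalty_policy ::
  "'w measure \<Rightarrow> ('i::finite \<Rightarrow> real) \<Rightarrow> real \<Rightarrow> real \<Rightarrow> ('i \<Rightarrow> real) \<Rightarrow> ('i \<Rightarrow> real) \<Rightarrow> ('i \<Rightarrow> nat) \<Rightarrow>
   ('i primitive \<Rightarrow> 'w \<Rightarrow> real) \<Rightarrow> ('i \<Rightarrow> nat \<Rightarrow> 'w \<Rightarrow> bool) \<Rightarrow> bool" where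
  "penalty_policy M b cap \<beta> c0 c1 y0 Z acc \<longleftrightarrow>
     (\<forall>i n. acc i n \<in> measurable M (count_space UNIV)) \<and>
     (AE w in M. \<forall>i n. acc i n w \<longleftrightarrow>
        (let t = arrival_time Z i n w in
           penalty_condition \<beta> (b i) (c0 i) (c1 i)
             (real (x_before Z acc i t w)) (real (y_before Z acc y0 i t w)) \<and>
           (\<Sum>j\<in>UNIV. b j * real (x_before Z acc j t w)) + b i \<le> cap))"

end

theory Submission
  imports Defs
begin

text \<open>
  Along the path, a function \<open>F\<close> of the class \<open>i\<close> state satisfies Dynkin's formula
  \<open>E F(t) = F(0) + \<integral>\<^sub>0\<^sup>t E (generator F)(s) ds\<close>.  It is derived one clock at a time: an exponential clock \<open>Z\<close>
  independent of everything else satisfies \<open>E g(Z) = rate * E \<integral>\<^sub>0\<^sup>Z g\<close>, and the state up to the ringing of a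
  clock does not depend on the value of that clock.

  Let \<open>K = 2 exp (\<beta> (1 - \<epsilon>/2))\<close>.  For \<open>\<beta> < 4\<close> the claimed bound is not positive.  For \<open>\<beta> \<ge> 4\<close> and without
  capacity constraint, \<open>\<Psi>\<close> has drift at most \<open>\<mu> (K - \<Psi>)\<close>.  Requests blocked for lack of capacity spoil
  this; comparing with the unconstrained policy, some number \<open>D\<close> of fictitious requests would be in the
  original system.  Instead of coupling the two policies, minimise over \<open>D\<close>: the function
  \<open>F(x, y) = min {\<kappa> D + \<gamma> \<Psi>(x + D, y - D) | D \<le> y}\<close> has drift at most
  \<open>\<kappa> \<lambda> 1{blocked} + \<mu> (\<gamma> K - F)\<close>.  With \<open>\<kappa> = 0\<close> and \<open>\<gamma> = 1\<close> it bounds \<open>E exp (\<beta> b x / c\<^sup>0)\<close> by \<open>K\<close>, hence by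
  convexity the blocking probability.  With \<open>\<kappa> = 1\<close> and \<open>\<gamma> = c\<^sup>1 / (\<beta> b K)\<close> it bounds \<open>E y\<close>, and
  \<open>E (x + y)\<close> is that of an infinite-server queue.
\<close>

section \<open>Independent exponential clocks\<close>

text \<open>States along a path are taken at left limits, hence predictable: the state at the ring
  of a clock is fixed before that ring, as the one-clock formula requires. The obstacle in the drift
  estimate is a request that meets the penalty condition but finds no room: it raises the wrong
  exponential. In the minimum over \<open>D\<close> it is answered by raising \<open>D\<close> by
  one at price \<kappa>, and the minimum is still a function of the current state alone. With
  \<kappa> = 0 blocking costs nothing, so the bound on \<open>E exp (\<beta> b x / c^0)\<close> does
  not presuppose a bound on blocking; this breaks the circle between the two. The constant
  \<open>K\<close> dominates \<open>2 exp \<theta>\<close>, where \<theta> is the tangent point in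
  the departure drift, chosen so that the departures outweigh the arrivals by exactly one \<Psi>;
  \<beta> \<ge> 4 and \<epsilon> < 1/4 give \<theta> \<le> \<beta> (1 - \<epsilon>/2). The \<gamma>
  of the second use makes the weighted exponential of y have slope one where it equals
  \<open>\<gamma> K\<close>, so that, up to blocking, \<open>E y\<close> is at most
  \<open>ln K\<close> in units of \<open>c^1 / (\<beta> b)\<close>. Subtracting the fluid value (1 -
  \<alpha>) \<rho> leaves \<zeta> times that value.\<close>

lemma range_primitives_cases:
  "primitives y0 = range (case_prod Interarrival) \<union> range (case_prod Service) \<union>
     range (case_prod Fict_Service) \<union> (\<lambda>(i, k). Init_Service i k) ` {(i, k). k < y0 i}"
  by (auto simp: primitives_def image_iff)

lemma countable_primitives [simp]: "countable (primitives (y0 :: 'i::finite \<Rightarrow> nat))"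
  unfolding range_primitives_cases by (intro countable_Un countable_image) auto

lemma primitives_simps [simp]:
  "Interarrival i n \<in> primitives y0" "Service i n \<in> primitives y0" "Fict_Service i n \<in> primitives y0"
  "Init_Service i k \<in> primitives y0 \<longleftrightarrow> k < y0 i"
  by (auto simp: primitives_def)

abbreviation (input) coordinate :: "'p \<Rightarrow> ('p \<Rightarrow> real) \<Rightarrow> real" where
  "coordinate \<equiv> (\<lambda>p w. w p)"

locale loss_system =
  fixes lam mu :: "'i::finite \<Rightarrow> real"
    and y0 :: "'i \<Rightarrow> nat"
    and admit :: "'i \<Rightarrow> ('i \<Rightarrow> nat \<times> nat) \<Rightarrow> bool"
  assumes lam_pos: "lam i > 0" and mu_pos: "mu i > 0"
begin

abbreviation Prims :: "'i primitive set" where "Prims \<equiv> primitives y0"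

abbreviation rate :: "'i primitive \<Rightarrow> real" where "rate \<equiv> primitive_rate lam mu"

lemma rate_pos [simp]: "rate p > 0"
  using lam_pos mu_pos by (cases p) simp_all

definition clock :: "'i primitive \<Rightarrow> real measure" where
  "clock p = density lborel (exponential_density (rate p))"

definition Path :: "('i primitive \<Rightarrow> real) measure" where
  "Path = PiM Prims clock"

lemma sets_clock [simp, measurable_cong]: "sets (clock p) = sets borel"
  and space_clock [simp]: "space (clock p) = UNIV"
  by (simp_all add: clock_def)

lemma prob_space_clock: "prob_space (clock p)"
  unfolding clock_def by (rule prob_space_exponential_density) simp

lemma prob_space_Path: "prob_space Path"
  unfolding Path_def by (intro prob_space_PiM prob_space_clock)

lemma sets_Path [measurable_cong]: "sets Path = sets (PiM Prims (\<lambda>_. borel))"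
  unfolding Path_def by (intro sets_PiM_cong) auto

lemma measurable_coordinate [measurable]: "p \<in> Prims \<Longrightarrow> (\<lambda>w. w p) \<in> borel_measurable Path"
  by (rule measurable_compose[OF _ measurable_component_singleton[of p Prims "\<lambda>_. borel"]])
     (auto intro: measurable_ident_sets simp: sets_Path)

lemma measurable_update [measurable]:
  assumes "p \<in> Prims"
  shows "(\<lambda>(u, w). w(p := u)) \<in> borel \<Otimes>\<^sub>M Path \<rightarrow>\<^sub>M Path"
proof -
  have "(\<lambda>(u::real, w). w(p := u)) \<in> borel \<Otimes>\<^sub>M PiM Prims (\<lambda>_. borel) \<rightarrow>\<^sub>M PiM Prims (\<lambda>_. borel)"
    using assms measurable_add_dim[of p Prims "\<lambda>_. borel :: real measure"]
    by (auto simp: insert_absorb case_prod_beta' intro!: measurable_fun_upd)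
  moreover have "sets (borel \<Otimes>\<^sub>M Path) = sets (borel \<Otimes>\<^sub>M PiM Prims (\<lambda>_. borel :: real measure))"
    by (intro sets_pair_measure_cong sets_Path refl)
  ultimately show ?thesis
    using measurable_cong_sets[OF _ sets_Path] by metis
qed

text \<open>The law of \<open>w p\<close> does not depend on the other coordinates, so overwriting
  it by a fresh copy leaves the law of the path unchanged. This is the form in which independence of
  one clock from the rest is used.\<close>

lemma nn_integral_resample:
  assumes p: "p \<in> Prims" and [measurable]: "f \<in> borel_measurable Path"
  shows "(\<integral>\<^sup>+w. f w \<partial>Path) = (\<integral>\<^sup>+w. \<integral>\<^sup>+u. f (w(p := u)) \<partial>clock p \<partial>Path)"
proof -
  define R where "R = PiM (Prims - {p}) clock"
  interpret C: prob_space "clock p" by (rule prob_space_clock)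
  interpret R: prob_space R unfolding R_def by (intro prob_space_PiM prob_space_clock)
  interpret P: pair_sigma_finite "clock p" R ..
  have ins: "insert p (Prims - {p}) = Prims" using p by auto
  have upd: "(\<lambda>(u, w). w(p := u)) \<in> clock p \<Otimes>\<^sub>M R \<rightarrow>\<^sub>M Path"
    using measurable_compose[OF measurable_pair_swap' measurable_add_dim[of p "Prims - {p}" clock]]
    unfolding R_def Path_def ins by (simp add: case_prod_beta')
  have Path: "Path = distr (clock p \<Otimes>\<^sub>M R) Path (\<lambda>(u, w). w(p := u))"
    using distr_pair_PiM_eq_PiM[of "Prims - {p}" clock p] prob_space_clock
    unfolding R_def Path_def ins by simp
  have *: "(\<integral>\<^sup>+w. g w \<partial>Path) = (\<integral>\<^sup>+w. \<integral>\<^sup>+u. g (w(p := u)) \<partial>clock p \<partial>R)"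
    if g[measurable]: "g \<in> borel_measurable Path" for g
  proof -
    have "(\<integral>\<^sup>+w. g w \<partial>Path) = (\<integral>\<^sup>+z. g (case z of (u, w) \<Rightarrow> w(p := u)) \<partial>(clock p \<Otimes>\<^sub>M R))"
      by (subst Path, subst nn_integral_distr[OF upd]) simp_all
    also have "\<dots> = (\<integral>\<^sup>+w. \<integral>\<^sup>+u. g (w(p := u)) \<partial>clock p \<partial>R)"
      using measurable_compose[OF upd g] by (subst P.nn_integral_snd[symmetric]) auto
    finally show ?thesis .
  qed
  have meas: "(\<lambda>w. \<integral>\<^sup>+u. f (w(p := u)) \<partial>clock p) \<in> borel_measurable Path"
  proof -
    have "(\<lambda>z. f (case z of (u, w) \<Rightarrow> w(p := u))) \<in> borel_measurable (borel \<Otimes>\<^sub>M Path)"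
      by (rule measurable_compose[OF measurable_update[OF p]]) measurable
    then have "(\<lambda>(w, u). f (w(p := u))) \<in> borel_measurable (Path \<Otimes>\<^sub>M clock p)"
      by (subst (asm) measurable_pair_swap_iff)
         (simp add: case_prod_beta' cong: measurable_cong_sets)
    then show ?thesis
      by (intro C.borel_measurable_nn_integral) 
  qed
  \<comment> \<open>The inner integral no longer depends on \<open>w p\<close>, so the second
    integration over \<open>clock p\<close> contributes total mass one.\<close>
  show ?thesis
    by (subst *[OF assms(2)], subst *[OF meas]) (simp add: C.emeasure_space_1[simplified])
qed

text \<open>A null set can be checked on the lines along one coordinate, where a single exponential
  variable is all that is random.\<close>

lemma AE_resample:
  assumes p: "p \<in> Prims" and P[measurable]: "Measurable.pred Path P"
    and ae: "\<And>w. w \<in> space Path \<Longrightarrow> AE u in clock p. P (w(p := u))"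
  shows "AE w in Path. P w"
proof -
  have "(\<integral>\<^sup>+w. indicator {w \<in> space Path. \<not> P w} w \<partial>Path) = 
      (\<integral>\<^sup>+w. \<integral>\<^sup>+u. indicator {w \<in> space Path. \<not> P w} (w(p := u)) \<partial>clock p \<partial>Path)"
    by (rule nn_integral_resample[OF p]) measurable
  also have "\<dots> = (\<integral>\<^sup>+w. 0 \<partial>Path)"
  proof (rule nn_integral_cong)
    fix w assume w: "w \<in> space Path"
    have "(\<integral>\<^sup>+u. indicator {w \<in> space Path. \<not> P w} (w(p := u)) \<partial>clock p) = (\<integral>\<^sup>+u. 0 \<partial>clock p)"
      using ae[OF w] by (intro nn_integral_cong_AE) (auto simp: indicator_def)
    then show "(\<integral>\<^sup>+u. indicator {w \<in> space Path. \<not> P w} (w(p := u)) \<partial>clock p) = (0::ennreal)"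
      by simp
  qed
  finally have "emeasure Path {w \<in> space Path. \<not> P w} = 0"
    by (subst (asm) nn_integral_indicator) auto
  then show ?thesis
    by (intro AE_I[OF subset_refl]) auto
qed

lemma AE_clock_pos: "AE u in clock p. 0 < u"
proof -
  have "AE u in lborel. u \<noteq> (0::real)" by (rule AE_lborel_singleton)
  then show ?thesis
    unfolding clock_def
    by (subst AE_density) (auto simp: exponential_density_def elim!: eventually_mono)
qed

lemma AE_clock_neq: "AE u in clock p. u \<noteq> c"
proof -
  have "AE u in lborel. u \<noteq> c" by (rule AE_lborel_singleton)
  then show ?thesis
    unfolding clock_def by (subst AE_density) (auto elim!: eventually_mono)
qed

lemma AE_positive: "AE w in Path. \<forall>q\<in>Prims. 0 < w q"
proof (subst AE_ball_countable)
  show "countable Prims" by simp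
  show "\<forall>q\<in>Prims. AE w in Path. 0 < w q"
  proof
    fix q assume q[measurable]: "q \<in> Prims"
    show "AE w in Path. 0 < w q"
      by (rule AE_resample[OF q]) (use AE_clock_pos in auto)
  qed
qed

lemma emeasure_clock_tail:
  assumes "0 < u"
  shows "emeasure (clock p) {u..} = ennreal (exp (- rate p * u))"
proof -
  interpret prob_space "clock p" by (rule prob_space_clock)
  have "distributed (clock p) lborel (\<lambda>x. x) (exponential_density (rate p))"
    unfolding distributed_def by (auto simp: clock_def distr_id2)
  from exponential_distributedD_gt[OF this, of u] assms
  have "measure (clock p) {u<..} = exp (- rate p * u)"
    by (simp add: greaterThan_def mult.commute)
  moreover have "emeasure (clock p) {u..} = emeasure (clock p) {u<..}"
    using AE_clock_neq[of u p] by (intro emeasure_eq_AE) (auto elim!: eventually_mono)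
  ultimately show ?thesis by (simp add: emeasure_eq_measure)
qed

text \<open>The exponential density at \<open>u\<close> is \<open>rate p\<close> times the tail
  probability of \<open>{u..}\<close>: ringing at \<open>u\<close> is the rate times still running
  at \<open>u\<close>. Condition \<open>nonant\<close> makes \<open>H u\<close> insensitive to the
  value of clock \<open>p\<close> as long as that clock runs at least until
  \<open>u\<close>.\<close>

lemma compensator:
  fixes H :: "real \<Rightarrow> ('i primitive \<Rightarrow> real) \<Rightarrow> ennreal"
  assumes p: "p \<in> Prims"
    and H[measurable]: "(\<lambda>(u, w). H u w) \<in> borel_measurable (borel \<Otimes>\<^sub>M Path)"
    and nonant: "\<And>u w. \<lbrakk>w \<in> space Path; \<forall>q\<in>Prims. 0 < w q; 0 < u; u \<le> w p\<rbrakk> \<Longrightarrow> H u (w(p := u)) = H u w"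
  shows "(\<integral>\<^sup>+w. H (w p) w \<partial>Path) =
    (\<integral>\<^sup>+w. \<integral>\<^sup>+u. ennreal (rate p) * H u w * indicator {0<..w p} u \<partial>lborel \<partial>Path)"
proof -
  interpret Path: prob_space Path by (rule prob_space_Path)
  interpret pair_sigma_finite lborel Path ..
  note p[measurable]
  have H'[measurable]: "(\<lambda>(u, w). H u (w(p := u))) \<in> borel_measurable (borel \<Otimes>\<^sub>M Path)"
    using measurable_compose[OF measurable_Pair[OF measurable_fst measurable_update[OF p]] H]
    by (simp add: case_prod_beta')
  have "(\<integral>\<^sup>+w. H (w p) w \<partial>Path) = (\<integral>\<^sup>+w. \<integral>\<^sup>+u. H u (w(p := u)) \<partial>clock p \<partial>Path)"
    by (subst nn_integral_resample[OF p]) auto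
  also have "\<dots> = (\<integral>\<^sup>+w. \<integral>\<^sup>+u. exponential_density (rate p) u * H u (w(p := u)) \<partial>lborel \<partial>Path)"
  proof (rule nn_integral_cong)
    fix w assume [measurable]: "w \<in> space Path"
    have [measurable]: "(\<lambda>u. H u (w(p := u))) \<in> borel_measurable borel"
      using measurable_compose[OF measurable_Pair2'[of w Path borel] H'] by simp
    show "(\<integral>\<^sup>+u. H u (w(p := u)) \<partial>clock p) = 
      (\<integral>\<^sup>+u. exponential_density (rate p) u * H u (w(p := u)) \<partial>lborel)"
      unfolding clock_def by (subst nn_integral_density) auto
  qed
  also have "\<dots> = (\<integral>\<^sup>+u. \<integral>\<^sup>+w. exponential_density (rate p) u * H u (w(p := u)) \<partial>Path \<partial>lborel)"
    by (rule Fubini') measurable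
  also have "\<dots> = (\<integral>\<^sup>+u. \<integral>\<^sup>+w. ennreal (rate p) * H u w * indicator {0<..w p} u \<partial>Path \<partial>lborel)"
  proof (rule nn_integral_cong_AE, rule eventually_mono[OF AE_lborel_singleton[of "0::real"]])
    fix u :: real assume "u \<noteq> 0"
    have [measurable]: "(\<lambda>w. H u w) \<in> borel_measurable Path" 
      using measurable_compose[OF measurable_Pair1'[of u borel Path] H] by simp
    have [measurable]: "(\<lambda>w. H u (w(p := u))) \<in> borel_measurable Path" 
      using measurable_compose[OF measurable_Pair1'[of u borel Path] H'] by simp
    show "(\<integral>\<^sup>+w. exponential_density (rate p) u * H u (w(p := u)) \<partial>Path) =
       (\<integral>\<^sup>+w. ennreal (rate p) * H u w * indicator {0<..w p} u \<partial>Path)"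
    proof (cases "0 < u")
      case False
      with \<open>u \<noteq> 0\<close> show ?thesis by (simp add: exponential_density_def)
    next
      \<comment> \<open>On the event \<open>u \<le> w p\<close> the clock value may be replaced by
        \<open>u\<close>. What remains depends on \<open>w p\<close> only through that event, and
        resampling turns the event into the tail probability.\<close>
      case True
      have "(\<integral>\<^sup>+w. ennreal (rate p) * H u w * indicator {0<..w p} u \<partial>Path) =
        (\<integral>\<^sup>+w. ennreal (rate p) * H u (w(p := u)) * indicator {u..} (w p) \<partial>Path)"
        using AE_positive AE_space True
        by (intro nn_integral_cong_AE, elim AE_mp, intro AE_I2 impI)
           (auto simp: indicator_def nonant)
      also have "\<dots> = (\<integral>\<^sup>+w. \<integral>\<^sup>+v. ennreal (rate p) * H u (w(p := u)) * indicator {u..} v \<partial>clock p \<partial>Path)"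
        by (subst nn_integral_resample[OF p]) auto
      also have "\<dots> = (\<integral>\<^sup>+w. ennreal (rate p) * H u (w(p := u)) * ennreal (exp (- rate p * u)) \<partial>Path)"
        by (intro nn_integral_cong, subst nn_integral_cmult_indicator)
           (simp_all only: emeasure_clock_tail[OF True] sets_clock atLeast_borel)
      also have "\<dots> = (\<integral>\<^sup>+w. exponential_density (rate p) u * H u (w(p := u)) \<partial>Path)"
        using True less_imp_le[OF rate_pos[of p]]
        by (intro nn_integral_cong) (simp add: exponential_density_def ennreal_mult' mult_ac)
      finally show ?thesis ..
    qed
  qed
  also have "\<dots> = (\<integral>\<^sup>+w. \<integral>\<^sup>+u. ennreal (rate p) * H u w * indicator {0<..w p} u \<partial>lborel \<partial>Path)"
  proof (rule Fubini'[symmetric])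
    have "(\<lambda>(u, w). ennreal (rate p) * H u w * (if 0 < u \<and> u \<le> w p then 1 else 0))
        \<in> borel_measurable (lborel \<Otimes>\<^sub>M Path)"
      by measurable
    then show "(\<lambda>(u, w). ennreal (rate p) * H u w * indicator {0<..w p} u)
        \<in> borel_measurable (lborel \<Otimes>\<^sub>M Path)"
      by (rule measurable_cong[THEN iffD1, rotated]) (auto simp: indicator_def)
  qed
  finally show ?thesis .
qed

end

section \<open>The controlled path\<close>

abbreviation arrival :: "'i \<Rightarrow> nat \<Rightarrow> ('i primitive \<Rightarrow> real) \<Rightarrow> real" where
  "arrival i n w \<equiv> arrival_time coordinate i n w"

text \<open>Left limits are used: a request whose service ends exactly at \<open>s\<close> still
  counts. This keeps the state at the ring of a clock insensitive to the value of the clock.\<close>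

definition occupancy ::
  "('i \<Rightarrow> nat \<Rightarrow> ('i primitive \<Rightarrow> real) \<Rightarrow> bool) \<Rightarrow> ('i \<Rightarrow> nat) \<Rightarrow> real \<Rightarrow> ('i primitive \<Rightarrow> real) \<Rightarrow> 'i \<Rightarrow> nat \<times> nat"
  where "occupancy acc y0 s w j = (x_before coordinate acc j s w, y_before coordinate acc y0 j s w)"

fun start :: "'i primitive \<Rightarrow> ('i primitive \<Rightarrow> real) \<Rightarrow> real" where
  "start (Interarrival i n) w = (\<Sum>k<n. w (Interarrival i k))"
| "start (Service i n) w = arrival i n w"
| "start (Fict_Service i n) w = arrival i n w"
| "start (Init_Service i k) w = 0"

definition ring :: "'i primitive \<Rightarrow> ('i primitive \<Rightarrow> real) \<Rightarrow> real" where
  "ring p w = start p w + w p"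

lemma ring_Interarrival [simp]: "ring (Interarrival i n) w = arrival i n w"
  unfolding ring_def arrival_time_def by (simp flip: lessThan_Suc_atMost)

lemma start_update: "start p (w(p := u)) = start p w"
  by (cases p) (auto simp: arrival_time_def)

lemma arrival_update:
  assumes "\<And>n. n \<le> m \<Longrightarrow> p \<noteq> Interarrival j n"
  shows "arrival j m (w(p := u)) = arrival j m w"
  using assms unfolding arrival_time_def by (intro sum.cong) auto

context loss_system
begin

lemma arrival_mono:
  assumes "\<forall>q\<in>Prims. 0 < w q" "n \<le> m"
  shows "arrival j n w \<le> arrival j m w"
  unfolding arrival_time_def using assms
  by (intro sum_mono2) (auto intro!: less_imp_le)

lemma arrival_strict_mono:
  assumes "\<forall>q\<in>Prims. 0 < w q" "n < m"
  shows "arrival j n w < arrival j m w"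
  unfolding arrival_time_def using assms
  by (intro sum_strict_mono2[of _ _ m]) (auto intro!: less_imp_le)

lemma arrival_pos:
  assumes "\<forall>q\<in>Prims. 0 < w q"
  shows "0 < arrival j n w"
  unfolding arrival_time_def using assms by (intro sum_pos) auto

lemma start_nonneg:
  assumes "\<forall>q\<in>Prims. 0 < w q"
  shows "0 \<le> start p w"
  using assms arrival_pos[OF assms] by (cases p) (simp_all add: sum_nonneg less_imp_le)

text \<open>
  Whether a request is accepted depends only on earlier arrivals, so the iterates of the acceptance
  rule stabilise on paths whose arrivals do not accumulate; on other paths \<open>routing\<close> is a junk value.
\<close>

primrec picard :: "nat \<Rightarrow> 'i \<Rightarrow> nat \<Rightarrow> ('i primitive \<Rightarrow> real) \<Rightarrow> bool" where
  "picard 0 = (\<lambda>i n w. False)"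
| "picard (Suc k) = (\<lambda>i n w. admit i (occupancy (picard k) y0 (arrival i n w) w))"

definition routing :: "'i \<Rightarrow> nat \<Rightarrow> ('i primitive \<Rightarrow> real) \<Rightarrow> bool" where
  "routing i n w \<longleftrightarrow> (\<exists>N. \<forall>k\<ge>N. picard k i n w)"

abbreviation state :: "real \<Rightarrow> ('i primitive \<Rightarrow> real) \<Rightarrow> 'i \<Rightarrow> nat \<times> nat" where
  "state \<equiv> occupancy routing y0"

context
  fixes p :: "'i primitive" and w :: "'i primitive \<Rightarrow> real" and u e :: real
  assumes p: "p \<in> Prims" and pos: "\<forall>q\<in>Prims. 0 < w q" and u: "0 < u"
    and e: "e = start p w + min (w p) u"
begin

text \<open>In this context \<open>e\<close> is the earlier of the two rings of clock
  \<open>p\<close>, with its old value \<open>w p\<close> and its new value \<open>u\<close>. An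
  arrival whose time involves clock \<open>p\<close> comes no earlier than the ring of
  \<open>p\<close> on either path, hence not before \<open>e\<close>.\<close>

lemma arrival_before:
  assumes "arrival j m w < e \<or> arrival j m (w(p := u)) < e"
  shows "arrival j m (w(p := u)) = arrival j m w"
proof (rule arrival_update)
  fix n assume n: "n \<le> m" 
  show "p \<noteq> Interarrival j n"
  proof
    assume pn: "p = Interarrival j n"
    have pos': "\<forall>q\<in>Prims. 0 < (w(p := u)) q" using pos u by auto
    have "ring p w \<le> arrival j m w" using arrival_mono[OF pos n] by (simp add: pn)
    moreover have "ring p (w(p := u)) \<le> arrival j m (w(p := u))"
      using arrival_mono[OF pos' n] unfolding pn ring_Interarrival .
    ultimately show False using assms e by (auto simp: ring_def start_update)
  qed
qed

lemma occupancy_before: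
  assumes acc: "\<And>j m. arrival j m w < e \<Longrightarrow> acc j m (w(p := u)) = acc j m w" and s: "s \<le> e"
  shows "occupancy acc y0 s (w(p := u)) = occupancy acc y0 s w"
proof -
  have srv: "(s \<le> arrival j m (w(p := u)) + (w(p := u)) q) = (s \<le> arrival j m w + w q)"
    if "arrival j m w < e" and q: "q = Service j m \<or> q = Fict_Service j m" for j m q
  proof (cases "q = p")
    case False
    then show ?thesis using arrival_before[of j m] that by simp
  next
    \<comment> \<open>If the changed clock is the service clock of this very request,
      \<open>s \<le> e\<close> makes both sides true: its service has not ended before
      \<open>s\<close> on either path.\<close>
    case True
    then have "start p w = arrival j m w" using q by auto
    then show ?thesis using arrival_before[of j m] that s e True by auto
  qed
  have arr: "(arrival j m (w(p := u)) < s) = (arrival j m w < s)" for j m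
    using arrival_before[of j m] s by fastforce
  have x: "{n. acc j n (w(p := u)) \<and> arrival j n (w(p := u)) < s \<and>
        s \<le> arrival j n (w(p := u)) + (w(p := u)) (Service j n)} =
      {n. acc j n w \<and> arrival j n w < s \<and> s \<le> arrival j n w + w (Service j n)}" for j
  proof (intro Collect_cong)
    fix n show "(acc j n (w(p := u)) \<and> arrival j n (w(p := u)) < s \<and>
        s \<le> arrival j n (w(p := u)) + (w(p := u)) (Service j n)) \<longleftrightarrow>
      (acc j n w \<and> arrival j n w < s \<and> s \<le> arrival j n w + w (Service j n))"
      using srv[of j n "Service j n"] arr[of j n] acc[of j n] s by (cases "arrival j n w < s") auto
  qed
  have y: "{n. \<not> acc j n (w(p := u)) \<and> arrival j n (w(p := u)) < s \<and>
        s \<le> arrival j n (w(p := u)) + (w(p := u)) (Fict_Service j n)} =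
      {n. \<not> acc j n w \<and> arrival j n w < s \<and> s \<le> arrival j n w + w (Fict_Service j n)}" for j
  proof (intro Collect_cong)
    fix n show "(\<not> acc j n (w(p := u)) \<and> arrival j n (w(p := u)) < s \<and>
        s \<le> arrival j n (w(p := u)) + (w(p := u)) (Fict_Service j n)) \<longleftrightarrow>
      (\<not> acc j n w \<and> arrival j n w < s \<and> s \<le> arrival j n w + w (Fict_Service j n))"
      using srv[of j n "Fict_Service j n"] arr[of j n] acc[of j n] s by (cases "arrival j n w < s") auto
  qed
  have z: "{k. k < y0 j \<and> s \<le> (w(p := u)) (Init_Service j k)} = {k. k < y0 j \<and> s \<le> w (Init_Service j k)}" for j
    using s e by auto
  show ?thesis
    unfolding occupancy_def x_before_def y_before_def x y z ..
qed

text \<open>An arrival before \<open>e\<close> is decided from the occupancy at its time, which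
  involves only earlier arrivals. The induction runs on the iterate, so the claim also covers paths
  with accumulating arrivals.\<close>

lemma picard_before:
  "arrival i n w < e \<Longrightarrow> picard k i n (w(p := u)) = picard k i n w"
proof (induction k arbitrary: i n)
  case (Suc k)
  have "occupancy (picard k) y0 (arrival i n w) (w(p := u)) = occupancy (picard k) y0 (arrival i n w) w"
    using less_imp_le[OF Suc.prems] by (intro occupancy_before Suc.IH)
  then show ?case by (simp only: picard.simps arrival_before[OF disjI1, OF Suc.prems])
qed simp

lemma routing_before: "arrival i n w < e \<Longrightarrow> routing i n (w(p := u)) = routing i n w"
  unfolding routing_def using picard_before by simp

lemma state_before: "s \<le> e \<Longrightarrow> state s (w(p := u)) = state s w"
  by (intro occupancy_before routing_before)

end

section \<open>Measurability of the controlled path\<close>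

lemma measurable_arrival [measurable]: "(\<lambda>w. arrival i n w) \<in> borel_measurable Path"
  unfolding arrival_time_def by measurable

lemma measurable_start [measurable]: "(\<lambda>w. start p w) \<in> borel_measurable Path"
proof (cases p)
  case (Interarrival i n)
  show ?thesis unfolding Interarrival start.simps by measurable
qed simp_all

lemma measurable_ring [measurable]: "p \<in> Prims \<Longrightarrow> (\<lambda>w. ring p w) \<in> borel_measurable Path"
  unfolding ring_def by measurable

text \<open>There are finitely many classes, so occupancy vectors form a countable type and
  preimages of single vectors suffice. With \<open>count_space UNIV\<close> as target, every
  function of the state is then measurable.\<close>

lemma measurable_vector_count_space:
  fixes X :: "'i \<Rightarrow> 'x \<Rightarrow> nat \<times> nat"
  assumes "\<And>j. X j \<in> N \<rightarrow>\<^sub>M count_space UNIV"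
  shows "(\<lambda>x j. X j x) \<in> N \<rightarrow>\<^sub>M count_space UNIV"
  unfolding measurable_count_space_eq2_countable
proof safe
  note [measurable] = assms
  fix v :: "'i \<Rightarrow> nat \<times> nat"
  have "(\<lambda>x j. X j x) -` {v} \<inter> space N = {x \<in> space N. \<forall>j\<in>UNIV. X j x = v j}"
    by auto
  also have "\<dots> \<in> sets N" by measurable
  finally show "(\<lambda>x j. X j x) -` {v} \<inter> space N \<in> sets N" .
qed simp_all

lemma measurable_occupancy:
  assumes acc[measurable]: "\<And>i n. Measurable.pred Path (acc i n)"
    and f[measurable]: "f \<in> borel_measurable N" and g[measurable]: "g \<in> N \<rightarrow>\<^sub>M Path"
  shows "(\<lambda>x. occupancy acc y0 (f x) (g x)) \<in> N \<rightarrow>\<^sub>M count_space UNIV"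
proof -
  have [measurable]: "(\<lambda>x. g x q) \<in> borel_measurable N" if "q \<in> Prims" for q
    using measurable_compose[OF g measurable_coordinate[OF that]] .
  have [measurable]: "(\<lambda>x. arrival i n (g x)) \<in> borel_measurable N" for i n
    using measurable_compose[OF g measurable_arrival] .
  have x: "(\<lambda>x. x_before coordinate acc j (f x) (g x)) \<in> N \<rightarrow>\<^sub>M count_space UNIV" for j
    unfolding x_before_def by (rule measurable_card) measurable
  have i: "(\<lambda>x. card {k. k < y0 j \<and> f x \<le> g x (Init_Service j k)}) \<in> N \<rightarrow>\<^sub>M count_space UNIV" for j
  proof (rule measurable_card)
    fix k show "{x \<in> space N. k \<in> {k. k < y0 j \<and> f x \<le> g x (Init_Service j k)}} \<in> sets N"
      by (cases "k < y0 j") auto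
  qed
  have c: "(\<lambda>x. card {n. \<not> acc j n (g x) \<and> arrival j n (g x) < f x \<and> f x \<le> arrival j n (g x) + g x (Fict_Service j n)})
      \<in> N \<rightarrow>\<^sub>M count_space UNIV" for j
    by (rule measurable_card) measurable
  have y: "(\<lambda>x. y_before coordinate acc y0 j (f x) (g x)) \<in> N \<rightarrow>\<^sub>M count_space UNIV" for j
    unfolding y_before_def using i c by measurable
  have "(\<lambda>x. occupancy acc y0 (f x) (g x) j) \<in> N \<rightarrow>\<^sub>M count_space UNIV" for j
    unfolding occupancy_def using x y by measurable
  from measurable_vector_count_space[OF this] show ?thesis by simp
qed

lemma measurable_picard [measurable]: "Measurable.pred Path (picard k i n)"
proof (induction k arbitrary: i n)
  case (Suc k)
  have "(\<lambda>w. occupancy (picard k) y0 (arrival i n w) w) \<in> Path \<rightarrow>\<^sub>M count_space UNIV"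
    by (intro measurable_occupancy Suc) measurable
  then show ?case unfolding picard.simps by measurable
qed simp

lemma measurable_routing [measurable]: "Measurable.pred Path (routing i n)"
  unfolding routing_def by measurable

lemma measurable_state [measurable]:
  "f \<in> borel_measurable N \<Longrightarrow> g \<in> N \<rightarrow>\<^sub>M Path \<Longrightarrow> (\<lambda>x. state (f x) (g x)) \<in> N \<rightarrow>\<^sub>M count_space UNIV"
  by (intro measurable_occupancy measurable_routing)

end

section \<open>Existence and uniqueness of the routing decisions\<close>

lemma occupancy_cong:
  assumes "\<And>j m. arrival j m w < s \<Longrightarrow> acc j m w = acc' j m w"
  shows "occupancy acc y0 s w = occupancy acc' y0 s w"
proof -
  have "{n. acc j n w \<and> arrival j n w < s \<and> s \<le> arrival j n w + w (Service j n)} =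
      {n. acc' j n w \<and> arrival j n w < s \<and> s \<le> arrival j n w + w (Service j n)}"
    "{n. \<not> acc j n w \<and> arrival j n w < s \<and> s \<le> arrival j n w + w (Fict_Service j n)} =
      {n. \<not> acc' j n w \<and> arrival j n w < s \<and> s \<le> arrival j n w + w (Fict_Service j n)}" for j
    using assms by auto
  then show ?thesis unfolding occupancy_def x_before_def y_before_def by presburger
qed

definition locally_finite :: "('i primitive \<Rightarrow> real) \<Rightarrow> bool" where
  "locally_finite w \<longleftrightarrow> (\<forall>i t. finite {n. arrival i n w < t})"

text \<open>At the arrival time of a request, the cardinality of this set is the rank of the request
  among the requests of all classes; the arguments about decisions are inductions tied to this
  rank.\<close>

definition arrivals_before :: "real \<Rightarrow> ('i primitive \<Rightarrow> real) \<Rightarrow> ('i \<times> nat) set" where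
  "arrivals_before t w = {(j, m). arrival j m w < t}"

lemma finite_arrivals_before:
  fixes w :: "'i::finite primitive \<Rightarrow> real"
  assumes "locally_finite w"
  shows "finite (arrivals_before t w)"
proof -
  have "arrivals_before t w = (SIGMA j:UNIV. {m. arrival j m w < t})"
    by (auto simp: arrivals_before_def)
  then show ?thesis using assms by (simp add: locally_finite_def)
qed

lemma card_arrivals_before_less:
  fixes w :: "'i::finite primitive \<Rightarrow> real"
  assumes "locally_finite w" "arrival j m w < t"
  shows "card (arrivals_before (arrival j m w) w) < card (arrivals_before t w)"
proof (rule psubset_card_mono[OF finite_arrivals_before[OF assms(1)]])
  have "(j, m) \<in> arrivals_before t w - arrivals_before (arrival j m w) w"
    using assms(2) by (simp add: arrivals_before_def)
  moreover have "arrivals_before (arrival j m w) w \<subseteq> arrivals_before t w"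
    using assms(2) by (auto simp: arrivals_before_def)
  ultimately show "arrivals_before (arrival j m w) w \<subset> arrivals_before t w" by blast
qed

context loss_system
begin

text \<open>Requests with fewer than \<open>k\<close> predecessors are settled after
  \<open>k\<close> iterations, because the occupancy they find involves only requests of strictly
  smaller rank.\<close>

lemma picard_stable:
  assumes "locally_finite w"
  shows "card (arrivals_before (arrival i n w) w) < k \<Longrightarrow> picard (Suc k) i n w = picard k i n w"
proof (induction k arbitrary: i n)
  case (Suc k)
  have "occupancy (picard (Suc k)) y0 (arrival i n w) w = occupancy (picard k) y0 (arrival i n w) w"
    using Suc.prems by (intro occupancy_cong Suc.IH) (auto dest!: card_arrivals_before_less[OF assms])
  then show ?case by (subst (1 2) picard.simps) simp
qed simp

lemma picard_eq_routing:
  assumes w: "locally_finite w" and k: "card (arrivals_before (arrival i n w) w) < k"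
  shows "picard k i n w = routing i n w"
proof -
  have "picard m i n w = picard k i n w" if "k \<le> m" for m
    using that by (induction m rule: dec_induct) (use picard_stable[OF w] k in auto)
  then show ?thesis unfolding routing_def by (metis max.cobounded1 max.cobounded2)
qed

lemma routing_admit:
  assumes w: "locally_finite w"
  shows "routing i n w \<longleftrightarrow> admit i (state (arrival i n w) w)"
proof -
  define k where "k = Suc (card (arrivals_before (arrival i n w) w))"
  have "routing i n w = picard (Suc k) i n w"
    by (rule picard_eq_routing[OF w, symmetric]) (simp add: k_def)
  also have "\<dots> \<longleftrightarrow> admit i (occupancy (picard k) y0 (arrival i n w) w)" by simp
  also have "occupancy (picard k) y0 (arrival i n w) w = state (arrival i n w) w"
    by (intro occupancy_cong picard_eq_routing[OF w])
       (auto dest!: card_arrivals_before_less[OF w] simp: k_def)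
  finally show ?thesis .
qed

text \<open>The rule refers only to decisions of smaller rank, so two solutions agree by induction
  on the rank.\<close>

lemma routing_unique:
  assumes w: "locally_finite w"
    and acc: "\<And>i n. acc i n w \<longleftrightarrow> admit i (occupancy acc y0 (arrival i n w) w)"
  shows "acc i n w = routing i n w"
proof (induction "card (arrivals_before (arrival i n w) w)" arbitrary: i n rule: less_induct)
  case less
  have "occupancy acc y0 (arrival i n w) w = state (arrival i n w) w"
    by (intro occupancy_cong less card_arrivals_before_less[OF w])
  then show ?case using acc routing_admit[OF w] by simp
qed

section \<open>Exponential moments of the number of requests\<close>

lemma nn_integral_clock_exp:
  assumes "0 \<le> c"
  shows "(\<integral>\<^sup>+u. ennreal (exp (- c * u)) \<partial>clock p) = ennreal (rate p / (rate p + c))"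
proof -
  have r: "0 < rate p" "0 < rate p + c" using assms rate_pos[of p] by linarith+
  interpret prob_space "density lborel (exponential_density (rate p + c))"
    by (rule prob_space_exponential_density) (rule r)
  have "(\<integral>\<^sup>+u. ennreal (exp (- c * u)) \<partial>clock p) =
      (\<integral>\<^sup>+u. ennreal (exponential_density (rate p) u) * ennreal (exp (- c * u)) \<partial>lborel)"
    unfolding clock_def by (subst nn_integral_density) auto
  also have "\<dots> = (\<integral>\<^sup>+u. ennreal (rate p / (rate p + c)) * ennreal (exponential_density (rate p + c) u) \<partial>lborel)"
  proof (rule nn_integral_cong)
    fix u :: real
    have "exponential_density (rate p) u * exp (- c * u) =
        rate p / (rate p + c) * exponential_density (rate p + c) u"
    proof -
      have "exp (- u * rate p) * exp (- c * u) = exp (- u * (rate p + c))"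
        by (simp add: mult_exp_exp algebra_simps)
      then show ?thesis using r by (simp add: exponential_density_def)
    qed
    then show "ennreal (exponential_density (rate p) u) * ennreal (exp (- c * u)) =
        ennreal (rate p / (rate p + c)) * ennreal (exponential_density (rate p + c) u)"
      using r by (subst (1 2) ennreal_mult[symmetric]) (simp_all add: less_imp_le)
  qed
  also have "\<dots> = ennreal (rate p / (rate p + c)) * (\<integral>\<^sup>+u. ennreal (exponential_density (rate p + c) u) \<partial>lborel)"
    by (rule nn_integral_cmult) auto
  also have "(\<integral>\<^sup>+u. ennreal (exponential_density (rate p + c) u) \<partial>lborel) = 1"
    using emeasure_space_1 by (subst (asm) emeasure_density) (auto simp: space_density)
  finally show ?thesis by simp
qed

lemma arrival_Suc: "arrival i (Suc n) w = arrival i n w + w (Interarrival i (Suc n))"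
  by (simp add: arrival_time_def)

text \<open>The Laplace transform of an Erlang variable, obtained by peeling off the last
  interarrival time with \<open>nn_integral_resample\<close>.\<close>

lemma nn_integral_exp_arrival:
  assumes c: "0 \<le> c"
  shows "(\<integral>\<^sup>+w. ennreal (exp (- c * arrival i n w)) \<partial>Path) = ennreal ((lam i / (lam i + c)) ^ Suc n)"
proof (induction n)
  case 0
  interpret prob_space Path by (rule prob_space_Path)
  show ?case
    using nn_integral_clock_exp[OF c, of "Interarrival i 0"]
    by (subst nn_integral_resample[of "Interarrival i 0"])
       (simp_all add: arrival_time_def emeasure_space_1)
next
  case (Suc n)
  have r: "0 \<le> lam i / (lam i + c)" using c lam_pos[of i] by simp
  have upd: "arrival i n (w(Interarrival i (Suc n) := u)) = arrival i n w" for w u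
    by (rule arrival_update) auto
  have "(\<integral>\<^sup>+w. ennreal (exp (- c * arrival i (Suc n) w)) \<partial>Path) =
      (\<integral>\<^sup>+w. ennreal (exp (- c * arrival i n w)) * ennreal (exp (- c * w (Interarrival i (Suc n)))) \<partial>Path)"
    by (intro nn_integral_cong)
       (simp add: arrival_Suc algebra_simps exp_add[symmetric] ennreal_mult[symmetric])
  also have "\<dots> = (\<integral>\<^sup>+w. \<integral>\<^sup>+u. ennreal (exp (- c * arrival i n w)) * ennreal (exp (- c * u))
      \<partial>clock (Interarrival i (Suc n)) \<partial>Path)"
    by (subst nn_integral_resample[of "Interarrival i (Suc n)"]) (simp_all add: upd)
  also have "\<dots> = (\<integral>\<^sup>+w. ennreal (exp (- c * arrival i n w)) * ennreal (lam i / (lam i + c)) \<partial>Path)"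
  proof -
    have "(\<lambda>u. ennreal (exp (- c * u))) \<in> borel_measurable (clock (Interarrival i (Suc n)))"
      by (subst measurable_cong_sets[OF sets_clock refl]) measurable
    from nn_integral_cmult[OF this] show ?thesis
      using nn_integral_clock_exp[OF c, of "Interarrival i (Suc n)"] by simp
  qed
  also have "\<dots> = ennreal ((lam i / (lam i + c)) ^ Suc (Suc n))"
  proof -
    have "(\<lambda>w. ennreal (exp (- c * arrival i n w))) \<in> borel_measurable Path" by measurable
    from nn_integral_multc[OF this] show ?thesis
      using r by (simp only: Suc) (simp add: ennreal_mult'[symmetric] mult_ac)
  qed
  finally show ?case .
qed

text \<open>Chernoff's bound: the indicator of \<open>arrival i n w < t\<close> is at most
  \<open>exp (c * (t - arrival i n w))\<close>, whose mean decays geometrically in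
  \<open>n\<close>.\<close>

lemma geometric_arrival_bound:
  "\<exists>C::real. (\<integral>\<^sup>+w. (\<Sum>n. ennreal (exp (\<kappa> * real (Suc n))) * indicator {..<t} (arrival i n w)) \<partial>Path) \<le> ennreal C"
proof -
  \<comment> \<open>This \<open>c\<close> makes \<open>exp \<kappa> * (lam i / (lam i + c))\<close>
    at most 1/2, so the decay beats the weights
    \<open>exp (\<kappa> * real (Suc n))\<close>.\<close>
  define c where "c = 2 * lam i * exp \<kappa>"
  have c: "0 < c" using lam_pos[of i] by (simp add: c_def)
  define q where "q = exp \<kappa> * (lam i / (lam i + c))"
  have q: "0 \<le> q" "q \<le> 1/2"
  proof -
    have "exp \<kappa> * lam i \<le> 1/2 * (lam i + c)" using lam_pos[of i] by (simp add: c_def)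
    then show "0 \<le> q" "q \<le> 1/2" using lam_pos[of i] c by (simp_all add: q_def divide_le_eq)
  qed
  have "(\<integral>\<^sup>+w. (\<Sum>n. ennreal (exp (\<kappa> * real (Suc n))) * indicator {..<t} (arrival i n w)) \<partial>Path) =
      (\<Sum>n. \<integral>\<^sup>+w. ennreal (exp (\<kappa> * real (Suc n))) * indicator {..<t} (arrival i n w) \<partial>Path)"
    by (rule nn_integral_suminf) measurable
  also have "\<dots> \<le> (\<Sum>n. ennreal (exp (c * t) * (1/2) ^ Suc n))"
  proof (rule suminf_le)
    fix n
    have "(\<integral>\<^sup>+w. ennreal (exp (\<kappa> * real (Suc n))) * indicator {..<t} (arrival i n w) \<partial>Path) \<le>
       (\<integral>\<^sup>+w. ennreal (exp (\<kappa> * real (Suc n)) * exp (c * t)) * ennreal (exp (- c * arrival i n w)) \<partial>Path)"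
      using c by (intro nn_integral_mono)
        (auto simp: indicator_def ennreal_mult[symmetric] mult_exp_exp intro!: ennreal_leI)
    also have "\<dots> = ennreal (exp (\<kappa> * real (Suc n)) * exp (c * t)) * ennreal ((lam i / (lam i + c)) ^ Suc n)"
      using c nn_integral_exp_arrival[of c i n] by (subst nn_integral_cmult) auto
    also have "\<dots> = ennreal (exp (c * t) * q ^ Suc n)"
    proof -
      have "exp (\<kappa> * real (Suc n)) = exp \<kappa> ^ Suc n"
        by (metis exp_of_nat_mult mult.commute)
      then show ?thesis
        using c lam_pos[of i] unfolding q_def power_mult_distrib
        by (subst ennreal_mult[symmetric]) (simp_all add: mult_ac)
    qed
    also have "\<dots> \<le> ennreal (exp (c * t) * (1/2) ^ Suc n)"
      using q by (intro ennreal_leI mult_left_mono power_mono) auto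
    finally show "(\<integral>\<^sup>+w. ennreal (exp (\<kappa> * real (Suc n))) * indicator {..<t} (arrival i n w) \<partial>Path)
      \<le> ennreal (exp (c * t) * (1/2) ^ Suc n)" .
  qed auto
  also have "\<dots> = ennreal (exp (c * t))"
    using sums_mult[OF power_half_series, of "exp (c * t)"]
    by (intro suminf_ennreal_eq) auto
  finally show ?thesis by blast
qed

lemma AE_locally_finite: "AE w in Path. locally_finite w"
proof -
  have "AE w in Path. finite {n. arrival i n w < real k}" for i k
  proof -
    \<comment> \<open>With exponent zero all weights are one, so this bounds the expected number of
      arrivals before \<open>k\<close>.\<close>
    obtain C :: real where C: "(\<integral>\<^sup>+w. (\<Sum>n. ennreal (exp (0 * real (Suc n))) * indicator {..<real k} (arrival i n w)) \<partial>Path) \<le> ennreal C"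
      using geometric_arrival_bound by blast
    then have "AE w in Path. (\<Sum>n. indicator {..<real k} (arrival i n w) :: ennreal) \<noteq> \<infinity>"
      by (intro nn_integral_PInf_AE) (auto simp: top_unique less_top[symmetric])
    then show ?thesis
    proof eventually_elim
      case (elim w)
      have "(\<integral>\<^sup>+n. indicator {..<real k} (arrival i n w) \<partial>count_space UNIV) =
          (\<integral>\<^sup>+n. indicator {n. arrival i n w < real k} n \<partial>count_space UNIV)"
        by (intro nn_integral_cong) (simp add: indicator_def)
      also have "\<dots> = emeasure (count_space UNIV) {n. arrival i n w < real k}" by simp
      finally show ?case using elim
        by (simp add: nn_integral_count_space_nat emeasure_count_space split: if_splits)
    qed
  qed
  then have "AE w in Path. \<forall>i k. finite {n. arrival i n w < real k}"
    by (simp add: AE_all_countable)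
  then show ?thesis
  proof eventually_elim
    case (elim w)
    show ?case unfolding locally_finite_def
    proof (intro allI)
      fix i t
      have "{n. arrival i n w < t} \<subseteq> {n. arrival i n w < real (nat \<lceil>t\<rceil>)}" by auto linarith
      then show "finite {n. arrival i n w < t}" using elim finite_subset by blast
    qed
  qed
qed

lemma occupancy_total_le:
  assumes "locally_finite w"
  shows "fst (occupancy acc y0 s w i) + snd (occupancy acc y0 s w i) \<le> y0 i + card {n. arrival i n w < s}"
proof -
  let ?A = "{n. arrival i n w < s}"
  have fin: "finite ?A" using assms by (simp add: locally_finite_def)
  have "card {k. k < y0 i \<and> s \<le> w (Init_Service i k)} \<le> card {k. k < y0 i}"
    by (intro card_mono) auto
  moreover have "card {n. acc i n w \<and> arrival i n w < s \<and> s \<le> arrival i n w + w (Service i n)} +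
      card {n. \<not> acc i n w \<and> arrival i n w < s \<and> s \<le> arrival i n w + w (Fict_Service i n)} \<le> card ?A"
    using fin by (subst card_Un_disjoint[symmetric]) (auto intro!: card_mono)
  ultimately show ?thesis
    by (simp add: occupancy_def x_before_def y_before_def)
qed

text \<open>The arrivals before \<open>t\<close> form an initial segment \<open>{..m}\<close>, so
  the left side is the single term \<open>n = m\<close> of the series; the summand 1 covers the case
  of no arrival.\<close>

lemma exp_card_arrivals_le:
  assumes w: "\<forall>q\<in>Prims. 0 < w q" "locally_finite w"
  shows "ennreal (exp (\<kappa> * real (card {n. arrival i n w < t}))) \<le>
    1 + (\<Sum>n. ennreal (exp (\<kappa> * real (Suc n))) * indicator {..<t} (arrival i n w))"
proof (cases "{n. arrival i n w < t} = {}")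
  case True
  then show ?thesis by simp
next
  case False
  let ?A = "{n. arrival i n w < t}"
  have fin: "finite ?A" using w by (simp add: locally_finite_def)
  define m where "m = Max ?A"
  have m: "m \<in> ?A" using Max_in[OF fin False] by (simp add: m_def)
  have "?A = {..m}"
  proof (intro set_eqI iffI)
    fix n
    show "n \<in> {..m}" if "n \<in> ?A" using Max_ge[OF fin that] by (simp add: m_def)
    show "n \<in> ?A" if "n \<in> {..m}" using arrival_mono[OF w(1), of n m i] that m by simp
  qed
  then have "card ?A = Suc m" by simp
  then have "ennreal (exp (\<kappa> * real (card ?A))) =
      (\<Sum>n\<in>{m}. ennreal (exp (\<kappa> * real (Suc n))) * indicator {..<t} (arrival i n w))"
    using m by simp
  also have "\<dots> \<le> (\<Sum>n. ennreal (exp (\<kappa> * real (Suc n))) * indicator {..<t} (arrival i n w))"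
    by (rule sum_le_suminf) auto
  finally show ?thesis by (meson add_increasing zero_le)
qed

text \<open>Whatever the routing, a class holds at most its initial load plus its arrivals before
  \<open>t\<close>. Integrability of unbounded functions of the state rests on this bound; its
  uniformity in \<open>s\<close> serves the time integrals.\<close>

lemma exp_moment_bound:
  assumes \<kappa>: "0 \<le> \<kappa>"
  shows "\<exists>C::real. \<forall>s\<le>t. (\<integral>\<^sup>+w. ennreal (exp (\<kappa> * real (fst (state s w i) + snd (state s w i)))) \<partial>Path) \<le> ennreal C"
proof -
  interpret Path: prob_space Path by (rule prob_space_Path)
  obtain C :: real where C: "(\<integral>\<^sup>+w. (\<Sum>n. ennreal (exp (\<kappa> * real (Suc n))) * indicator {..<t} (arrival i n w)) \<partial>Path) \<le> ennreal C"
    using geometric_arrival_bound by blast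
  show ?thesis
  proof (intro exI[of _ "exp (\<kappa> * real (y0 i)) * (1 + max 0 C)"] allI impI)
    fix s assume "s \<le> t"
    have "AE w in Path. ennreal (exp (\<kappa> * real (fst (state s w i) + snd (state s w i)))) \<le>
      ennreal (exp (\<kappa> * real (y0 i))) * (1 + (\<Sum>n. ennreal (exp (\<kappa> * real (Suc n))) * indicator {..<t} (arrival i n w)))"
      using AE_positive AE_locally_finite
    proof eventually_elim
      case (elim w)
      have "card {n. arrival i n w < s} \<le> card {n. arrival i n w < t}"
        using elim(2) \<open>s \<le> t\<close> by (intro card_mono) (auto simp: locally_finite_def)
      then have "fst (state s w i) + snd (state s w i) \<le> y0 i + card {n. arrival i n w < t}"
        using occupancy_total_le[OF elim(2), of routing s i] by linarith
      then have "exp (\<kappa> * real (fst (state s w i) + snd (state s w i))) \<le>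
          exp (\<kappa> * real (y0 i)) * exp (\<kappa> * real (card {n. arrival i n w < t}))"
        using \<kappa> by (simp add: mult_exp_exp distrib_left[symmetric] mult_left_mono)
      then have "ennreal (exp (\<kappa> * real (fst (state s w i) + snd (state s w i)))) \<le>
          ennreal (exp (\<kappa> * real (y0 i))) * ennreal (exp (\<kappa> * real (card {n. arrival i n w < t})))"
        by (simp add: ennreal_mult[symmetric] ennreal_leI)
      also have "\<dots> \<le> ennreal (exp (\<kappa> * real (y0 i))) * (1 + (\<Sum>n. ennreal (exp (\<kappa> * real (Suc n))) * indicator {..<t} (arrival i n w)))"
        by (intro mult_left_mono exp_card_arrivals_le elim) auto
      finally show ?case .
    qed
    then have "(\<integral>\<^sup>+w. ennreal (exp (\<kappa> * real (fst (state s w i) + snd (state s w i)))) \<partial>Path) \<le>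
      (\<integral>\<^sup>+w. ennreal (exp (\<kappa> * real (y0 i))) * (1 + (\<Sum>n. ennreal (exp (\<kappa> * real (Suc n))) * indicator {..<t} (arrival i n w))) \<partial>Path)"
      by (rule nn_integral_mono_AE)
    also have "\<dots> = ennreal (exp (\<kappa> * real (y0 i))) * (1 + (\<integral>\<^sup>+w. (\<Sum>n. ennreal (exp (\<kappa> * real (Suc n))) * indicator {..<t} (arrival i n w)) \<partial>Path))"
      by (subst nn_integral_cmult) (auto simp: nn_integral_add Path.emeasure_space_1)
    also have "\<dots> \<le> ennreal (exp (\<kappa> * real (y0 i))) * (1 + ennreal (max 0 C))"
      using C by (intro mult_left_mono add_left_mono) (auto simp: max_def ennreal_neg split: if_splits)
    also have "\<dots> = ennreal (exp (\<kappa> * real (y0 i)) * (1 + max 0 C))"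
      by (simp add: ennreal_mult' ennreal_plus[symmetric] ennreal_1[symmetric] del: ennreal_1)
    finally show "(\<integral>\<^sup>+w. ennreal (exp (\<kappa> * real (fst (state s w i) + snd (state s w i)))) \<partial>Path)
      \<le> ennreal (exp (\<kappa> * real (y0 i)) * (1 + max 0 C))" .
  qed
qed

end

section \<open>Dynkin's formula\<close>

fun owner :: "'i primitive \<Rightarrow> 'i" where
  "owner (Interarrival i n) = i"
| "owner (Service i n) = i"
| "owner (Fict_Service i n) = i"
| "owner (Init_Service i k) = i"

text \<open>The three transitions of a class: arrival, departure from the original system, departure
  from the fictitious system. Initially loaded requests share the last kind, so the occupancy
  determines the total rate of each kind.\<close>

fun by_kind :: "'c \<Rightarrow> 'c \<Rightarrow> 'c \<Rightarrow> 'i primitive \<Rightarrow> 'c" where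
  "by_kind a x y (Interarrival i n) = a"
| "by_kind a x y (Service i n) = x"
| "by_kind a x y (Fict_Service i n) = y"
| "by_kind a x y (Init_Service i k) = y"

lemma nn_integral_count_space_subset:
  fixes f :: "'c \<Rightarrow> real"
  assumes "finite A" "A \<subseteq> B" "\<And>p. 0 \<le> f p"
  shows "(\<integral>\<^sup>+p. (if p \<in> A then ennreal (f p) else 0) \<partial>count_space B) = ennreal (\<Sum>p\<in>A. f p)"
proof -
  have "(\<integral>\<^sup>+p. (if p \<in> A then ennreal (f p) else 0) \<partial>count_space B) =
      (\<Sum>p\<in>A. (if p \<in> A then ennreal (f p) else 0))"
    using assms by (intro nn_integral_count_space') auto
  then show ?thesis using assms by simp
qed

section \<open>Running clocks and their compensators\<close>

context loss_system
begin

text \<open>Each request owns two service clocks, and only the one of the system it is routed to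
  marks an event.\<close>

fun relevant :: "'i primitive \<Rightarrow> ('i primitive \<Rightarrow> real) \<Rightarrow> bool" where
  "relevant (Service i n) w \<longleftrightarrow> routing i n w"
| "relevant (Fict_Service i n) w \<longleftrightarrow> \<not> routing i n w"
| "relevant _ w \<longleftrightarrow> True"

definition clocks :: "'i \<Rightarrow> 'i primitive set" where
  "clocks i = {p \<in> Prims. owner p = i}"

text \<open>The running interval is open at the start and closed at the ring, to match the left
  limits: active service clocks correspond exactly to the requests counted by
  \<open>occupancy\<close>.\<close>

definition active :: "'i \<Rightarrow> real \<Rightarrow> ('i primitive \<Rightarrow> real) \<Rightarrow> 'i primitive set" where
  "active i s w = {p \<in> clocks i. relevant p w \<and> start p w < s \<and> s \<le> ring p w}"

definition rung :: "'i \<Rightarrow> real \<Rightarrow> ('i primitive \<Rightarrow> real) \<Rightarrow> 'i primitive set" where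
  "rung i t w = {p \<in> clocks i. relevant p w \<and> ring p w < t}"

lemma countable_clocks: "countable (clocks i)"
  unfolding clocks_def by (rule countable_subset[OF _ countable_primitives[of y0]]) auto

lemma clocks_iff [simp]:
  "Interarrival j n \<in> clocks i \<longleftrightarrow> j = i" "Service j n \<in> clocks i \<longleftrightarrow> j = i"
  "Fict_Service j n \<in> clocks i \<longleftrightarrow> j = i" "Init_Service j k \<in> clocks i \<longleftrightarrow> j = i \<and> k < y0 i"
  by (auto simp: clocks_def)

lemma clocks_in_Prims: "p \<in> clocks i \<Longrightarrow> p \<in> Prims"
  by (simp add: clocks_def)

lemma measurable_relevant [measurable]: "Measurable.pred Path (\<lambda>w. relevant p w)"
  by (cases p) simp_all

text \<open>The routing of a request is settled at its arrival, when its service clocks only start,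
  so their values cannot affect it.\<close>

lemma relevant_update:
  assumes p: "p \<in> Prims" and pos: "\<forall>q\<in>Prims. 0 < w q" and u: "0 < u"
  shows "relevant p (w(p := u)) = relevant p w"
proof -
  have "routing i n (w(p := u)) = routing i n w" if "start p w = arrival i n w" for i n
    using that p pos u by (intro routing_before[OF p pos u refl]) auto
  then show ?thesis by (cases p) auto
qed

lemma finite_rung:
  assumes pos: "\<forall>q\<in>Prims. 0 < w q" and lf: "locally_finite w"
  shows "finite (rung i t w)"
proof (rule finite_subset)
  let ?A = "{n. arrival i n w < t}"
  show "rung i t w \<subseteq> Interarrival i ` ?A \<union> Service i ` ?A \<union> Fict_Service i ` ?A \<union> Init_Service i ` {..<y0 i}"
  proof
    fix p assume p: "p \<in> rung i t w"
    then have "p \<in> Prims" by (auto simp: rung_def clocks_def)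
    then have "start p w < ring p w" using pos by (auto simp: ring_def)
    with p show "p \<in> Interarrival i ` ?A \<union> Service i ` ?A \<union> Fict_Service i ` ?A \<union> Init_Service i ` {..<y0 i}"
      by (cases p) (auto simp: rung_def)
  qed
  show "finite (Interarrival i ` ?A \<union> Service i ` ?A \<union> Fict_Service i ` ?A \<union> Init_Service i ` {..<y0 i})"
    using lf by (simp add: locally_finite_def)
qed

lemma active_decompose:
  assumes pos: "\<forall>q\<in>Prims. 0 < w q" and lf: "locally_finite w" and s: "0 < s"
  obtains m where
    "active i s w = {Interarrival i m} \<union>
       Service i ` {n. routing i n w \<and> arrival i n w < s \<and> s \<le> arrival i n w + w (Service i n)} \<union>
       Fict_Service i ` {n. \<not> routing i n w \<and> arrival i n w < s \<and> s \<le> arrival i n w + w (Fict_Service i n)} \<union>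
       Init_Service i ` {k. k < y0 i \<and> s \<le> w (Init_Service i k)}"
proof -
  let ?R = "\<lambda>m. {Interarrival i m} \<union>
       Service i ` {n. routing i n w \<and> arrival i n w < s \<and> s \<le> arrival i n w + w (Service i n)} \<union>
       Fict_Service i ` {n. \<not> routing i n w \<and> arrival i n w < s \<and> s \<le> arrival i n w + w (Fict_Service i n)} \<union>
       Init_Service i ` {k. k < y0 i \<and> s \<le> w (Init_Service i k)}"
  have "\<exists>n. s \<le> arrival i n w"
  proof (rule ccontr)
    assume "\<nexists>n. s \<le> arrival i n w"
    then have "{n. arrival i n w < s} = UNIV" by (auto simp: not_le)
    with lf show False by (metis infinite_UNIV_nat locally_finite_def)
  qed
  \<comment> \<open>The interarrival clock running at \<open>s\<close> is the one ending with the
    first arrival at or after \<open>s\<close>; such an arrival exists because arrivals do not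
    accumulate.\<close>
  define m where "m = (LEAST n. s \<le> arrival i n w)"
  have m: "s \<le> arrival i m w" unfolding m_def by (rule LeastI_ex) fact
  have less: "arrival i n w < s" if "n < m" for n
    using not_less_Least[of n "\<lambda>n. s \<le> arrival i n w"] that by (auto simp: m_def)
  have start_m: "start (Interarrival i n) w < s \<and> s \<le> arrival i n w \<longleftrightarrow> n = m" for n
  proof
    assume n: "start (Interarrival i n) w < s \<and> s \<le> arrival i n w"
    have "n \<le> m"
    proof (rule ccontr)
      assume "\<not> n \<le> m"
      then obtain l where l: "n = Suc l" "m \<le> l" by (cases n) auto
      then have "start (Interarrival i n) w = arrival i l w"
        by (simp add: arrival_time_def lessThan_Suc_atMost)
      with n m arrival_mono[OF pos l(2), of i] show False by simp
    qed
    moreover have "m \<le> n" using less[of n] n by (auto simp: not_less[symmetric])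
    ultimately show "n = m" by simp
  next
    assume n: "n = m"
    show "start (Interarrival i n) w < s \<and> s \<le> arrival i n w"
    proof (cases m)
      case 0
      then show ?thesis using n m s by simp
    next
      case (Suc l)
      then have "start (Interarrival i n) w = arrival i l w"
        using n by (simp add: arrival_time_def lessThan_Suc_atMost)
      then show ?thesis using less[of l] m n Suc by simp
    qed
  qed
  have "p \<in> active i s w \<longleftrightarrow> p \<in> ?R m" for p
  proof (cases p)
    case (Interarrival j n)
    then show ?thesis using start_m[of n] by (auto simp: active_def image_iff simp del: start.simps)
  qed (use s in \<open>auto simp: active_def ring_def image_iff\<close>)
  then have "active i s w = ?R m" by blast
  then show ?thesis by (rule that)
qed

lemma finite_occupancy_sets:
  assumes "locally_finite w"
  shows "finite {n. P n \<and> arrival i n w < s \<and> Q n}"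
  by (rule finite_subset[of _ "{n. arrival i n w < s}"]) (use assms in \<open>auto simp: locally_finite_def\<close>)

text \<open>One interarrival clock and one service clock per request present are running, so the sum
  of their rates, weighted by kind, is a function of the state. This is where the Markov generator
  appears.\<close>

lemma sum_active:
  fixes a x y :: real
  assumes pos: "\<forall>q\<in>Prims. 0 < w q" and lf: "locally_finite w" and s: "0 < s"
  shows "finite (active i s w)"
    and "(\<Sum>p\<in>active i s w. rate p * by_kind a x y p) =
      lam i * a + mu i * real (fst (state s w i)) * x + mu i * real (snd (state s w i)) * y"
proof -
  define X where "X = {n. routing i n w \<and> arrival i n w < s \<and> s \<le> arrival i n w + w (Service i n)}"
  define Y where "Y = {n. \<not> routing i n w \<and> arrival i n w < s \<and> s \<le> arrival i n w + w (Fict_Service i n)}"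
  define K where "K = {k. k < y0 i \<and> s \<le> w (Init_Service i k)}"
  obtain m where act: "active i s w = {Interarrival i m} \<union> Service i ` X \<union> Fict_Service i ` Y \<union> Init_Service i ` K"
    using active_decompose[OF assms] unfolding X_def Y_def K_def by blast
  have fin: "finite X" "finite Y" "finite K"
    using finite_occupancy_sets[OF lf] by (simp_all add: X_def Y_def K_def)
  then show "finite (active i s w)" by (simp add: act)
  have state: "fst (state s w i) = card X" "snd (state s w i) = card K + card Y"
    by (simp_all add: occupancy_def x_before_def y_before_def X_def Y_def K_def)
  have "(\<Sum>p\<in>active i s w. rate p * by_kind a x y p) =
     (\<Sum>p\<in>{Interarrival i m}. rate p * by_kind a x y p) + (\<Sum>p\<in>Service i ` X. rate p * by_kind a x y p) +
     (\<Sum>p\<in>Fict_Service i ` Y. rate p * by_kind a x y p) + (\<Sum>p\<in>Init_Service i ` K. rate p * by_kind a x y p)"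
  proof -
    have d: "{Interarrival i m} \<inter> Service i ` X = {}"
      "({Interarrival i m} \<union> Service i ` X) \<inter> Fict_Service i ` Y = {}"
      "({Interarrival i m} \<union> Service i ` X \<union> Fict_Service i ` Y) \<inter> Init_Service i ` K = {}"
      by auto
    have f: "finite {Interarrival i m}" "finite (Service i ` X)" "finite (Fict_Service i ` Y)"
      "finite (Init_Service i ` K)"
      using fin by auto
    show ?thesis
      unfolding act using d f by (simp only: sum.union_disjoint finite_UnI)
  qed
  also have "\<dots> = lam i * a + mu i * real (card X) * x + mu i * real (card Y) * y + mu i * real (card K) * y"
    by (simp add: sum.reindex inj_on_def)
  finally show "(\<Sum>p\<in>active i s w. rate p * by_kind a x y p) =
      lam i * a + mu i * real (fst (state s w i)) * x + mu i * real (snd (state s w i)) * y"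
    by (simp add: state algebra_simps)
qed

text \<open>This is \<open>compensator\<close> in the clock's own time, shifted afterwards by
  \<open>start p w\<close>. Non-anticipation holds because neither relevance nor the state up to the
  ring depends on the value of the clock.\<close>

lemma compensator_event:
  fixes h :: "('i \<Rightarrow> nat \<times> nat) \<Rightarrow> ennreal"
  assumes p: "p \<in> Prims"
  shows "(\<integral>\<^sup>+w. (if relevant p w \<and> ring p w < t then h (state (ring p w) w) else 0) \<partial>Path) =
    (\<integral>\<^sup>+w. \<integral>\<^sup>+s. (if relevant p w \<and> start p w < s \<and> s \<le> ring p w \<and> s < t
        then ennreal (rate p) * h (state s w) else 0) \<partial>lborel \<partial>Path)"
proof -
  define H where "H = (\<lambda>u w. if relevant p w \<and> start p w + u < t then h (state (start p w + u) w) else 0)"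
  have [measurable]: "h \<in> count_space UNIV \<rightarrow>\<^sub>M borel" by simp
  have [measurable]: "(\<lambda>(u, w). relevant p w) \<in> borel \<Otimes>\<^sub>M Path \<rightarrow>\<^sub>M count_space UNIV"
    "(\<lambda>(u::real, w). start p w) \<in> borel_measurable (borel \<Otimes>\<^sub>M Path)"
    using measurable_compose[OF measurable_snd measurable_relevant]
      measurable_compose[OF measurable_snd measurable_start] by (simp_all add: case_prod_beta')
  have H: "(\<lambda>(u, w). H u w) \<in> borel_measurable (borel \<Otimes>\<^sub>M Path)"
    unfolding H_def by measurable
  have "(\<integral>\<^sup>+w. H (w p) w \<partial>Path) =
     (\<integral>\<^sup>+w. \<integral>\<^sup>+u. ennreal (rate p) * H u w * indicator {0<..w p} u \<partial>lborel \<partial>Path)"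
  proof (rule compensator[OF p H])
    fix u w assume w: "w \<in> space Path" "\<forall>q\<in>Prims. 0 < w q" "0 < u" "u \<le> w p"
    have "state (start p w + u) (w(p := u)) = state (start p w + u) w"
      using w by (intro state_before[OF p _ _ refl]) auto
    then show "H u (w(p := u)) = H u w"
      using relevant_update[OF p w(2,3)] by (simp add: H_def start_update)
  qed
  also have "\<dots> = (\<integral>\<^sup>+w. \<integral>\<^sup>+s. (if relevant p w \<and> start p w < s \<and> s \<le> ring p w \<and> s < t
        then ennreal (rate p) * h (state s w) else 0) \<partial>lborel \<partial>Path)"
  proof (rule nn_integral_cong)
    fix w assume [measurable]: "w \<in> space Path"
    let ?f = "\<lambda>s. if relevant p w \<and> start p w < s \<and> s \<le> ring p w \<and> s < t
        then ennreal (rate p) * h (state s w) else 0"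
    have "?f \<in> borel_measurable borel" by measurable
    from nn_integral_real_affine[OF this, of 1 "start p w"]
    have "(\<integral>\<^sup>+s. ?f s \<partial>lborel) = (\<integral>\<^sup>+u. ?f (start p w + u) \<partial>lborel)"
      by (simp only: mult_1 abs_one ennreal_1 one_neq_zero simp_thms)
    also have "\<dots> = (\<integral>\<^sup>+u. ennreal (rate p) * H u w * indicator {0<..w p} u \<partial>lborel)"
      by (intro nn_integral_cong) (auto simp: H_def ring_def indicator_def)
    finally show "(\<integral>\<^sup>+u. ennreal (rate p) * H u w * indicator {0<..w p} u \<partial>lborel) = (\<integral>\<^sup>+s. ?f s \<partial>lborel)" ..
  qed
  finally show ?thesis by (simp only: H_def ring_def[symmetric])
qed

lemma measurable_event:
  fixes h :: "'i primitive \<Rightarrow> ('i \<Rightarrow> nat \<times> nat) \<Rightarrow> real"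
  assumes "p \<in> clocks i"
  shows "(\<lambda>w. if relevant p w \<and> ring p w < t then ennreal (h p (state (ring p w) w)) else 0) \<in> borel_measurable Path"
proof -
  note clocks_in_Prims[OF assms, measurable]
  have h_meas: "(\<lambda>v. ennreal (h p v)) \<in> count_space UNIV \<rightarrow>\<^sub>M borel" by simp
  have f: "(\<lambda>w. ennreal (h p (state (ring p w) w))) \<in> borel_measurable Path"
    by (rule measurable_compose[OF measurable_state h_meas]) measurable
  have P: "Measurable.pred Path (\<lambda>w. relevant p w \<and> ring p w < t)" by measurable
  show ?thesis by (rule measurable_If[OF f measurable_const predE[OF P]]) simp
qed

lemma nn_integral_rung:
  fixes h :: "'i primitive \<Rightarrow> ('i \<Rightarrow> nat \<times> nat) \<Rightarrow> real"
  assumes h: "\<And>p v. 0 \<le> h p v" and w: "\<forall>q\<in>Prims. 0 < w q" "locally_finite w"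
  shows "(\<integral>\<^sup>+p. (if relevant p w \<and> ring p w < t then ennreal (h p (state (ring p w) w)) else 0) \<partial>count_space (clocks i))
    = ennreal (\<Sum>p\<in>rung i t w. h p (state (ring p w) w))"
proof -
  have "(\<integral>\<^sup>+p. (if relevant p w \<and> ring p w < t then ennreal (h p (state (ring p w) w)) else 0) \<partial>count_space (clocks i)) =
    (\<integral>\<^sup>+p. (if p \<in> rung i t w then ennreal (h p (state (ring p w) w)) else 0) \<partial>count_space (clocks i))"
    by (intro nn_integral_cong) (auto simp: rung_def)
  also have "\<dots> = ennreal (\<Sum>p\<in>rung i t w. h p (state (ring p w) w))"
    using finite_rung[OF w] h by (intro nn_integral_count_space_subset) (auto simp: rung_def)
  finally show ?thesis .
qed

text \<open>The one-clock formula summed over the countably many clocks of a class. Nonnegativity of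
  \<open>h\<close> permits every exchange of sums and integrals before anything is known to be
  finite.\<close>

lemma compensator_class:
  fixes h :: "'i primitive \<Rightarrow> ('i \<Rightarrow> nat \<times> nat) \<Rightarrow> real"
  assumes h: "\<And>p v. 0 \<le> h p v"
  shows "(\<integral>\<^sup>+w. ennreal (\<Sum>p\<in>rung i t w. h p (state (ring p w) w)) \<partial>Path) =
    (\<integral>\<^sup>+s. \<integral>\<^sup>+w. ennreal (\<Sum>p\<in>active i s w. rate p * h p (state s w)) * indicator {0<..<t} s \<partial>Path \<partial>lborel)"
proof -
  interpret Path: prob_space Path by (rule prob_space_Path)
  interpret pair_sigma_finite lborel Path ..
  interpret C: sigma_finite_measure "count_space (clocks i)"
    by (rule sigma_finite_measure_count_space_countable[OF countable_clocks])
  note good = AE_positive AE_locally_finite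
  let ?e = "\<lambda>p w. if relevant p w \<and> ring p w < t then ennreal (h p (state (ring p w) w)) else 0"
  let ?a = "\<lambda>p w s. if relevant p w \<and> start p w < s \<and> s \<le> ring p w \<and> s < t
        then ennreal (rate p) * ennreal (h p (state s w)) else 0"
  have h_meas: "(\<lambda>v. ennreal (h p v)) \<in> count_space UNIV \<rightarrow>\<^sub>M borel" for p by simp
  have me: "?e p \<in> borel_measurable Path" if "p \<in> clocks i" for p
    by (rule measurable_event[OF that])
  have ma: "(\<lambda>(s, w). ?a p w s) \<in> borel_measurable (borel \<Otimes>\<^sub>M Path)" if "p \<in> clocks i" for p
  proof -
    note clocks_in_Prims[OF that, measurable]
    have f: "(\<lambda>z. ennreal (rate p) * ennreal (h p (state (fst z) (snd z)))) \<in> borel_measurable (borel \<Otimes>\<^sub>M Path)"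
      by (intro borel_measurable_times_ennreal measurable_const measurable_compose[OF measurable_state h_meas])
         measurable
    have P: "Measurable.pred (borel \<Otimes>\<^sub>M Path)
        (\<lambda>z. relevant p (snd z) \<and> start p (snd z) < fst z \<and> fst z \<le> ring p (snd z) \<and> fst z < t)"
    proof -
      note [measurable] = measurable_compose[OF measurable_snd measurable_relevant, of p]
        measurable_compose[OF measurable_snd measurable_start, of p]
        measurable_compose[OF measurable_snd measurable_ring, of p]
      show ?thesis by measurable
    qed
    show ?thesis
      unfolding case_prod_beta' by (rule measurable_If[OF f measurable_const predE[OF P]]) simp
  qed
  have ma1: "(\<lambda>w. ?a p w s) \<in> borel_measurable Path" if "p \<in> clocks i" for p s
    using measurable_compose[OF measurable_Pair1'[of s borel Path] ma[OF that]] by simp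
  have "(\<integral>\<^sup>+w. ennreal (\<Sum>p\<in>rung i t w. h p (state (ring p w) w)) \<partial>Path) =
      (\<integral>\<^sup>+w. \<integral>\<^sup>+p. ?e p w \<partial>count_space (clocks i) \<partial>Path)"
    by (intro nn_integral_cong_AE, use good in eventually_elim)
       (simp only: nn_integral_rung h)
  also have "\<dots> = (\<integral>\<^sup>+p. \<integral>\<^sup>+w. ?e p w \<partial>Path \<partial>count_space (clocks i))"
    by (rule nn_integral_count_space_nn_integral[OF countable_clocks me])
  also have "\<dots> = (\<integral>\<^sup>+p. \<integral>\<^sup>+w. \<integral>\<^sup>+s. ?a p w s \<partial>lborel \<partial>Path \<partial>count_space (clocks i))"
    by (intro nn_integral_cong compensator_event) (auto intro: clocks_in_Prims)
  also have "\<dots> = (\<integral>\<^sup>+p. \<integral>\<^sup>+s. \<integral>\<^sup>+w. ?a p w s \<partial>Path \<partial>lborel \<partial>count_space (clocks i))"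
    by (intro nn_integral_cong Fubini') (use ma in simp)
  also have "\<dots> = (\<integral>\<^sup>+s. \<integral>\<^sup>+p. \<integral>\<^sup>+w. ?a p w s \<partial>Path \<partial>count_space (clocks i) \<partial>lborel)"
    by (rule nn_integral_count_space_nn_integral[OF countable_clocks, symmetric])
       (use Path.borel_measurable_nn_integral[OF ma] in simp)
  also have "\<dots> = (\<integral>\<^sup>+s. \<integral>\<^sup>+w. \<integral>\<^sup>+p. ?a p w s \<partial>count_space (clocks i) \<partial>Path \<partial>lborel)"
    by (intro nn_integral_cong nn_integral_count_space_nn_integral[OF countable_clocks, symmetric] ma1)
  also have "\<dots> = (\<integral>\<^sup>+s. \<integral>\<^sup>+w. ennreal (\<Sum>p\<in>active i s w. rate p * h p (state s w)) * indicator {0<..<t} s \<partial>Path \<partial>lborel)"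
  proof (rule nn_integral_cong, rule nn_integral_cong_AE, use good in eventually_elim)
    fix s w assume w: "\<forall>q\<in>Prims. 0 < w q" "locally_finite w"
    show "(\<integral>\<^sup>+p. ?a p w s \<partial>count_space (clocks i)) =
      ennreal (\<Sum>p\<in>active i s w. rate p * h p (state s w)) * indicator {0<..<t} s"
    proof (cases "0 < s \<and> s < t")
      case True
      have "(\<integral>\<^sup>+p. ?a p w s \<partial>count_space (clocks i)) =
        (\<integral>\<^sup>+p. (if p \<in> active i s w then ennreal (rate p * h p (state s w)) else 0) \<partial>count_space (clocks i))"
        using True by (intro nn_integral_cong) (auto simp: active_def ennreal_mult[symmetric] h less_imp_le)
      also have "\<dots> = ennreal (\<Sum>p\<in>active i s w. rate p * h p (state s w))"
        using sum_active(1)[OF w, of s] True h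
        by (intro nn_integral_count_space_subset) (auto simp: active_def less_imp_le)
      finally show ?thesis using True by simp
    next
      case False
      then have "?a p w s = 0" for p
        using start_nonneg[OF w(1), of p] by auto
      then show ?thesis using False by (auto simp: indicator_def)
    qed
  qed
  finally show ?thesis .
qed

end

section \<open>Jumps of the state and their telescoping sum\<close>

lemma start_update_other:
  assumes "\<And>i n. p \<noteq> Interarrival i n"
  shows "start q (w(p := u)) = start q w"
proof -
  have ne: "Interarrival i n \<noteq> p" for i n using assms by metis
  show ?thesis by (cases q) (simp_all add: arrival_time_def ne)
qed

context loss_system
begin

text \<open>Given the other clocks, the ring of \<open>p\<close> is a fixed start plus a variable
  with a density, while the ring of \<open>q\<close> is fixed. The latter fails for interarrival
  clocks \<open>p\<close>, which shift the starts of later clocks.\<close>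

lemma AE_ring_neq:
  assumes p: "p \<in> Prims" and q: "q \<in> Prims" and "p \<noteq> q" and ni: "\<And>i n. p \<noteq> Interarrival i n"
  shows "AE w in Path. ring p w \<noteq> ring q w"
proof (rule AE_resample[OF p])
  show "Measurable.pred Path (\<lambda>w. ring p w \<noteq> ring q w)"
    unfolding pred_def by (intro borel_measurable_neq measurable_ring p q)
  fix w
  show "AE u in clock p. ring p (w(p := u)) \<noteq> ring q (w(p := u))"
    using AE_clock_neq[of "ring q w - start p w" p]
  proof eventually_elim
    case (elim u)
    have "ring q (w(p := u)) = ring q w"
      using \<open>p \<noteq> q\<close> start_update_other[OF ni] by (simp add: ring_def)
    moreover have "ring p (w(p := u)) = start p w + u" by (simp add: ring_def start_update)
    ultimately show ?case using elim by auto
  qed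
qed

lemma AE_ring_neq_const:
  assumes p: "p \<in> Prims"
  shows "AE w in Path. ring p w \<noteq> t"
proof (rule AE_resample[OF p])
  note [measurable] = p
  show "Measurable.pred Path (\<lambda>w. ring p w \<noteq> t)" by measurable
  fix w
  show "AE u in clock p. ring p (w(p := u)) \<noteq> t"
    using AE_clock_neq[of "t - start p w" p]
    by eventually_elim (simp add: ring_def start_update algebra_simps)
qed

definition distinct_rings :: "('i primitive \<Rightarrow> real) \<Rightarrow> bool" where
  "distinct_rings w \<longleftrightarrow> (\<forall>i. inj_on (\<lambda>p. ring p w) (clocks i))"

lemma AE_distinct_rings: "AE w in Path. distinct_rings w"
proof -
  have "AE w in Path. \<forall>p\<in>Prims. \<forall>q\<in>Prims. p \<noteq> q \<longrightarrow> (\<forall>i n. p \<noteq> Interarrival i n) \<longrightarrow> ring p w \<noteq> ring q w"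
  proof (simp only: AE_ball_countable[OF countable_primitives], intro ballI)
    fix p q assume "p \<in> Prims" "q \<in> Prims"
    then show "AE w in Path. p \<noteq> q \<longrightarrow> (\<forall>i n. p \<noteq> Interarrival i n) \<longrightarrow> ring p w \<noteq> ring q w"
      using AE_ring_neq[of p q] by (cases "p \<noteq> q \<and> (\<forall>i n. p \<noteq> Interarrival i n)") auto
  qed
  then show ?thesis using AE_positive
  proof eventually_elim
    case (elim w)
    show ?case unfolding distinct_rings_def
    proof (intro allI inj_onI, rule ccontr)
      fix i p q assume pq: "p \<in> clocks i" "q \<in> clocks i" "ring p w = ring q w" "p \<noteq> q"
      then have "\<exists>j n. p = Interarrival j n" "\<exists>j n. q = Interarrival j n"
        using elim(1) by (metis clocks_in_Prims)+
      \<comment> \<open>Two interarrival clocks of the same class are left, and their rings increase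
        strictly with the index.\<close>
      then obtain n m where nm: "p = Interarrival i n" "q = Interarrival i m" using pq by auto
      with pq show False
        using arrival_strict_mono[OF elim(2), of n m i] arrival_strict_mono[OF elim(2), of m n i]
        by (cases n m rule: linorder_cases) auto
    qed
  qed
qed

text \<open>The full vector \<open>v\<close> enters because admission looks at all classes.
  Truncated subtraction does no harm in the generator, since departures from an empty system have
  rate zero.\<close>

definition target :: "'i \<Rightarrow> 'i primitive \<Rightarrow> ('i \<Rightarrow> nat \<times> nat) \<Rightarrow> nat \<times> nat" where
  "target i p v = by_kind
     (if admit i v then (fst (v i) + 1, snd (v i)) else (fst (v i), snd (v i) + 1))
     (fst (v i) - 1, snd (v i)) (fst (v i), snd (v i) - 1) p"

text \<open>Time enters only through the set of clocks that have rung, so a step in time becomes the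
  insertion of one clock into a finite set.\<close>

lemma state_rung:
  "state s w i =
    (card {n. routing i n w \<and> Interarrival i n \<in> rung i s w \<and> Service i n \<notin> rung i s w},
     card {k. k < y0 i \<and> Init_Service i k \<notin> rung i s w} +
     card {n. \<not> routing i n w \<and> Interarrival i n \<in> rung i s w \<and> Fict_Service i n \<notin> rung i s w})"
proof -
  have "{n. routing i n w \<and> Interarrival i n \<in> rung i s w \<and> Service i n \<notin> rung i s w} =
      {n. routing i n w \<and> arrival i n w < s \<and> s \<le> arrival i n w + w (Service i n)}"
    "{n. \<not> routing i n w \<and> Interarrival i n \<in> rung i s w \<and> Fict_Service i n \<notin> rung i s w} =
      {n. \<not> routing i n w \<and> arrival i n w < s \<and> s \<le> arrival i n w + w (Fict_Service i n)}"
    "{k. k < y0 i \<and> Init_Service i k \<notin> rung i s w} = {k. k < y0 i \<and> s \<le> w (Init_Service i k)}"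
    by (auto simp: rung_def ring_def[of "Service _ _"] ring_def[of "Fict_Service _ _"] ring_def[of "Init_Service _ _"])
  then show ?thesis by (simp only: occupancy_def x_before_def y_before_def)
qed

lemma state_step:
  assumes pos: "\<forall>q\<in>Prims. 0 < w q" and lf: "locally_finite w"
    and p: "p \<in> clocks i" "relevant p w" and u: "rung i u w = insert p (rung i (ring p w) w)"
  shows "state u w i = target i p (state (ring p w) w)"
proof -
  define E where "E = rung i (ring p w) w"
  have fin: "finite E" unfolding E_def by (rule finite_rung[OF pos lf])
  have pE: "p \<notin> E" by (simp add: E_def rung_def)
  have fA: "finite {n. Interarrival i n \<in> E}"
    by (rule finite_vimageI[OF fin, of "Interarrival i", unfolded vimage_def]) (simp add: inj_on_def)
  have fX: "finite {n. P n \<and> Interarrival i n \<in> E \<and> Q n}" for P Q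
    by (rule finite_subset[OF _ fA]) auto
  \<comment> \<open>A service clock rings strictly after the arrival of its request, so that arrival
    already belongs to \<open>E\<close>.\<close>
  have served: "Interarrival i n \<in> E" if "start p w = arrival i n w" for n
    using that p pos clocks_in_Prims[OF p(1)] by (auto simp: E_def rung_def ring_def[of p])
  have notE: "Service i n \<notin> E" "Fict_Service i n \<notin> E" if "p = Interarrival i n" for n
  proof -
    have "0 < w (Service i n)" "0 < w (Fict_Service i n)" using pos by auto
    then show "Service i n \<notin> E" "Fict_Service i n \<notin> E"
      by (auto simp: E_def rung_def that ring_def[of "Service _ _"] ring_def[of "Fict_Service _ _"])
  qed
  note st = state_rung[of "ring p w" w i, folded E_def] state_rung[of u w i, unfolded u, folded E_def]
  show ?thesis
  proof (cases p)
    case (Interarrival j n)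
    then have p_eq: "p = Interarrival i n" using p by simp
    have adm: "admit i (state (ring p w) w) \<longleftrightarrow> routing i n w"
      using routing_admit[OF lf, of i n] by (simp add: p_eq)
    have X: "{m. routing i m w \<and> Interarrival i m \<in> insert p E \<and> Service i m \<notin> insert p E} =
       (if routing i n w then insert n {m. routing i m w \<and> Interarrival i m \<in> E \<and> Service i m \<notin> E}
        else {m. routing i m w \<and> Interarrival i m \<in> E \<and> Service i m \<notin> E})"
      using notE[OF p_eq] by (auto simp: p_eq)
    have Y: "{m. \<not> routing i m w \<and> Interarrival i m \<in> insert p E \<and> Fict_Service i m \<notin> insert p E} =
       (if routing i n w then {m. \<not> routing i m w \<and> Interarrival i m \<in> E \<and> Fict_Service i m \<notin> E}
        else insert n {m. \<not> routing i m w \<and> Interarrival i m \<in> E \<and> Fict_Service i m \<notin> E})"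
      using notE[OF p_eq] by (auto simp: p_eq)
    have Z: "{k. k < y0 i \<and> Init_Service i k \<notin> insert p E} = {k. k < y0 i \<and> Init_Service i k \<notin> E}"
      by (auto simp: p_eq)
    have n: "Interarrival i n \<notin> E" using pE by (simp add: p_eq)
    show ?thesis
      unfolding target_def adm unfolding st X Y Z using fX n by (simp add: p_eq)
  next
    case (Service j n)
    then have p_eq: "p = Service i n" "routing i n w" using p by auto
    have X: "{m. routing i m w \<and> Interarrival i m \<in> insert p E \<and> Service i m \<notin> insert p E} =
       {m. routing i m w \<and> Interarrival i m \<in> E \<and> Service i m \<notin> E} - {n}"
      by (auto simp: p_eq)
    have n: "n \<in> {m. routing i m w \<and> Interarrival i m \<in> E \<and> Service i m \<notin> E}"
      using p_eq pE served[of n] by auto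
    have Y: "{m. \<not> routing i m w \<and> Interarrival i m \<in> insert p E \<and> Fict_Service i m \<notin> insert p E} =
       {m. \<not> routing i m w \<and> Interarrival i m \<in> E \<and> Fict_Service i m \<notin> E}"
      "{k. k < y0 i \<and> Init_Service i k \<notin> insert p E} = {k. k < y0 i \<and> Init_Service i k \<notin> E}"
      by (auto simp: p_eq)
    show ?thesis
      unfolding target_def st X Y using fX card_Diff_singleton[OF n] by (simp add: p_eq)
  next
    case (Fict_Service j n)
    then have p_eq: "p = Fict_Service i n" "\<not> routing i n w" using p by auto
    have X: "{m. \<not> routing i m w \<and> Interarrival i m \<in> insert p E \<and> Fict_Service i m \<notin> insert p E} =
       {m. \<not> routing i m w \<and> Interarrival i m \<in> E \<and> Fict_Service i m \<notin> E} - {n}"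
      by (auto simp: p_eq)
    have n: "n \<in> {m. \<not> routing i m w \<and> Interarrival i m \<in> E \<and> Fict_Service i m \<notin> E}"
      using p_eq pE served[of n] by auto
    have Y: "{m. routing i m w \<and> Interarrival i m \<in> insert p E \<and> Service i m \<notin> insert p E} =
       {m. routing i m w \<and> Interarrival i m \<in> E \<and> Service i m \<notin> E}"
      "{k. k < y0 i \<and> Init_Service i k \<notin> insert p E} = {k. k < y0 i \<and> Init_Service i k \<notin> E}"
      by (auto simp: p_eq)
    have "0 < card {m. \<not> routing i m w \<and> Interarrival i m \<in> E \<and> Fict_Service i m \<notin> E}"
      using n by (subst card_gt_0_iff) (auto intro: fX)
    then show ?thesis
      unfolding target_def st X Y using card_Diff_singleton[OF n] by (simp add: p_eq)
  next
    case (Init_Service j n)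
    then have p_eq: "p = Init_Service i n" "n < y0 i" using p by auto
    have X: "{k. k < y0 i \<and> Init_Service i k \<notin> insert p E} = {k. k < y0 i \<and> Init_Service i k \<notin> E} - {n}"
      by (auto simp: p_eq)
    have n: "n \<in> {k. k < y0 i \<and> Init_Service i k \<notin> E}"
      using p_eq pE by auto
    have Y: "{m. routing i m w \<and> Interarrival i m \<in> insert p E \<and> Service i m \<notin> insert p E} =
       {m. routing i m w \<and> Interarrival i m \<in> E \<and> Service i m \<notin> E}"
      "{m. \<not> routing i m w \<and> Interarrival i m \<in> insert p E \<and> Fict_Service i m \<notin> insert p E} =
       {m. \<not> routing i m w \<and> Interarrival i m \<in> E \<and> Fict_Service i m \<notin> E}"
      by (auto simp: p_eq)
    have "0 < card {k. k < y0 i \<and> Init_Service i k \<notin> E}"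
      using n by (subst card_gt_0_iff) auto
    then show ?thesis
      unfolding target_def st X Y using card_Diff_singleton[OF n] by (simp add: p_eq)
  qed
qed

text \<open>Induction on the number of rung clocks, removing the last one to ring. Distinctness of
  the rings ensures that the set of clocks rung before it lacks this clock alone.\<close>

lemma telescoping:
  fixes f :: "nat \<times> nat \<Rightarrow> real"
  assumes pos: "\<forall>q\<in>Prims. 0 < w q" and lf: "locally_finite w" and dist: "distinct_rings w"
  shows "f (state u w i) = f (0, y0 i) +
    (\<Sum>p\<in>rung i u w. f (target i p (state (ring p w) w)) - f (state (ring p w) w i))"
proof (induction "card (rung i u w)" arbitrary: u)
  case 0
  then have "rung i u w = {}" using finite_rung[OF pos lf] by simp
  then show ?case by (simp add: state_rung)
next
  case (Suc k)
  let ?R = "rung i u w" and ?r = "\<lambda>p. ring p w"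
  let ?c = "\<lambda>p. f (target i p (state (ring p w) w)) - f (state (ring p w) w i)"
  have fin: "finite ?R" by (rule finite_rung[OF pos lf])
  have ne: "?R \<noteq> {}" using Suc.hyps(2) by auto
  obtain p where p: "p \<in> ?R" "\<And>q. q \<in> ?R \<Longrightarrow> ?r q \<le> ?r p"
  proof -
    have "Max (?r ` ?R) \<in> ?r ` ?R" using fin ne by (intro Max_in) auto
    then obtain p where "p \<in> ?R" "?r p = Max (?r ` ?R)" by auto
    then show ?thesis using fin by (intro that) auto
  qed
  have inj: "?r q = ?r p \<Longrightarrow> q = p" if "q \<in> ?R" for q
    using that p(1) dist inj_onD[of ?r "clocks i" q p] by (auto simp: distinct_rings_def rung_def)
  have R: "?R = insert p (rung i (?r p) w)"
    using p inj by (force simp: rung_def)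
  have pn: "p \<notin> rung i (?r p) w" by (simp add: rung_def)
  have fin': "finite (rung i (?r p) w)" by (rule finite_rung[OF pos lf])
  have "k = card (rung i (?r p) w)" using Suc.hyps(2) R pn fin' by simp
  from Suc.hyps(1)[OF this]
  have IH: "f (state (?r p) w i) = f (0, y0 i) + sum ?c (rung i (?r p) w)" .
  have "state u w i = target i p (state (?r p) w)"
    using p(1) R by (intro state_step pos lf) (auto simp: rung_def)
  then have "f (state u w i) = f (state (?r p) w i) + ?c p" by simp
  also have "\<dots> = f (0, y0 i) + sum ?c ?R"
    using arg_cong[OF R, of "sum ?c"] pn fin' IH by simp
  finally show ?case .
qed

section \<open>Integrability and Dynkin's formula\<close>

lemma AE_good: "AE w in Path. (\<forall>q\<in>Prims. 0 < w q) \<and> locally_finite w \<and> distinct_rings w"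
  using AE_positive AE_locally_finite AE_distinct_rings by eventually_elim auto

lemma borel_measurable_state:
  fixes g :: "('i \<Rightarrow> nat \<times> nat) \<Rightarrow> real"
  shows "(\<lambda>(s, w). g (state s w)) \<in> borel_measurable (borel \<Otimes>\<^sub>M Path)"
    and "(\<lambda>w. g (state s w)) \<in> borel_measurable Path"
  using measurable_compose[OF measurable_state[OF measurable_fst measurable_snd], where g = g]
    measurable_compose[OF measurable_state[OF measurable_const measurable_ident], where g = g]
  by (simp_all add: case_prod_beta')

lemma expectation_state_bound:
  fixes g :: "('i \<Rightarrow> nat \<times> nat) \<Rightarrow> real"
  assumes \<kappa>: "0 \<le> \<kappa>" and g: "\<And>v. \<bar>g v\<bar> \<le> C * exp (\<kappa> * real (fst (v i) + snd (v i)))"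
  obtains B where "\<And>s. s \<le> t \<Longrightarrow> integrable Path (\<lambda>w. g (state s w))"
    and "\<And>s. s \<le> t \<Longrightarrow> (\<integral>w. \<bar>g (state s w)\<bar> \<partial>Path) \<le> B"
proof -
  obtain D where D: "\<And>s. s \<le> t \<Longrightarrow>
      (\<integral>\<^sup>+w. ennreal (exp (\<kappa> * real (fst (state s w i) + snd (state s w i)))) \<partial>Path) \<le> ennreal D"
    using exp_moment_bound[OF \<kappa>] by blast
  have C: "0 \<le> C" using order_trans[OF abs_ge_zero g] by (simp add: zero_le_mult_iff)
  have nn: "(\<integral>\<^sup>+w. ennreal \<bar>g (state s w)\<bar> \<partial>Path) \<le> ennreal (C * max 0 D)" if "s \<le> t" for s
  proof -
    have "(\<integral>\<^sup>+w. ennreal \<bar>g (state s w)\<bar> \<partial>Path) \<le>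
        (\<integral>\<^sup>+w. ennreal C * ennreal (exp (\<kappa> * real (fst (state s w i) + snd (state s w i)))) \<partial>Path)"
      using g C by (intro nn_integral_mono) (auto simp: ennreal_mult[symmetric] intro!: ennreal_leI)
    also have "\<dots> = ennreal C * (\<integral>\<^sup>+w. ennreal (exp (\<kappa> * real (fst (state s w i) + snd (state s w i)))) \<partial>Path)"
      using borel_measurable_state(2)[where s = s and g = "\<lambda>v. exp (\<kappa> * real (fst (v i) + snd (v i)))"]
      by (intro nn_integral_cmult measurable_compose[OF _ measurable_ennreal])
    also have "\<dots> \<le> ennreal C * ennreal (max 0 D)"
      by (intro mult_left_mono order_trans[OF D[OF that]] ennreal_leI) auto
    also have "\<dots> = ennreal (C * max 0 D)" using C by (intro ennreal_mult[symmetric]) auto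
    finally show ?thesis .
  qed
  have int: "integrable Path (\<lambda>w. g (state s w))" if "s \<le> t" for s
    using nn[OF that] borel_measurable_state(2)
    by (intro integrableI_bounded) (auto simp: le_less_trans)
  show ?thesis
  proof (rule that[OF int])
    fix s assume s: "s \<le> t"
    have "ennreal (\<integral>w. \<bar>g (state s w)\<bar> \<partial>Path) \<le> ennreal (C * max 0 D)"
      using nn[OF s] int[OF s] by (subst nn_integral_eq_integral[symmetric]) auto
    then show "(\<integral>w. \<bar>g (state s w)\<bar> \<partial>Path) \<le> C * max 0 D"
      using C by (subst (asm) ennreal_le_iff) auto
  qed simp_all
qed

text \<open>On good paths and for nonnegative \<open>h\<close> this is the sum over the random
  finite set \<open>rung i t w\<close>; written as an integral over the fixed countable set of
  clocks, it is visibly measurable in \<open>w\<close>.\<close>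

definition rung_sum :: "'i \<Rightarrow> real \<Rightarrow> ('i primitive \<Rightarrow> ('i \<Rightarrow> nat \<times> nat) \<Rightarrow> real) \<Rightarrow> ('i primitive \<Rightarrow> real) \<Rightarrow> real" where
  "rung_sum i t h w = enn2real
     (\<integral>\<^sup>+p. (if relevant p w \<and> ring p w < t then ennreal (h p (state (ring p w) w)) else 0) \<partial>count_space (clocks i))"

lemma borel_measurable_rung_sum: "rung_sum i t h \<in> borel_measurable Path"
proof -
  interpret C: sigma_finite_measure "count_space (clocks i)"
    by (rule sigma_finite_measure_count_space_countable[OF countable_clocks])
  let ?e = "\<lambda>p w. if relevant p w \<and> ring p w < t then ennreal (h p (state (ring p w) w)) else 0"
  have "(\<lambda>(p, w). ?e p w) \<in> borel_measurable (count_space (clocks i) \<Otimes>\<^sub>M Path)"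
    by (rule measurable_pair_measure_countable1[OF countable_clocks]) (use measurable_event in simp)
  then have "(\<lambda>(w, p). ?e p w) \<in> borel_measurable (Path \<Otimes>\<^sub>M count_space (clocks i))"
    by (subst measurable_pair_swap_iff) (simp add: case_prod_beta' cong: if_cong)
  from C.borel_measurable_nn_integral[OF this] show ?thesis
    unfolding rung_sum_def by (rule borel_measurable_enn2real)
qed

lemma rung_sum_nonneg: "0 \<le> rung_sum i t h w"
  by (simp add: rung_sum_def)

lemma rung_sum_eq:
  assumes "\<And>p v. 0 \<le> h p v" "\<forall>q\<in>Prims. 0 < w q" "locally_finite w"
  shows "rung_sum i t h w = (\<Sum>p\<in>rung i t w. h p (state (ring p w) w))"
  unfolding rung_sum_def using assms by (subst nn_integral_rung) (auto simp: sum_nonneg)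

text \<open>The index \<open>0\<close> only serves as a representative of the kind of clock; see \<open>kind_only\<close> below.\<close>

definition rate_of :: "'i \<Rightarrow> ('i primitive \<Rightarrow> ('i \<Rightarrow> nat \<times> nat) \<Rightarrow> real) \<Rightarrow> ('i \<Rightarrow> nat \<times> nat) \<Rightarrow> real" where
  "rate_of i h v = lam i * h (Interarrival i 0) v + mu i * real (fst (v i)) * h (Service i 0) v
     + mu i * real (snd (v i)) * h (Fict_Service i 0) v"

definition kind_only :: "('i primitive \<Rightarrow> 'b) \<Rightarrow> bool" where
  "kind_only h \<longleftrightarrow> (\<exists>a x y. h = by_kind a x y)"

lemma sum_active_rate:
  assumes h: "kind_only h" and w: "\<forall>q\<in>Prims. 0 < w q" "locally_finite w" and s: "0 < s"
  shows "(\<Sum>p\<in>active i s w. rate p * h p (state s w)) = rate_of i h (state s w)"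
proof -
  obtain a x y where h: "h = by_kind a x y" using h by (auto simp: kind_only_def)
  have "h p v = by_kind (a v) (x v) (y v) p" for p v unfolding h by (cases p) auto
  then show ?thesis using sum_active(2)[OF w s] unfolding rate_of_def by simp
qed

text \<open>The rates grow linearly with the occupancy, which is absorbed by raising the exponent by
  one.\<close>

lemma rate_of_bound:
  assumes h: "\<And>p v. \<bar>h p v\<bar> \<le> C * exp (\<kappa> * real (fst (v i) + snd (v i)))"
  shows "\<bar>rate_of i h v\<bar> \<le> (lam i + mu i) * C * exp ((\<kappa> + 1) * real (fst (v i) + snd (v i)))"
proof -
  let ?z = "real (fst (v i) + snd (v i))"
  let ?E = "C * exp (\<kappa> * ?z)"
  have E: "0 \<le> ?E" using order_trans[OF abs_ge_zero h] .
  have pos: "0 < lam i" "0 < mu i" using lam_pos mu_pos by auto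
  have "\<bar>rate_of i h v\<bar> \<le> \<bar>lam i * h (Interarrival i 0) v\<bar> + \<bar>mu i * real (fst (v i)) * h (Service i 0) v\<bar> +
      \<bar>mu i * real (snd (v i)) * h (Fict_Service i 0) v\<bar>"
    unfolding rate_of_def by linarith
  also have "\<dots> \<le> lam i * ?E + mu i * real (fst (v i)) * ?E + mu i * real (snd (v i)) * ?E"
    using pos h by (simp only: abs_mult) (intro add_mono mult_mono, auto)
  also have "\<dots> = (lam i + mu i * ?z) * ?E" by (simp add: algebra_simps)
  also have "\<dots> \<le> ((lam i + mu i) * exp ?z) * ?E"
  proof (rule mult_right_mono[OF _ E])
    have "1 + ?z \<le> exp ?z" by (rule exp_ge_add_one_self)
    then have "1 \<le> exp ?z" "?z \<le> exp ?z" by linarith+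
    then have "lam i * 1 \<le> lam i * exp ?z" "mu i * ?z \<le> mu i * exp ?z"
      using pos by (auto intro!: mult_left_mono simp del: of_nat_add)
    then show "lam i + mu i * ?z \<le> (lam i + mu i) * exp ?z" by (simp add: algebra_simps)
  qed
  also have "\<dots> = (lam i + mu i) * C * exp ((\<kappa> + 1) * ?z)"
    by (simp add: algebra_simps exp_add)
  finally show ?thesis .
qed

text \<open>Exponential moments, bounded uniformly on bounded time intervals, make both sides
  finite, so the identity passes from extended to real integrals.\<close>

lemma compensator_nonneg:
  fixes h :: "'i primitive \<Rightarrow> ('i \<Rightarrow> nat \<times> nat) \<Rightarrow> real"
  assumes \<kappa>: "0 \<le> \<kappa>" and kind: "kind_only h" and h0: "\<And>p v. 0 \<le> h p v"
    and h: "\<And>p v. h p v \<le> C * exp (\<kappa> * real (fst (v i) + snd (v i)))"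
  shows "integrable Path (rung_sum i t h)"
    and "integrable lborel (\<lambda>s. (\<integral>w. rate_of i h (state s w) \<partial>Path) * indicator {0<..<t} s)"
    and "(\<integral>w. rung_sum i t h w \<partial>Path) = (\<integral>s. (\<integral>w. rate_of i h (state s w) \<partial>Path) * indicator {0<..<t} s \<partial>lborel)"
proof -
  interpret Path: prob_space Path by (rule prob_space_Path)
  have abs_h: "\<bar>h p v\<bar> \<le> C * exp (\<kappa> * real (fst (v i) + snd (v i)))" for p v
    using h0 h by simp
  have \<kappa>': "0 \<le> \<kappa> + 1" using \<kappa> by simp
  have rb: "\<bar>rate_of i h v\<bar> \<le> (lam i + mu i) * (C) * exp ((\<kappa> + 1) * real (fst (v i) + snd (v i)))" for v
    by (rule rate_of_bound) (rule abs_h)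
  obtain B where int: "\<And>s. s \<le> t \<Longrightarrow> integrable Path (\<lambda>w. rate_of i h (state s w))"
    and B: "\<And>s. s \<le> t \<Longrightarrow> (\<integral>w. \<bar>rate_of i h (state s w)\<bar> \<partial>Path) \<le> B"
    by (rule expectation_state_bound[where i = i and t = t and g = "rate_of i h", OF \<kappa>' rb])
       (rule that, simp_all)
  have rate0: "0 \<le> rate_of i h v" for v
    unfolding rate_of_def using lam_pos[of i] mu_pos[of i] h0 by (intro add_nonneg_nonneg mult_nonneg_nonneg) auto
  define \<psi> where "\<psi> = (\<lambda>s. (\<integral>w. rate_of i h (state s w) \<partial>Path) * indicator {0<..<t} s)"
  have \<psi>_meas[measurable]: "\<psi> \<in> borel_measurable borel"
    using Path.borel_measurable_lebesgue_integral[OF borel_measurable_state(1)[of "rate_of i h"]]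
    unfolding \<psi>_def by measurable
  have \<psi>0: "0 \<le> \<psi> s" for s using rate0 by (auto simp: \<psi>_def intro!: integral_nonneg)
  have \<psi>B: "\<psi> s \<le> \<bar>B\<bar> * indicator {0<..<t} s" for s
    using B[of s] rate0 by (auto simp: \<psi>_def indicator_def)
  have eq: "(\<integral>\<^sup>+w. ennreal (rung_sum i t h w) \<partial>Path) = (\<integral>\<^sup>+s. ennreal (\<psi> s) \<partial>lborel)"
  proof -
    have "(\<integral>\<^sup>+w. ennreal (rung_sum i t h w) \<partial>Path) =
        (\<integral>\<^sup>+w. ennreal (\<Sum>p\<in>rung i t w. h p (state (ring p w) w)) \<partial>Path)"
      using AE_good by (intro nn_integral_cong_AE) (auto simp: rung_sum_eq h0)
    also have "\<dots> = (\<integral>\<^sup>+s. \<integral>\<^sup>+w. ennreal (\<Sum>p\<in>active i s w. rate p * h p (state s w)) * indicator {0<..<t} s \<partial>Path \<partial>lborel)"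
      by (rule compensator_class[OF h0])
    also have "\<dots> = (\<integral>\<^sup>+s. ennreal (\<psi> s) \<partial>lborel)"
    proof (rule nn_integral_cong)
      fix s :: real
      show "(\<integral>\<^sup>+w. ennreal (\<Sum>p\<in>active i s w. rate p * h p (state s w)) * indicator {0<..<t} s \<partial>Path) = ennreal (\<psi> s)"
      proof (cases "0 < s \<and> s < t")
        case True
        have "(\<integral>\<^sup>+w. ennreal (\<Sum>p\<in>active i s w. rate p * h p (state s w)) * indicator {0<..<t} s \<partial>Path) =
            (\<integral>\<^sup>+w. ennreal (rate_of i h (state s w)) \<partial>Path)"
          using AE_good True by (intro nn_integral_cong_AE) (auto simp: sum_active_rate kind)
        also have "\<dots> = ennreal (\<integral>w. rate_of i h (state s w) \<partial>Path)"
          using int True rate0 by (intro nn_integral_eq_integral) auto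
        finally show ?thesis using True by (simp add: \<psi>_def)
      qed (auto simp: \<psi>_def indicator_def)
    qed
    finally show ?thesis .
  qed
  have "(\<integral>\<^sup>+s. ennreal (\<psi> s) \<partial>lborel) \<le> (\<integral>\<^sup>+s. ennreal \<bar>B\<bar> * indicator {0<..<t} s \<partial>lborel)"
    using ennreal_leI[OF \<psi>B]
    by (intro nn_integral_mono) (simp add: ennreal_mult' ennreal_indicator)
  also have "\<dots> < \<infinity>"
    using emeasure_bounded_finite[of "{0<..<t}"]
    by (subst nn_integral_cmult_indicator) (auto simp: ennreal_mult_less_top)
  finally have fin: "(\<integral>\<^sup>+s. ennreal (\<psi> s) \<partial>lborel) < \<infinity>" .
  show "integrable Path (rung_sum i t h)"
    using fin borel_measurable_rung_sum[of i t h]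
    by (intro integrableI_nonneg) (auto simp: eq[symmetric] rung_sum_def)
  show "integrable lborel (\<lambda>s. (\<integral>w. rate_of i h (state s w) \<partial>Path) * indicator {0<..<t} s)"
    using fin \<psi>0 \<psi>_meas unfolding \<psi>_def[symmetric] by (intro integrableI_nonneg) auto
  show "(\<integral>w. rung_sum i t h w \<partial>Path) = (\<integral>s. (\<integral>w. rate_of i h (state s w) \<partial>Path) * indicator {0<..<t} s \<partial>lborel)"
    unfolding \<psi>_def[symmetric] using borel_measurable_rung_sum[of i t h] \<psi>0 \<psi>_meas
    by (subst (1 2) integral_eq_nn_integral) (auto simp: eq rung_sum_nonneg)
qed

definition jump :: "'i \<Rightarrow> (nat \<times> nat \<Rightarrow> real) \<Rightarrow> 'i primitive \<Rightarrow> ('i \<Rightarrow> nat \<times> nat) \<Rightarrow> real" where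
  "jump i f p v = f (target i p v) - f (v i)"

abbreviation generator :: "'i \<Rightarrow> (nat \<times> nat \<Rightarrow> real) \<Rightarrow> ('i \<Rightarrow> nat \<times> nat) \<Rightarrow> real" where
  "generator i f \<equiv> rate_of i (jump i f)"

lemma jump_bound:
  assumes \<kappa>: "0 \<le> \<kappa>" and f: "\<And>x y. \<bar>f (x, y)\<bar> \<le> C * exp (\<kappa> * real (x + y))"
  shows "\<bar>jump i f p v\<bar> \<le> 2 * C * exp \<kappa> * exp (\<kappa> * real (fst (v i) + snd (v i)))"
proof -
  have C: "0 \<le> C" using order_trans[OF abs_ge_zero f] by (simp add: zero_le_mult_iff)
  let ?z = "fst (v i) + snd (v i)"
  have *: "\<bar>f q\<bar> \<le> C * (exp \<kappa> * exp (\<kappa> * real ?z))" if "fst q + snd q \<le> ?z + 1" for q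
  proof -
    have "\<bar>f q\<bar> \<le> C * exp (\<kappa> * real (fst q + snd q))" using f[of "fst q" "snd q"] by simp
    also have "\<dots> \<le> C * exp (\<kappa> * real (?z + 1))"
      using that C \<kappa> by (intro mult_left_mono) (auto intro!: mult_left_mono simp flip: of_nat_add)
    also have "\<dots> = C * (exp \<kappa> * exp (\<kappa> * real ?z))" by (simp add: algebra_simps exp_add)
    finally show ?thesis .
  qed
  have "fst (target i p v) + snd (target i p v) \<le> ?z + 1"
    by (cases p) (auto simp: target_def)
  then have "\<bar>f (target i p v)\<bar> \<le> C * (exp \<kappa> * exp (\<kappa> * real ?z))" by (rule *)
  moreover have "\<bar>f (v i)\<bar> \<le> C * (exp \<kappa> * exp (\<kappa> * real ?z))" by (rule *) simp
  ultimately show ?thesis unfolding jump_def by (simp add: mult.assoc)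
qed

lemma dynkin:
  fixes f :: "nat \<times> nat \<Rightarrow> real"
  assumes \<kappa>: "0 \<le> \<kappa>" and f: "\<And>x y. \<bar>f (x, y)\<bar> \<le> C * exp (\<kappa> * real (x + y))"
  shows "integrable lborel (\<lambda>s. (\<integral>w. generator i f (state s w) \<partial>Path) * indicator {0<..<t} s)" (is "integrable _ ?\<psi>")
    and "(\<integral>w. f (state t w i) \<partial>Path) = f (0, y0 i) + (\<integral>s. (\<integral>w. generator i f (state s w) \<partial>Path) * indicator {0<..<t} s \<partial>lborel)"
proof -
  interpret Path: prob_space Path by (rule prob_space_Path)
  \<comment> \<open>Compensation is available for nonnegative summands, hence the jumps are split
    into positive and negative parts; both inherit the growth bound.\<close>
  define P where "P = (\<lambda>p v. max 0 (jump i f p v))"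
  define N where "N = (\<lambda>p v. max 0 (- jump i f p v))"
  have kind: "kind_only P" "kind_only N"
  proof -
    have "P = by_kind (P (Interarrival i 0)) (P (Service i 0)) (P (Fict_Service i 0))"
      "N = by_kind (N (Interarrival i 0)) (N (Service i 0)) (N (Fict_Service i 0))"
      by (rule ext, rename_tac p, case_tac p, simp_all add: P_def N_def jump_def target_def)+
    then show "kind_only P" "kind_only N" unfolding kind_only_def by blast+
  qed
  have nonneg: "0 \<le> P p v" "0 \<le> N p v" for p v by (simp_all add: P_def N_def)
  have bound: "P p v \<le> 2 * C * exp \<kappa> * exp (\<kappa> * real (fst (v i) + snd (v i)))"
    "N p v \<le> 2 * C * exp \<kappa> * exp (\<kappa> * real (fst (v i) + snd (v i)))" for p v
    using jump_bound[OF \<kappa> f, of i p v] by (auto simp: P_def N_def)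
  note CP = compensator_nonneg[where i = i and t = t, OF \<kappa> kind(1) nonneg(1) bound(1)]
  note CN = compensator_nonneg[where i = i and t = t, OF \<kappa> kind(2) nonneg(2) bound(2)]
  have \<kappa>': "0 \<le> \<kappa> + 1" using \<kappa> by simp
  have absPN: "\<bar>P p v\<bar> \<le> 2 * C * exp \<kappa> * exp (\<kappa> * real (fst (v i) + snd (v i)))"
    "\<bar>N p v\<bar> \<le> 2 * C * exp \<kappa> * exp (\<kappa> * real (fst (v i) + snd (v i)))" for p v
    using bound nonneg by simp_all
  have rbP: "\<bar>rate_of i P v\<bar> \<le> (lam i + mu i) * (2 * C * exp \<kappa>) * exp ((\<kappa> + 1) * real (fst (v i) + snd (v i)))" for v
    by (rule rate_of_bound) (rule absPN(1))
  have rbN: "\<bar>rate_of i N v\<bar> \<le> (lam i + mu i) * (2 * C * exp \<kappa>) * exp ((\<kappa> + 1) * real (fst (v i) + snd (v i)))" for v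
    by (rule rate_of_bound) (rule absPN(2))
  have gen: "generator i f v = rate_of i P v - rate_of i N v" for v
  proof -
    have jump: "jump i f p v = P p v - N p v" for p by (simp add: P_def N_def)
    show ?thesis unfolding rate_of_def jump by (simp add: algebra_simps)
  qed
  have \<psi>: "?\<psi> s = (\<integral>w. rate_of i P (state s w) \<partial>Path) * indicator {0<..<t} s
      - (\<integral>w. rate_of i N (state s w) \<partial>Path) * indicator {0<..<t} s" for s
  proof (cases "s \<le> t")
    case True
    have "integrable Path (\<lambda>w. rate_of i P (state s w))"
      by (rule expectation_state_bound[where i = i and t = t and g = "rate_of i P", OF \<kappa>' rbP]) (use True in simp)
    moreover have "integrable Path (\<lambda>w. rate_of i N (state s w))"
      by (rule expectation_state_bound[where i = i and t = t and g = "rate_of i N", OF \<kappa>' rbN]) (use True in simp)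
    ultimately show ?thesis by (simp add: gen algebra_simps)
  qed auto
  show "integrable lborel ?\<psi>" unfolding \<psi> using CP(2) CN(2) by simp
  have "AE w in Path. f (state t w i) = f (0, y0 i) + (rung_sum i t P w - rung_sum i t N w)"
    using AE_good
  proof eventually_elim
    case (elim w)
    have "f (target i p (state (ring p w) w)) - f (state (ring p w) w i) =
        P p (state (ring p w) w) - N p (state (ring p w) w)" for p
      by (simp add: P_def N_def jump_def)
    then show ?case
      using telescoping[of w f t i] elim by (simp add: rung_sum_eq nonneg sum_subtractf)
  qed
  then have "(\<integral>w. f (state t w i) \<partial>Path) = (\<integral>w. f (0, y0 i) + (rung_sum i t P w - rung_sum i t N w) \<partial>Path)"
    using borel_measurable_state(2)[where s = t and g = "\<lambda>v. f (v i)"] CP(1) CN(1)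
    by (intro integral_cong_AE) auto
  also have "\<dots> = f (0, y0 i) + ((\<integral>w. rung_sum i t P w \<partial>Path) - (\<integral>w. rung_sum i t N w \<partial>Path))"
    using CP(1) CN(1) by (simp add: Path.prob_space)
  also have "\<dots> = f (0, y0 i) + (\<integral>s. ?\<psi> s \<partial>lborel)"
    unfolding \<psi> CP(3) CN(3) using CP(2) CN(2) by simp
  finally show "(\<integral>w. f (state t w i) \<partial>Path) = f (0, y0 i) + (\<integral>s. ?\<psi> s \<partial>lborel)" .
qed

end

text \<open>If the solution of the comparison equation were exceeded, then from the last time of equality on the
  difference would be positive and hence decreasing.\<close>

lemma linear_comparison:
  fixes \<phi> \<psi> :: "real \<Rightarrow> real"
  assumes \<mu>: "0 < \<mu>" and t: "0 \<le> t"
    and \<psi>: "\<psi> integrable_on {0..t}"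
    and \<phi>: "\<And>s. 0 \<le> s \<Longrightarrow> s \<le> t \<Longrightarrow> \<phi> s = c + integral {0..s} \<psi>"
    and le: "\<And>s. 0 \<le> s \<Longrightarrow> s \<le> t \<Longrightarrow> \<psi> s \<le> K - \<mu> * \<phi> s"
  shows "\<phi> t \<le> c * exp (- \<mu> * t) + K / \<mu> * (1 - exp (- \<mu> * t))"
proof (rule ccontr)
  define sol where "sol s = c * exp (- \<mu> * s) + K / \<mu> * (1 - exp (- \<mu> * s))" for s
  define \<eta> where "\<eta> s = \<phi> s - sol s" for s
  assume "\<not> ?thesis"
  then have pos: "0 < \<eta> t" by (simp add: \<eta>_def sol_def)
  have \<phi>_cont: "continuous_on {0..t} \<phi>"
    by (rule continuous_on_eq[of _ "\<lambda>s. c + integral {0..s} \<psi>"])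
       (auto intro!: continuous_intros indefinite_integral_continuous_1 \<psi> simp: \<phi>)
  have sol_cont: "continuous_on A sol" for A
    unfolding sol_def by (intro continuous_intros)
  have \<eta>_cont: "continuous_on {0..t} \<eta>"
    unfolding \<eta>_def by (intro continuous_intros \<phi>_cont sol_cont)
  have \<eta>0: "\<eta> 0 = 0" using \<phi>[of 0] t by (simp add: \<eta>_def sol_def)
  define S where "S = {s \<in> {0..t}. \<eta> s \<le> 0}"
  define a where "a = Sup S"
  have "closed S"
    unfolding S_def by (intro continuous_on_closed_Collect_le \<eta>_cont continuous_intros)
  moreover have S: "0 \<in> S" "bdd_above S" using t \<eta>0 by (auto simp: S_def)
  ultimately have a: "a \<in> S" unfolding a_def by (intro closed_contains_Sup) auto
  then have a_bounds: "0 \<le> a" "a \<le> t" "\<eta> a \<le> 0" by (auto simp: S_def)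
  have after: "0 < \<eta> s" if "a < s" "s \<le> t" for s
  proof (rule ccontr)
    assume "\<not> 0 < \<eta> s"
    then have "s \<in> S" using that a_bounds by (auto simp: S_def)
    then have "s \<le> a" unfolding a_def using S by (intro cSup_upper)
    with that show False by simp
  qed
  have \<eta>a: "\<eta> a = 0"
  proof (rule ccontr)
    assume "\<eta> a \<noteq> 0"
    then have "\<eta> a < 0" using a_bounds by simp
    moreover have "continuous_on {a..t} \<eta>"
      by (rule continuous_on_subset[OF \<eta>_cont]) (use a_bounds in auto)
    ultimately obtain x where x: "a \<le> x" "x \<le> t" "\<eta> x = 0"
      using IVT'[of \<eta> a 0 t] pos a_bounds by auto
    with after[of x] \<open>\<eta> a \<noteq> 0\<close> show False by (cases "x = a") auto
  qed
  have \<psi>_at: "\<psi> integrable_on {a..t}"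
    by (rule integrable_on_subinterval[OF \<psi>]) (use a_bounds in auto)
  have cont: "continuous_on {a..t} (\<lambda>s. K - \<mu> * \<phi> s)"
    by (intro continuous_intros continuous_on_subset[OF \<phi>_cont]) (use a_bounds in auto)
  have "\<phi> t - \<phi> a = integral {a..t} \<psi>"
    using Henstock_Kurzweil_Integration.integral_combine[OF a_bounds(1,2) \<psi>] a_bounds t by (simp add: \<phi>)
  also have "\<dots> \<le> integral {a..t} (\<lambda>s. K - \<mu> * \<phi> s)"
    using a_bounds by (intro integral_le \<psi>_at integrable_continuous_real cont le) auto
  finally have *: "\<phi> t - \<phi> a \<le> integral {a..t} (\<lambda>s. K - \<mu> * \<phi> s)" .
  have "((\<lambda>s. K - \<mu> * sol s) has_integral sol t - sol a) {a..t}"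
    using \<mu> a_bounds
    by (intro fundamental_theorem_of_calculus)
       (auto simp: sol_def field_simps has_real_derivative_iff_has_vector_derivative[symmetric]
         intro!: derivative_eq_intros)
  then have sol: "integral {a..t} (\<lambda>s. K - \<mu> * sol s) = sol t - sol a" by (rule integral_unique)
  have "\<eta> t - \<eta> a \<le> integral {a..t} (\<lambda>s. K - \<mu> * \<phi> s) - integral {a..t} (\<lambda>s. K - \<mu> * sol s)"
    using * unfolding sol \<eta>_def by simp
  also have "\<dots> = integral {a..t} (\<lambda>s. (K - \<mu> * \<phi> s) - (K - \<mu> * sol s))"
    by (intro Henstock_Kurzweil_Integration.integral_diff[symmetric] integrable_continuous_real cont continuous_intros sol_cont)
  also have "\<dots> \<le> integral {a..t} (\<lambda>s. 0)"
  proof (rule integral_le)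
    show "(\<lambda>s. (K - \<mu> * \<phi> s) - (K - \<mu> * sol s)) integrable_on {a..t}"
      by (intro integrable_continuous_real continuous_intros cont sol_cont)
    fix s assume "s \<in> {a..t}"
    then have "0 \<le> \<eta> s" using after[of s] \<eta>a by (cases "s = a") auto
    then show "(K - \<mu> * \<phi> s) - (K - \<mu> * sol s) \<le> 0"
      using \<mu> by (simp add: \<eta>_def)
  qed auto
  finally show False using pos \<eta>a by simp
qed

section \<open>From a drift inequality to a bound on the expectation\<close>

context loss_system
begin

lemma generator_eq:
  "generator i f v =
     lam i * ((if admit i v then f (fst (v i) + 1, snd (v i)) else f (fst (v i), snd (v i) + 1)) - f (v i))
     + mu i * real (fst (v i)) * (f (fst (v i) - 1, snd (v i)) - f (v i))
     + mu i * real (snd (v i)) * (f (fst (v i), snd (v i) - 1) - f (v i))"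
  by (simp add: rate_of_def jump_def target_def)

text \<open>Dynkin's formula makes the drift inequality an integral inequality for the expectation,
  which \<open>linear_comparison\<close> solves. The inhomogeneity \<open>c\<close> may depend on
  the state and only its mean is compared with \<open>K\<close>, because blocking is controlled in
  probability and not pointwise.\<close>

lemma drift_bound:
  fixes f :: "nat \<times> nat \<Rightarrow> real"
  assumes \<kappa>: "0 \<le> \<kappa>" and f: "\<And>x y. \<bar>f (x, y)\<bar> \<le> C * exp (\<kappa> * real (x + y))"
    and drift: "\<And>v. generator i f v \<le> c v - mu i * f (v i)"
    and c_bound: "\<And>v. \<bar>c v\<bar> \<le> B"
    and c: "\<And>s. 0 \<le> s \<Longrightarrow> (\<integral>w. c (state s w) \<partial>Path) \<le> K"
    and t: "0 \<le> t"
  shows "(\<integral>w. f (state t w i) \<partial>Path) \<le> f (0, y0 i) * exp (- mu i * t) + K / mu i * (1 - exp (- mu i * t))"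
proof -
  interpret Path: prob_space Path by (rule prob_space_Path)
  define \<phi> where "\<phi> = (\<lambda>s. \<integral>w. f (state s w i) \<partial>Path)"
  define \<psi> where "\<psi> = (\<lambda>s. \<integral>w. generator i f (state s w) \<partial>Path)"
  note D = dynkin[where i = i, OF \<kappa> f]
  have set_int: "set_integrable lborel {0<..<s} \<psi>" for s
    using D(1)[of s] by (simp add: set_integrable_def \<psi>_def mult.commute)
  have \<psi>_int: "\<psi> integrable_on {0..t}"
    using set_borel_integral_eq_integral(1)[OF set_int[of t]]
    by (simp add: integrable_on_open_interval_real)
  have \<phi>_eq: "\<phi> s = f (0, y0 i) + integral {0..s} \<psi>" if "0 \<le> s" for s
  proof -
    have "(\<integral>r. \<psi> r * indicator {0<..<s} r \<partial>lborel) = integral {0<..<s} \<psi>"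
      using set_borel_integral_eq_integral(2)[OF set_int[of s]]
      by (simp add: set_lebesgue_integral_def mult.commute)
    then show ?thesis
      using D(2)[of s] by (simp add: \<phi>_def \<psi>_def integral_open_interval_real)
  qed
  have le: "\<psi> s \<le> K - mu i * \<phi> s" if "0 \<le> s" for s
  proof -
    have f': "\<bar>f (v i)\<bar> \<le> C * exp (\<kappa> * real (fst (v i) + snd (v i)))" for v
      using f[of "fst (v i)" "snd (v i)"] by simp
    have int_f: "integrable Path (\<lambda>w. f (state s w i))"
      by (rule expectation_state_bound[where i = i and t = s and C = C and \<kappa> = \<kappa> and g = "\<lambda>v. f (v i)"])
         (use \<kappa> f' in simp_all)
    have int_c: "integrable Path (\<lambda>w. c (state s w))"
      using c_bound borel_measurable_state(2)[where g = c] by (intro Path.integrable_const_bound[of _ B]) auto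
    have jb: "\<bar>jump i f p v\<bar> \<le> (2 * C * exp \<kappa>) * exp (\<kappa> * real (fst (v i) + snd (v i)))" for p v
      by (rule jump_bound[OF \<kappa> f])
    have gb: "\<bar>generator i f v\<bar> \<le> (lam i + mu i) * (2 * C * exp \<kappa>) * exp ((\<kappa> + 1) * real (fst (v i) + snd (v i)))" for v
      by (rule rate_of_bound) (rule jb)
    have "0 \<le> \<kappa> + 1" using \<kappa> by simp
    then have int_g: "integrable Path (\<lambda>w. generator i f (state s w))"
      by (rule expectation_state_bound[where i = i and t = s and \<kappa> = "\<kappa> + 1"
          and C = "(lam i + mu i) * (2 * C * exp \<kappa>)" and g = "generator i f", OF _ gb]) simp
    have "\<psi> s \<le> (\<integral>w. c (state s w) - mu i * f (state s w i) \<partial>Path)"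
      unfolding \<psi>_def using int_f int_c int_g drift by (intro integral_mono) auto
    also have "\<dots> = (\<integral>w. c (state s w) \<partial>Path) - mu i * \<phi> s"
      using int_f int_c by (simp add: \<phi>_def)
    finally show ?thesis using c[OF that] by simp
  qed
  have "\<phi> t \<le> f (0, y0 i) * exp (- mu i * t) + K / mu i * (1 - exp (- mu i * t))"
    by (rule linear_comparison[OF mu_pos t \<psi>_int \<phi>_eq le])
  then show ?thesis by (simp add: \<phi>_def)
qed

end

section \<open>The penalty function\<close>

definition potential :: "real \<Rightarrow> real \<Rightarrow> nat \<Rightarrow> nat \<Rightarrow> real" where
  "potential a d x y = exp (a * real x) + exp (d * real y)"

text \<open>A discrete infimal convolution: \<open>D\<close> requests are moved from the second
  system into the first at price \<kappa> each before the potential is evaluated.\<close>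

definition relaxed :: "real \<Rightarrow> real \<Rightarrow> real \<Rightarrow> real \<Rightarrow> nat \<times> nat \<Rightarrow> real" where
  "relaxed \<kappa> \<gamma> a d q = Min ((\<lambda>D. \<kappa> * real D + \<gamma> * potential a d (fst q + D) (snd q - D)) ` {..snd q})"

lemma relaxed_le:
  "D \<le> y \<Longrightarrow> relaxed \<kappa> \<gamma> a d (x, y) \<le> \<kappa> * real D + \<gamma> * potential a d (x + D) (y - D)"
  unfolding relaxed_def by (intro Min_le) auto

lemma relaxed_attained:
  obtains D where "D \<le> y" "relaxed \<kappa> \<gamma> a d (x, y) = \<kappa> * real D + \<gamma> * potential a d (x + D) (y - D)"
proof -
  have "relaxed \<kappa> \<gamma> a d (x, y) \<in> (\<lambda>D. \<kappa> * real D + \<gamma> * potential a d (x + D) (y - D)) ` {..y}"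
    unfolding relaxed_def fst_conv snd_conv by (intro Min_in) auto
  then show ?thesis using that by auto
qed

lemma exp_increment_le:
  fixes a \<epsilon> :: real
  assumes "0 \<le> a" "a \<le> \<epsilon>" "\<epsilon> \<le> 1"
  shows "exp (a * real (Suc x)) - exp (a * real x) \<le> (1 + \<epsilon>) * (a * exp (a * real x))"
proof -
  have "exp a \<le> 1 + a + a\<^sup>2" using assms by (intro exp_bound) auto
  also have "a\<^sup>2 \<le> \<epsilon> * a" using assms by (simp add: power2_eq_square mult_right_mono)
  finally have "exp a - 1 \<le> (1 + \<epsilon>) * a" by (simp add: algebra_simps)
  then have "(exp a - 1) * exp (a * real x) \<le> (1 + \<epsilon>) * a * exp (a * real x)"
    by (intro mult_right_mono) auto
  then show ?thesis by (simp add: algebra_simps exp_add)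
qed

text \<open>The departure drift uses \<open>s * exp s \<ge> (1 + \<theta>) * exp s - exp \<theta>\<close>, the tangent inequality at \<open>\<theta>\<close>.\<close>

lemma exp_departure_le:
  fixes a \<epsilon> \<theta> :: real
  assumes "0 \<le> a" "a \<le> \<epsilon>"
  shows "real x * (exp (a * real (x - 1)) - exp (a * real x)) \<le> (exp \<theta> - (1 + \<theta>) * exp (a * real x)) / (1 + \<epsilon>)"
proof -
  let ?s = "a * real x"
  have e: "0 < 1 + \<epsilon>" "0 < 1 + a" using assms by auto
  have "1 + (\<theta> - ?s) \<le> exp (\<theta> - ?s)" by (rule exp_ge_add_one_self)
  then have "(1 + (\<theta> - ?s)) * exp ?s \<le> exp (\<theta> - ?s) * exp ?s" by (intro mult_right_mono) auto
  then have tangent: "- ?s * exp ?s \<le> exp \<theta> - (1 + \<theta>) * exp ?s"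
    by (simp add: exp_diff algebra_simps)
  have "1 + a \<le> exp a" by (rule exp_ge_add_one_self)
  then have "exp (- a) \<le> 1 / (1 + a)"
    using e by (simp add: exp_minus field_simps)
  also have "\<dots> = 1 - a / (1 + a)" using e by (simp add: field_simps)
  also have "\<dots> \<le> 1 - a / (1 + \<epsilon>)" using e assms by (simp add: frac_le)
  finally have dec: "exp (- a) - 1 \<le> - a / (1 + \<epsilon>)" by simp
  have "real x * (exp (a * real (x - 1)) - exp ?s) = real x * exp ?s * (exp (- a) - 1)"
  proof (cases x)
    case (Suc n)
    have "exp (a * real n) = exp (a * real (Suc n)) * exp (- a)" by (simp add: mult_exp_exp algebra_simps)
    then show ?thesis by (simp add: Suc algebra_simps)
  qed simp
  also have "\<dots> \<le> real x * exp ?s * (- a / (1 + \<epsilon>))"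
    by (intro mult_left_mono dec) auto
  also have "\<dots> = (- ?s * exp ?s) / (1 + \<epsilon>)" by simp
  also have "\<dots> \<le> (exp \<theta> - (1 + \<theta>) * exp ?s) / (1 + \<epsilon>)"
    using tangent e by (intro divide_right_mono) auto
  finally show ?thesis .
qed

lemma potential_departure_le:
  fixes a d \<epsilon> \<theta> :: real
  assumes "0 \<le> a" "a \<le> \<epsilon>" "0 \<le> d" "d \<le> \<epsilon>"
  shows "real x * (potential a d (x - 1) y - potential a d x y) + real y * (potential a d x (y - 1) - potential a d x y)
    \<le> (2 * exp \<theta> - (1 + \<theta>) * potential a d x y) / (1 + \<epsilon>)"
proof -
  have "real x * (potential a d (x - 1) y - potential a d x y) + real y * (potential a d x (y - 1) - potential a d x y) =
      real x * (exp (a * real (x - 1)) - exp (a * real x)) + real y * (exp (d * real (y - 1)) - exp (d * real y))"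
    by (simp add: potential_def)
  also have "\<dots> \<le> (exp \<theta> - (1 + \<theta>) * exp (a * real x)) / (1 + \<epsilon>) + (exp \<theta> - (1 + \<theta>) * exp (d * real y)) / (1 + \<epsilon>)"
    by (intro add_mono exp_departure_le assms)
  also have "\<dots> = (2 * exp \<theta> - (1 + \<theta>) * potential a d x y) / (1 + \<epsilon>)"
    by (simp add: add_divide_distrib[symmetric] potential_def algebra_simps)
  finally show ?thesis .
qed

text \<open>The policy raises the exponential with the smaller derivative, and the smaller of two
  numbers is at most any weighted mean. With weights \<open>al\<close> and \<open>1 - al\<close>
  this mean is the first-order increment under a static random split of the arrivals.\<close>

lemma potential_arrival_le:
  fixes a d \<epsilon> al :: real
  assumes a: "0 \<le> a" "a \<le> \<epsilon>" and d: "0 \<le> d" "d \<le> \<epsilon>" and "\<epsilon> \<le> 1" and al: "0 \<le> al" "al \<le> 1"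
  shows "a * exp (a * real x) \<le> d * exp (d * real y) \<Longrightarrow>
      potential a d (Suc x) y - potential a d x y \<le> (1 + \<epsilon>) * (al * a * exp (a * real x) + (1 - al) * d * exp (d * real y))"
    and "\<not> a * exp (a * real x) \<le> d * exp (d * real y) \<Longrightarrow>
      potential a d x (Suc y) - potential a d x y \<le> (1 + \<epsilon>) * (al * a * exp (a * real x) + (1 - al) * d * exp (d * real y))"
proof -
  let ?p = "a * exp (a * real x)" and ?q = "d * exp (d * real y)"
  have e: "0 \<le> 1 + \<epsilon>" using a by simp
  { assume "?p \<le> ?q"
    then have "(1 - al) * ?p \<le> (1 - al) * ?q" using al by (intro mult_left_mono) auto
    then have "?p \<le> al * a * exp (a * real x) + (1 - al) * d * exp (d * real y)" by (simp add: algebra_simps)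
    from mult_left_mono[OF this e] exp_increment_le[OF a \<open>\<epsilon> \<le> 1\<close>, of x]
    show "potential a d (Suc x) y - potential a d x y \<le> (1 + \<epsilon>) * (al * a * exp (a * real x) + (1 - al) * d * exp (d * real y))"
      by (simp add: potential_def) }
  { assume "\<not> ?p \<le> ?q"
    then have "al * ?q \<le> al * ?p" using al by (intro mult_left_mono) auto
    then have "?q \<le> al * a * exp (a * real x) + (1 - al) * d * exp (d * real y)" by (simp add: algebra_simps)
    from mult_left_mono[OF this e] exp_increment_le[OF d \<open>\<epsilon> \<le> 1\<close>, of y]
    show "potential a d x (Suc y) - potential a d x y \<le> (1 + \<epsilon>) * (al * a * exp (a * real x) + (1 - al) * d * exp (d * real y))"
      by (simp add: potential_def) }
qed

section \<open>Growth and drift of the relaxed penalty function\<close>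

lemma relaxed_bound:
  assumes "0 \<le> \<kappa>" "0 \<le> \<gamma>" "0 \<le> a" "a \<le> \<epsilon>" "0 \<le> d" "d \<le> \<epsilon>"
  shows "\<bar>relaxed \<kappa> \<gamma> a d (x, y)\<bar> \<le> 2 * \<gamma> * exp (\<epsilon> * real (x + y))"
proof -
  have "0 \<le> potential a d x' y'" for x' y' by (simp add: potential_def)
  then have "0 \<le> relaxed \<kappa> \<gamma> a d (x, y)"
    using assms by (rule_tac relaxed_attained[of y \<kappa> \<gamma> a d x]) simp
  moreover have "a * real x \<le> \<epsilon> * real (x + y)" "d * real y \<le> \<epsilon> * real (x + y)"
    using assms by (auto intro!: mult_mono)
  then have "\<gamma> * potential a d x y \<le> \<gamma> * (2 * exp (\<epsilon> * real (x + y)))"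
    using assms unfolding potential_def by (intro mult_left_mono) (smt (verit) exp_le_cancel_iff)+
  ultimately show ?thesis using relaxed_le[of 0 y \<kappa> \<gamma> a d x] by simp
qed

lemma relaxed_departure_x:
  assumes D: "D \<le> y" "relaxed \<kappa> \<gamma> a d (x, y) = \<kappa> * real D + \<gamma> * potential a d (x + D) (y - D)"
  shows "real x * (relaxed \<kappa> \<gamma> a d (x - 1, y) - relaxed \<kappa> \<gamma> a d (x, y))
    \<le> real x * (\<gamma> * (potential a d (x + D - 1) (y - D) - potential a d (x + D) (y - D)))"
proof (cases x)
  case (Suc n)
  show ?thesis
    using relaxed_le[OF D(1), of \<kappa> \<gamma> a d n] unfolding D(2)
    by (intro mult_left_mono) (auto simp: Suc algebra_simps)
qed simp

text \<open>Of the \<open>y\<close> departures, \<open>D\<close> are charged to moved requests: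
  there \<open>D - 1\<close> is a competitor, which saves one \<kappa> and lowers the first argument
  of the potential. For the other \<open>y - D\<close>, the old \<open>D\<close> stays admissible
  and the second argument drops.\<close>

lemma relaxed_departure_y:
  assumes D: "D \<le> y" "relaxed \<kappa> \<gamma> a d (x, y) = \<kappa> * real D + \<gamma> * potential a d (x + D) (y - D)"
  shows "real y * (relaxed \<kappa> \<gamma> a d (x, y - 1) - relaxed \<kappa> \<gamma> a d (x, y))
    \<le> real D * (\<gamma> * (potential a d (x + D - 1) (y - D) - potential a d (x + D) (y - D)) - \<kappa>)
      + real (y - D) * (\<gamma> * (potential a d (x + D) (y - D - 1) - potential a d (x + D) (y - D)))"
proof -
  let ?F = "relaxed \<kappa> \<gamma> a d"
  have "real D * (?F (x, y - 1) - ?F (x, y)) \<le>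
      real D * (\<gamma> * (potential a d (x + D - 1) (y - D) - potential a d (x + D) (y - D)) - \<kappa>)"
  proof (cases D)
    case (Suc n)
    have "n \<le> y - 1" "y - 1 - n = y - D" using D(1) Suc by auto
    then show ?thesis
      using relaxed_le[of n "y - 1" \<kappa> \<gamma> a d x] unfolding D(2)
      by (intro mult_left_mono) (auto simp: Suc algebra_simps)
  qed simp
  moreover have "real (y - D) * (?F (x, y - 1) - ?F (x, y)) \<le>
      real (y - D) * (\<gamma> * (potential a d (x + D) (y - D - 1) - potential a d (x + D) (y - D)))"
  proof (cases "y - D")
    case (Suc n)
    then have "D \<le> y - 1" "y - 1 - D = y - D - 1" by auto
    then show ?thesis
      using relaxed_le[of D "y - 1" \<kappa> \<gamma> a d x] unfolding D(2)
      by (intro mult_left_mono) (auto simp: algebra_simps)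
  qed simp
  moreover have "real y = real D + real (y - D)" using D(1) by simp
  ultimately show ?thesis by (simp only: distrib_right)
qed

text \<open>The minimiser \<open>D\<close> at the current state yields a competitor after every
  transition, so the potential may be followed at the virtual state \<open>(X, Y)\<close>, where the
  penalty rule is obeyed without capacity; a blocked arrival adds \<kappa>. Departures of moved
  requests contribute \<open>- m * \<kappa> * D\<close>, which completes the bound to a multiple of
  \<open>F\<close> itself.\<close>

lemma relaxed_drift:
  fixes l m a d \<epsilon> al \<kappa> \<gamma> B K \<theta> :: real
  assumes a: "0 \<le> a" "a \<le> \<epsilon>" and d: "0 \<le> d" "d \<le> \<epsilon>" and \<epsilon>: "\<epsilon> \<le> 1" and al: "0 \<le> al" "al \<le> 1"
    and l: "0 \<le> l" and m: "0 \<le> m" and \<kappa>: "0 \<le> \<kappa>" and \<gamma>: "0 \<le> \<gamma>"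
    and balance: "l * (al * a) = m * B" "l * ((1 - al) * d) = m * B"
    and \<theta>: "1 + \<theta> = (1 + \<epsilon>) * (1 + (1 + \<epsilon>) * B)" and K: "2 * exp \<theta> / (1 + \<epsilon>) \<le> K"
    and adm: "adm \<Longrightarrow> a * exp (a * real x) \<le> d * exp (d * real y)"
  defines "F \<equiv> relaxed \<kappa> \<gamma> a d"
  shows "l * ((if adm then F (x + 1, y) else F (x, y + 1)) - F (x, y))
      + m * real x * (F (x - 1, y) - F (x, y)) + m * real y * (F (x, y - 1) - F (x, y))
    \<le> (\<kappa> * l * of_bool (\<not> adm \<and> a * exp (a * real x) \<le> d * exp (d * real y)) + m * \<gamma> * K) - m * F (x, y)"
proof -
  obtain D where D: "D \<le> y" "F (x, y) = \<kappa> * real D + \<gamma> * potential a d (x + D) (y - D)"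
    unfolding F_def by (rule relaxed_attained)
  define X where "X = x + D"
  define Y where "Y = y - D"
  define \<Phi> where "\<Phi> = potential a d X Y"
  let ?blocked = "\<not> adm \<and> a * exp (a * real x) \<le> d * exp (d * real y)"
  define I where "I = (1 + \<epsilon>) * (al * a * exp (a * real X) + (1 - al) * d * exp (d * real Y))"
  have F: "F (x, y) = \<kappa> * real D + \<gamma> * \<Phi>" by (simp add: D(2) X_def Y_def \<Phi>_def)
  \<comment> \<open>Moving requests enlarges the first derivative and shrinks the second, so a
    preference for the first system at \<open>(X, Y)\<close> implies the same preference at
    \<open>(x, y)\<close>.\<close>
  have mono: "a * exp (a * real x) \<le> a * exp (a * real X)" "d * exp (d * real Y) \<le> d * exp (d * real y)"
    using a d by (auto simp: X_def Y_def intro!: mult_left_mono)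
  note arrival_le = potential_arrival_le[OF a d \<epsilon> al, of X Y, folded \<Phi>_def I_def]
  have arrival: "(if adm then F (x + 1, y) else F (x, y + 1)) - F (x, y) \<le> \<kappa> * of_bool ?blocked + \<gamma> * I"
  proof (cases "a * exp (a * real X) \<le> d * exp (d * real Y)")
    case True
    have I: "\<gamma> * potential a d (Suc X) Y \<le> \<gamma> * (\<Phi> + I)"
      using arrival_le(1)[OF True] \<gamma> by (intro mult_left_mono) auto
    show ?thesis
    proof (cases adm)
      case True
      then show ?thesis
        using relaxed_le[OF D(1), of \<kappa> \<gamma> a d "x + 1"] I F
        by (simp add: F_def[symmetric] X_def Y_def[symmetric] algebra_simps)
    next
      \<comment> \<open>The virtual system accepts and the true one does not: the request is
        blocked, and the competitor \<open>D + 1\<close> costs one \<kappa>.\<close>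
      case False
      with True mono have "?blocked" by linarith
      then show ?thesis
        using relaxed_le[of "D + 1" "y + 1" \<kappa> \<gamma> a d x] I F D(1) False
        by (simp add: F_def[symmetric] X_def Y_def[symmetric] algebra_simps)
    qed
  next
    case False
    have I: "\<gamma> * potential a d X (Suc Y) \<le> \<gamma> * (\<Phi> + I)"
      using arrival_le(2)[OF False] \<gamma> by (intro mult_left_mono) auto
    have b: "0 \<le> \<kappa> * of_bool ?blocked" using \<kappa> by simp
    show ?thesis
    proof (cases adm)
      case True
      \<comment> \<open>The virtual system rejects an accepted request. The two states must then
        differ, so \<open>D > 0\<close>, and \<open>D - 1\<close> is the competitor.\<close>
      have "D \<noteq> 0"
      proof
        assume "D = 0"
        then have "X = x" "Y = y" by (simp_all add: X_def Y_def)
        with False adm[OF True] show False by simp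
      qed
      then obtain E where E: "D = Suc E" by (cases D) auto
      have "y - E = Suc Y" using D(1) E by (simp add: Y_def)
      then show ?thesis
        using relaxed_le[of E y \<kappa> \<gamma> a d "x + 1"] I F D(1) True E b \<kappa>
        by (simp add: F_def[symmetric] X_def algebra_simps)
    next
      case adm: False
      have "y + 1 - D = Suc Y" using D(1) by (simp add: Y_def)
      then show ?thesis
        using relaxed_le[of D "y + 1" \<kappa> \<gamma> a d x] I F D(1) adm b
        by (simp add: F_def[symmetric] X_def algebra_simps)
    qed
  qed
  \<comment> \<open>By \<open>balance\<close> both exponentials receive the same coefficient, so the
    arrival drift becomes a multiple of \<Phi>.\<close>
  have lI: "l * I = m * ((1 + \<epsilon>) * B * \<Phi>)"
  proof -
    have "l * I = (1 + \<epsilon>) * ((l * (al * a)) * exp (a * real X) + (l * ((1 - al) * d)) * exp (d * real Y))"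
      unfolding I_def by (simp add: algebra_simps)
    also have "\<dots> = m * ((1 + \<epsilon>) * B * \<Phi>)"
      unfolding balance by (simp add: \<Phi>_def potential_def algebra_simps)
    finally show ?thesis .
  qed
  have "l * ((if adm then F (x + 1, y) else F (x, y + 1)) - F (x, y)) \<le> l * (\<kappa> * of_bool ?blocked + \<gamma> * I)"
    by (rule mult_left_mono[OF arrival l])
  also have "\<dots> = \<kappa> * l * of_bool ?blocked + m * (\<gamma> * ((1 + \<epsilon>) * B * \<Phi>))"
  proof -
    have "l * (\<kappa> * of_bool ?blocked + \<gamma> * I) = \<kappa> * l * of_bool ?blocked + \<gamma> * (l * I)"
      by (simp only: distrib_left mult_ac)
    also have "\<gamma> * (l * I) = m * (\<gamma> * ((1 + \<epsilon>) * B * \<Phi>))"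
      unfolding lI by (rule mult.left_commute)
    finally show ?thesis .
  qed
  finally have up: "l * ((if adm then F (x + 1, y) else F (x, y + 1)) - F (x, y))
      \<le> \<kappa> * l * of_bool ?blocked + m * (\<gamma> * ((1 + \<epsilon>) * B * \<Phi>))" .
  have "real x * (F (x - 1, y) - F (x, y)) + real y * (F (x, y - 1) - F (x, y)) \<le>
      \<gamma> * (real X * (potential a d (X - 1) Y - \<Phi>) + real Y * (potential a d X (Y - 1) - \<Phi>)) - \<kappa> * real D"
    using relaxed_departure_x[OF D[unfolded F_def]] relaxed_departure_y[OF D[unfolded F_def]]
    by (simp add: F_def[symmetric] X_def[symmetric] Y_def[symmetric] \<Phi>_def[symmetric])
       (simp add: X_def algebra_simps)
  also have "\<dots> \<le> \<gamma> * ((2 * exp \<theta> - (1 + \<theta>) * \<Phi>) / (1 + \<epsilon>)) - \<kappa> * real D"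
    using mult_left_mono[OF potential_departure_le[OF a d, of X Y \<theta>] \<gamma>] by (simp add: \<Phi>_def)
  \<comment> \<open>The purpose of \<theta>: the coefficient of \<Phi> here exceeds that of the
    arrival drift by exactly one.\<close>
  also have "(2 * exp \<theta> - (1 + \<theta>) * \<Phi>) / (1 + \<epsilon>) = 2 * exp \<theta> / (1 + \<epsilon>) - (1 + (1 + \<epsilon>) * B) * \<Phi>"
    using a unfolding \<theta> by (simp add: diff_divide_distrib)
  also have "\<gamma> * (2 * exp \<theta> / (1 + \<epsilon>) - (1 + (1 + \<epsilon>) * B) * \<Phi>) \<le> \<gamma> * (K - (1 + (1 + \<epsilon>) * B) * \<Phi>)"
    using K \<gamma> by (intro mult_left_mono) auto
  finally have "real x * (F (x - 1, y) - F (x, y)) + real y * (F (x, y - 1) - F (x, y))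
      \<le> \<gamma> * (K - (1 + (1 + \<epsilon>) * B) * \<Phi>) - \<kappa> * real D" by simp
  from mult_left_mono[OF this m] have down: "m * real x * (F (x - 1, y) - F (x, y)) + m * real y * (F (x, y - 1) - F (x, y))
      \<le> m * (\<gamma> * (K - (1 + (1 + \<epsilon>) * B) * \<Phi>) - \<kappa> * real D)"
    by (simp only: distrib_left mult.assoc)
  have "l * ((if adm then F (x + 1, y) else F (x, y + 1)) - F (x, y))
      + m * real x * (F (x - 1, y) - F (x, y)) + m * real y * (F (x, y - 1) - F (x, y))
    \<le> \<kappa> * l * of_bool ?blocked + m * (\<gamma> * ((1 + \<epsilon>) * B * \<Phi>))
      + m * (\<gamma> * (K - (1 + (1 + \<epsilon>) * B) * \<Phi>) - \<kappa> * real D)"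
    using up down by linarith
  also have "\<dots> = (\<kappa> * l * of_bool ?blocked + m * \<gamma> * K) - m * F (x, y)"
    unfolding F by (simp add: algebra_simps)
  finally show ?thesis .
qed

lemma penalty_condition_iff:
  assumes "c1 \<noteq> 0"
  shows "penalty_condition \<beta> bi c0 c1 x y \<longleftrightarrow>
    \<beta> * bi / c0 * exp (\<beta> * bi / c0 * x) \<le> \<beta> * bi / c1 * exp (\<beta> * bi / c1 * y)"
proof -
  have "((\<lambda>u. Psi \<beta> bi c0 c1 u y) has_field_derivative \<beta> * bi / c0 * exp (\<beta> * bi / c0 * x)) (at x)"
    unfolding Psi_def by (auto intro!: derivative_eq_intros simp: divide_inverse mult_ac)
  moreover have "((\<lambda>v. Psi \<beta> bi c0 c1 x v) has_field_derivative \<beta> * bi / c1 * exp (\<beta> * bi / c1 * y)) (at y)"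
    unfolding Psi_def by (auto intro!: derivative_eq_intros simp: divide_inverse mult_ac)
  ultimately show ?thesis
    unfolding penalty_condition_def using assms by (simp add: DERIV_imp_deriv)
qed

lemma balance_cancel:
  fixes l m e g x \<beta> :: real
  assumes "0 < l" "0 < m" "0 < e" "0 < g" "0 < x"
  shows "l * (g * (\<beta> * x / (e * g * x * (l / m)))) = m * (\<beta> / e)"
  using assms by (simp add: field_simps)

text \<open>Jensen's inequality for the exponential, from its tangent at the mean
  \<open>m\<close>.\<close>

lemma exp_weighted_mean_le:
  fixes w s :: "'i \<Rightarrow> real"
  assumes "\<And>j. j \<in> A \<Longrightarrow> 0 \<le> w j" and w: "sum w A = 1"
  shows "exp (\<Sum>j\<in>A. w j * s j) \<le> (\<Sum>j\<in>A. w j * exp (s j))"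
proof -
  define m where "m = (\<Sum>j\<in>A. w j * s j)"
  have "exp m = exp m * ((\<Sum>j\<in>A. w j) + (\<Sum>j\<in>A. w j * s j) - m * (\<Sum>j\<in>A. w j))"
    by (simp add: w m_def)
  also have "\<dots> = (\<Sum>j\<in>A. w j * (exp m * (1 + (s j - m))))"
    by (simp add: sum_distrib_left sum.distrib[symmetric] sum_subtractf[symmetric] algebra_simps)
  also have "\<dots> \<le> (\<Sum>j\<in>A. w j * exp (s j))"
  proof (rule sum_mono, rule mult_left_mono)
    fix j
    have "exp m * (1 + (s j - m)) \<le> exp m * exp (s j - m)"
      by (intro mult_left_mono exp_ge_add_one_self) auto
    then show "exp m * (1 + (s j - m)) \<le> exp (s j)" by (simp add: mult_exp_exp)
  qed (use assms in auto)
  finally show ?thesis by (simp add: m_def)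
qed

section \<open>Constants of the penalty policy\<close>

locale penalty_system = loss_system lam mu y0 admit
  for lam mu :: "'i::finite \<Rightarrow> real" and y0 admit +
  fixes b \<alpha> c0 c1 :: "'i \<Rightarrow> real" and cap \<epsilon> \<beta> :: real
  assumes \<epsilon>: "0 < \<epsilon>" "\<epsilon> < 1 / 4" and \<beta>: "4 \<le> \<beta>" and b: "b i > 0"
    and \<alpha>: "0 < \<alpha> i" "\<alpha> i \<le> 1"
    and c0: "c0 i = (1 + 4 * \<epsilon>) * \<alpha> i * b i * (lam i / mu i)"
    and c1: "c1 i = (1 + 4 * \<epsilon>) * (1 - \<alpha> i) * b i * (lam i / mu i)"
    and \<beta>_c0: "\<beta> * b i \<le> \<epsilon> * c0 i" and \<beta>_c1: "\<alpha> i < 1 \<Longrightarrow> \<beta> * b i \<le> \<epsilon> * c1 i"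
    and y0: "real (y0 i) = (1 - \<alpha> i) * (lam i / mu i)"
    and c0_cap: "(\<Sum>j\<in>UNIV. c0 j) \<le> cap"
    and admit_iff: "admit i v \<longleftrightarrow>
      penalty_condition \<beta> (b i) (c0 i) (c1 i) (real (fst (v i))) (real (snd (v i))) \<and>
      (\<Sum>j\<in>UNIV. b j * real (fst (v j))) + b i \<le> cap"
begin

definition a :: "'i \<Rightarrow> real" where "a i = \<beta> * b i / c0 i"
definition d :: "'i \<Rightarrow> real" where "d i = \<beta> * b i / c1 i"
text \<open>The common value of both exponents at the fluid equilibrium
  \<open>x = \<alpha> i * (lam i / mu i)\<close>,
  \<open>y = (1 - \<alpha> i) * (lam i / mu i)\<close>; the second exponent exists for
  \<open>\<alpha> i < 1\<close>.\<close>

definition load :: real where "load = \<beta> / (1 + 4 * \<epsilon>)"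
definition \<theta> :: real where "\<theta> = (1 + \<epsilon>) * (1 + (1 + \<epsilon>) * load) - 1"
definition K :: real where "K = 2 * exp (\<beta> * (1 - \<epsilon> / 2))"

lemma \<beta>_pos: "0 < \<beta>" using \<beta> by simp
lemma \<rho>_pos: "0 < lam i / mu i" using lam_pos mu_pos by simp
lemma c0_pos: "0 < c0 i"
  unfolding c0 using \<epsilon> \<alpha>[of i] b[of i] \<rho>_pos[of i] by (intro mult_pos_pos) auto
lemma c1_pos: "\<alpha> i < 1 \<Longrightarrow> 0 < c1 i"
  unfolding c1 using \<epsilon> b[of i] \<rho>_pos[of i] by (intro mult_pos_pos) auto
lemma a_pos: "0 < a i" unfolding a_def using \<beta>_pos b c0_pos by simp
lemma a_le: "a i \<le> \<epsilon>" unfolding a_def using \<beta>_c0[of i] c0_pos[of i] by (simp add: divide_le_eq)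
lemma d_pos: "\<alpha> i < 1 \<Longrightarrow> 0 < d i" unfolding d_def using \<beta>_pos b c1_pos by simp
lemma d_le: "\<alpha> i < 1 \<Longrightarrow> d i \<le> \<epsilon>"
  unfolding d_def using \<beta>_c1[of i] c1_pos[of i] by (simp add: divide_le_eq)

lemma balance_a: "lam i * (\<alpha> i * a i) = mu i * load"
  unfolding a_def c0 load_def
  by (rule balance_cancel) (use \<alpha>[of i] b[of i] \<epsilon> lam_pos[of i] mu_pos[of i] in simp_all)

lemma balance_d: "\<alpha> i < 1 \<Longrightarrow> lam i * ((1 - \<alpha> i) * d i) = mu i * load"
  unfolding d_def c1 load_def
  by (rule balance_cancel) (use b[of i] \<epsilon> lam_pos[of i] mu_pos[of i] in simp_all)

text \<open>After multiplication by \<open>1 + 4 * \<epsilon>\<close> the terms in \<beta> leave a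
  slack of \<open>\<epsilon> * \<beta> * (3 / 2 - 3 * \<epsilon>)\<close>, which has to cover
  \<open>\<epsilon> * (1 + 4 * \<epsilon>)\<close>; it does for \<beta> \<ge> 4 and \<epsilon> <
  1/4.\<close>

lemma \<theta>_le: "\<theta> \<le> \<beta> * (1 - \<epsilon> / 2)"
proof -
  have e: "0 < 1 + 4 * \<epsilon>" using \<epsilon> by simp
  have "1 + 4 * \<epsilon> \<le> 4 * (3 / 2 - 3 * \<epsilon>)" using \<epsilon> by simp
  also have "\<dots> \<le> \<beta> * (3 / 2 - 3 * \<epsilon>)" using \<epsilon> \<beta> by (intro mult_right_mono) auto
  finally have "\<epsilon> * (1 + 4 * \<epsilon>) \<le> \<epsilon> * (\<beta> * (3 / 2 - 3 * \<epsilon>))" using \<epsilon> by (intro mult_left_mono) auto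
  then have "\<epsilon> * (1 + 4 * \<epsilon>) + (1 + \<epsilon>)\<^sup>2 * \<beta> \<le> \<beta> * (1 - \<epsilon> / 2) * (1 + 4 * \<epsilon>)"
    by (simp add: power2_eq_square algebra_simps)
  then have "\<epsilon> + (1 + \<epsilon>)\<^sup>2 * load \<le> \<beta> * (1 - \<epsilon> / 2)"
    unfolding load_def using e by (simp add: field_simps)
  then show ?thesis by (simp add: \<theta>_def power2_eq_square algebra_simps)
qed

lemma \<theta>_eq: "1 + \<theta> = (1 + \<epsilon>) * (1 + (1 + \<epsilon>) * load)"
  by (simp add: \<theta>_def)

lemma K_ge: "2 * exp \<theta> / (1 + \<epsilon>) \<le> K"
proof -
  have "2 * exp \<theta> / (1 + \<epsilon>) \<le> 2 * exp \<theta> / 1" using \<epsilon> by (intro divide_left_mono) auto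
  also have "\<dots> \<le> K" using \<theta>_le by (simp add: K_def)
  finally show ?thesis .
qed

lemma load_nonneg: "0 \<le> load" and load_le: "load \<le> \<beta> * (1 - \<epsilon> / 2)"
proof -
  show "0 \<le> load" using \<beta>_pos \<epsilon> by (simp add: load_def)
  then have "load \<le> \<theta>" using \<epsilon> by (simp add: \<theta>_def algebra_simps)
  then show "load \<le> \<beta> * (1 - \<epsilon> / 2)" using \<theta>_le by simp
qed

lemma K_pos: "0 < K" by (simp add: K_def)

text \<open>The initial load puts the second exponent at its fluid value \<open>load\<close> and
  leaves the first at zero, so the process starts below the level \<open>K\<close> of the drift
  bound.\<close>

lemma initial_potential:
  assumes "\<alpha> i < 1"
  shows "potential (a i) (d i) 0 (y0 i) \<le> K"
proof -
  have "d i * real (y0 i) = load"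
    using balance_d[OF assms] mu_pos[of i] by (simp add: y0 field_simps)
  then have "potential (a i) (d i) 0 (y0 i) = 1 + exp load" by (simp add: potential_def)
  also have "\<dots> \<le> 2 * exp load" using load_nonneg by simp
  also have "\<dots> \<le> K" using load_le by (simp add: K_def)
  finally show ?thesis .
qed

section \<open>Exponential moments and the probability of blocking\<close>

abbreviation capacity_blocked :: "'i \<Rightarrow> ('i \<Rightarrow> nat \<times> nat) \<Rightarrow> bool" where
  "capacity_blocked i v \<equiv> cap < (\<Sum>j\<in>UNIV. b j * real (fst (v j))) + b i"

text \<open>A request that meets the penalty condition and is refused can only lack
  capacity.\<close>

lemma generator_relaxed_le:
  assumes "\<alpha> i < 1" "0 \<le> \<kappa>" "0 \<le> \<gamma>"
  shows "generator i (relaxed \<kappa> \<gamma> (a i) (d i)) v \<le>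
    (\<kappa> * lam i * of_bool (capacity_blocked i v) + mu i * \<gamma> * K) - mu i * relaxed \<kappa> \<gamma> (a i) (d i) (v i)"
proof -
  obtain x y where v: "v i = (x, y)" by (cases "v i")
  have pen: "penalty_condition \<beta> (b i) (c0 i) (c1 i) (real x) (real y) \<longleftrightarrow>
      a i * exp (a i * real x) \<le> d i * exp (d i * real y)"
    using penalty_condition_iff[of "c1 i" \<beta> "b i" "c0 i"] c1_pos[OF assms(1)] by (simp add: a_def d_def)
  have "generator i (relaxed \<kappa> \<gamma> (a i) (d i)) v \<le>
    (\<kappa> * lam i * of_bool (\<not> admit i v \<and> a i * exp (a i * real x) \<le> d i * exp (d i * real y)) + mu i * \<gamma> * K)
      - mu i * relaxed \<kappa> \<gamma> (a i) (d i) (v i)"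
    unfolding generator_eq v fst_conv snd_conv
  proof (rule relaxed_drift[where al = "\<alpha> i" and B = load and \<theta> = \<theta> and \<epsilon> = \<epsilon>])
    show "admit i v \<Longrightarrow> a i * exp (a i * real x) \<le> d i * exp (d i * real y)"
      using pen by (simp add: admit_iff v)
  qed (use assms a_pos[of i] a_le[of i] d_pos[OF assms(1)] d_le[OF assms(1)] \<epsilon> \<alpha>[of i] lam_pos[of i] mu_pos[of i]
      balance_a[of i] balance_d[OF assms(1)] \<theta>_eq K_ge in simp_all)
  also have "\<dots> \<le> (\<kappa> * lam i * of_bool (capacity_blocked i v) + mu i * \<gamma> * K) - mu i * relaxed \<kappa> \<gamma> (a i) (d i) (v i)"
    using assms(2) lam_pos[of i] by (auto simp: admit_iff v pen)
  finally show ?thesis .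
qed

lemma relaxed_growth:
  assumes "\<alpha> i < 1" "0 \<le> \<kappa>" "0 \<le> \<gamma>"
  shows "\<bar>relaxed \<kappa> \<gamma> (a i) (d i) (x, y)\<bar> \<le> 2 * \<gamma> * exp (\<epsilon> * real (x + y))"
  using assms a_pos[of i] a_le[of i] d_pos[of i] d_le[of i] by (intro relaxed_bound) auto

lemma exp_occupancy_le:
  assumes s: "0 \<le> s"
  shows "integrable Path (\<lambda>w. exp (a i * real (fst (state s w i))))"
    and "(\<integral>w. exp (a i * real (fst (state s w i))) \<partial>Path) \<le> K"
proof -
  interpret Path: prob_space Path by (rule prob_space_Path)
  have a0: "0 \<le> a i" using a_pos[of i] by simp
  have bound: "\<bar>exp (a i * real (fst (v i)))\<bar> \<le> 1 * exp (a i * real (fst (v i) + snd (v i)))" for v :: "'i \<Rightarrow> nat \<times> nat"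
    using a0 by (simp add: algebra_simps)
  show int: "integrable Path (\<lambda>w. exp (a i * real (fst (state s w i))))"
    by (rule expectation_state_bound[where i = i and t = s and C = 1 and \<kappa> = "a i" and g = "\<lambda>v. exp (a i * real (fst (v i)))"])
       (use a0 bound in simp_all)
  \<comment> \<open>The comparison bound is a convex combination of the initial value and
    \<open>K\<close>.\<close>
  have decay: "f0 * exp (- mu i * s) + mu i * K / mu i * (1 - exp (- mu i * s)) \<le> K" if "f0 \<le> K" for f0
  proof -
    have "exp (- mu i * s) \<le> 1" using s mu_pos[of i] by simp
    then have "f0 * exp (- mu i * s) \<le> K * exp (- mu i * s)" using that by (intro mult_right_mono) auto
    then show ?thesis using mu_pos[of i] by (simp add: algebra_simps)
  qed
  obtain f C \<kappa> where f: "0 \<le> \<kappa>" "\<And>x y. \<bar>f (x, y)\<bar> \<le> C * exp (\<kappa> * real (x + y))"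
    and ge: "\<And>x y. exp (a i * real x) \<le> f (x, y)" and init: "f (0, y0 i) \<le> K"
    and drift: "\<And>v. generator i f v \<le> mu i * K - mu i * f (v i)"
  proof (cases "\<alpha> i < 1")
    case True
    show ?thesis
    proof (rule that[of \<epsilon> "relaxed 0 1 (a i) (d i)" "2 * 1"])
      show "\<bar>relaxed 0 1 (a i) (d i) (x, y)\<bar> \<le> 2 * 1 * exp (\<epsilon> * real (x + y))" for x y
        by (rule relaxed_growth[OF True]) auto
      show "exp (a i * real x) \<le> relaxed 0 1 (a i) (d i) (x, y)" for x y
      proof (rule relaxed_attained[of y 0 1 "a i" "d i" x])
        fix D assume "relaxed 0 1 (a i) (d i) (x, y) = 0 * real D + 1 * potential (a i) (d i) (x + D) (y - D)"
        moreover have "exp (a i * real x) \<le> exp (a i * real (x + D))" using a0 by (simp add: algebra_simps)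
        ultimately show ?thesis by (simp add: potential_def add_increasing2)
      qed
      show "relaxed 0 1 (a i) (d i) (0, y0 i) \<le> K"
        using relaxed_le[of 0 "y0 i" 0 1 "a i" "d i" 0] initial_potential[OF True] by simp
      show "generator i (relaxed 0 1 (a i) (d i)) v \<le> mu i * K - mu i * relaxed 0 1 (a i) (d i) (v i)" for v
        using generator_relaxed_le[OF True, of 0 1 v] by simp
    qed (use \<epsilon> in simp)
  next
    case False
    \<comment> \<open>Here \<open>c1 i = 0\<close> and there is no second exponential. The total
      number of requests is used instead: it does not depend on the routing and dominates the number
      in the original system.\<close>
    then have \<alpha>1: "\<alpha> i = 1" using \<alpha>[of i] by simp
    have y00: "y0 i = 0" using y0[of i] \<alpha>1 by simp
    have la: "lam i * a i = mu i * load" using balance_a[of i] \<alpha>1 by simp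
    show ?thesis
    proof (rule that[of "a i" "\<lambda>q. exp (a i * real (fst q + snd q))" 1])
      show "exp (a i * real (fst (0::nat, y0 i) + snd (0::nat, y0 i))) \<le> K"
        using order_trans[OF load_nonneg load_le] one_le_exp_iff[of "\<beta> * (1 - \<epsilon> / 2)"]
        by (simp only: K_def y00) (simp del: one_le_exp_iff)
      fix v :: "'i \<Rightarrow> nat \<times> nat"
      obtain x y where v: "v i = (x, y)" by (cases "v i")
      let ?u = "exp (a i * real (x + y))"
      let ?dep = "exp (a i * real (x + y - 1)) - ?u"
      have dep_x: "real x * (exp (a i * real (x - 1 + y)) - ?u) = real x * ?dep"
        by (cases x) simp_all
      have dep_y: "real y * (exp (a i * real (x + (y - 1))) - ?u) = real y * ?dep"
        by (cases y) simp_all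
      have "generator i (\<lambda>q. exp (a i * real (fst q + snd q))) v =
          lam i * (exp (a i * real (Suc (x + y))) - ?u) + mu i * (real x * (exp (a i * real (x - 1 + y)) - ?u))
            + mu i * (real y * (exp (a i * real (x + (y - 1))) - ?u))"
        by (simp add: generator_eq v mult.assoc)
      also have "\<dots> = lam i * (exp (a i * real (Suc (x + y))) - ?u) + mu i * (real (x + y) * ?dep)"
        unfolding dep_x dep_y by (simp only: of_nat_add distrib_left distrib_right add.assoc)
      also have "\<dots> \<le> lam i * ((1 + \<epsilon>) * (a i * ?u)) + mu i * ((exp \<theta> - (1 + \<theta>) * ?u) / (1 + \<epsilon>))"
        using lam_pos[of i] mu_pos[of i] a0 a_le[of i] \<epsilon>
        by (intro add_mono mult_left_mono exp_increment_le exp_departure_le) auto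
      also have "\<dots> = mu i * (exp \<theta> / (1 + \<epsilon>)) - mu i * ?u"
      proof -
        have dep: "(exp \<theta> - (1 + \<theta>) * ?u) / (1 + \<epsilon>) = exp \<theta> / (1 + \<epsilon>) - (1 + (1 + \<epsilon>) * load) * ?u"
          using \<epsilon> unfolding \<theta>_eq by (simp add: diff_divide_distrib)
        have arr: "lam i * ((1 + \<epsilon>) * (a i * ?u)) = mu i * ((1 + \<epsilon>) * load * ?u)"
          using arg_cong[OF la, of "\<lambda>z. z * ((1 + \<epsilon>) * ?u)"] by (simp add: mult_ac)
        show ?thesis unfolding dep arr by (simp add: right_diff_distrib distrib_right distrib_left)
      qed
      also have "\<dots> \<le> mu i * K - mu i * ?u"
      proof -
        have "0 \<le> exp \<theta> / (1 + \<epsilon>)" using \<epsilon> by simp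
        then have "exp \<theta> / (1 + \<epsilon>) \<le> K" using K_ge by simp
        then show ?thesis using mu_pos[of i] by (intro diff_right_mono mult_left_mono) auto
      qed
      finally show "generator i (\<lambda>q. exp (a i * real (fst q + snd q))) v \<le>
          mu i * K - mu i * exp (a i * real (fst (v i) + snd (v i)))"
        by (simp add: v)
    qed (use a0 in \<open>simp_all add: mult_left_mono\<close>)
  qed
  have "(\<integral>w. f (state s w i) \<partial>Path) \<le> f (0, y0 i) * exp (- mu i * s) + mu i * K / mu i * (1 - exp (- mu i * s))"
    by (rule drift_bound[where c = "\<lambda>v. mu i * K" and B = "\<bar>mu i * K\<bar>", OF f drift])
       (use s in \<open>simp_all add: Path.prob_space\<close>)
  also have "\<dots> \<le> K" by (rule decay[OF init])
  finally have le: "(\<integral>w. f (state s w i) \<partial>Path) \<le> K" .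
  have "integrable Path (\<lambda>w. f (state s w i))"
    by (rule expectation_state_bound[where i = i and t = s and C = C and \<kappa> = \<kappa> and g = "\<lambda>v. f (v i)"])
       (use f(1) f(2)[of "fst (v i)" "snd (v i)" for v] in simp_all)
  then have "(\<integral>w. exp (a i * real (fst (state s w i))) \<partial>Path) \<le> (\<integral>w. f (state s w i) \<partial>Path)"
    using int ge[of "fst q" "snd q" for q] by (intro integral_mono) auto
  with le show "(\<integral>w. exp (a i * real (fst (state s w i))) \<partial>Path) \<le> K" by simp
qed

definition p_block :: real where "p_block = 2 * exp (- (\<epsilon> / 2) * (\<beta> - 4))"

text \<open>With weights \<open>c0 j / sum c0 UNIV\<close> the mean of the exponents is \<beta>
  times the occupied capacity relative to \<open>sum c0 UNIV\<close>. Under blocking it is at least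
  \<beta> - \<epsilon>, as one request accounts for at most \<epsilon> on this scale. Convexity
  passes to the mean of the exponentials, so only moments of single classes are needed and no joint
  law.\<close>

lemma capacity_blocked_le:
  "of_bool (capacity_blocked i v) \<le>
    exp (\<epsilon> - \<beta>) * (\<Sum>j\<in>UNIV. c0 j / sum c0 UNIV * exp (a j * real (fst (v j))))"
proof -
  define C where "C = sum c0 UNIV"
  have C: "0 < C" unfolding C_def using c0_pos by (intro sum_pos) auto
  have w: "sum (\<lambda>j. c0 j / C) UNIV = 1" "\<And>j. 0 \<le> c0 j / C"
    using C by (auto simp: sum_divide_distrib[symmetric] C_def less_imp_le[OF c0_pos])
  have a_c0: "c0 j / C * (a j * z) = \<beta> / C * (b j * z)" for j z
    using c0_pos[of j] by (simp add: a_def)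
  have "of_bool (capacity_blocked i v) \<le> exp (\<epsilon> - \<beta>) * exp (\<Sum>j\<in>UNIV. c0 j / C * (a j * real (fst (v j))))"
  proof (cases "capacity_blocked i v")
    case True
    have "c0 i \<le> C" unfolding C_def using c0_pos less_imp_le by (intro member_le_sum) auto
    then have "\<beta> * b i \<le> \<epsilon> * C" using \<beta>_c0[of i] \<epsilon> by (meson order_trans mult_left_mono less_imp_le)
    moreover have "C < (\<Sum>j\<in>UNIV. b j * real (fst (v j))) + b i" using True c0_cap by (simp add: C_def)
    then have "\<beta> * C \<le> \<beta> * ((\<Sum>j\<in>UNIV. b j * real (fst (v j))) + b i)" using \<beta>_pos by simp
    ultimately have "(\<beta> - \<epsilon>) * C \<le> \<beta> * (\<Sum>j\<in>UNIV. b j * real (fst (v j)))"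
      by (simp add: algebra_simps)
    then have "\<beta> - \<epsilon> \<le> \<beta> / C * (\<Sum>j\<in>UNIV. b j * real (fst (v j)))"
      using C by (simp add: field_simps)
    also have "\<dots> = (\<Sum>j\<in>UNIV. c0 j / C * (a j * real (fst (v j))))"
      by (simp only: a_c0 sum_distrib_left)
    finally have "1 \<le> exp ((\<epsilon> - \<beta>) + (\<Sum>j\<in>UNIV. c0 j / C * (a j * real (fst (v j)))))" by simp
    then show ?thesis using True by (simp add: exp_add)
  qed simp
  also have "\<dots> \<le> exp (\<epsilon> - \<beta>) * (\<Sum>j\<in>UNIV. c0 j / C * exp (a j * real (fst (v j))))"
    using w by (intro mult_left_mono exp_weighted_mean_le) auto
  finally show ?thesis by (simp add: C_def)
qed

lemma integrable_bounded_state: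
  fixes g :: "('i \<Rightarrow> nat \<times> nat) \<Rightarrow> real"
  assumes "\<And>v. \<bar>g v\<bar> \<le> B"
  shows "integrable Path (\<lambda>w. g (state s w))"
proof -
  interpret Path: prob_space Path by (rule prob_space_Path)
  show ?thesis
    using assms borel_measurable_state(2)[where g = g] by (intro Path.integrable_const_bound[of _ B]) auto
qed

lemma prob_capacity_blocked_le:
  assumes s: "0 \<le> s"
  shows "(\<integral>w. of_bool (capacity_blocked i (state s w)) \<partial>Path) \<le> p_block"
proof -
  define C where "C = sum c0 UNIV"
  have C: "0 < C" unfolding C_def using c0_pos by (intro sum_pos) auto
  have w: "sum (\<lambda>j. c0 j / C) UNIV = 1" "\<And>j. 0 \<le> c0 j / C"
    using C by (auto simp: sum_divide_distrib[symmetric] C_def less_imp_le[OF c0_pos])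
  have "(\<integral>w. of_bool (capacity_blocked i (state s w)) \<partial>Path) \<le>
      (\<integral>w. exp (\<epsilon> - \<beta>) * (\<Sum>j\<in>UNIV. c0 j / C * exp (a j * real (fst (state s w j)))) \<partial>Path)"
  proof (rule integral_mono)
    show "integrable Path (\<lambda>w. of_bool (capacity_blocked i (state s w)) :: real)"
      by (rule integrable_bounded_state[where B = 1]) simp
    show "integrable Path (\<lambda>w. exp (\<epsilon> - \<beta>) * (\<Sum>j\<in>UNIV. c0 j / C * exp (a j * real (fst (state s w j)))))"
      using exp_occupancy_le(1)[OF s] by (intro integrable_mult_right integrable_sum) auto
  qed (simp only: C_def capacity_blocked_le)
  also have "\<dots> = exp (\<epsilon> - \<beta>) * (\<Sum>j\<in>UNIV. c0 j / C * (\<integral>w. exp (a j * real (fst (state s w j))) \<partial>Path))"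
    using exp_occupancy_le(1)[OF s] by simp
  also have "\<dots> \<le> exp (\<epsilon> - \<beta>) * (\<Sum>j\<in>UNIV. c0 j / C * K)"
    using w exp_occupancy_le(2)[OF s] by (intro mult_left_mono sum_mono) auto
  also have "\<dots> = exp (\<epsilon> - \<beta>) * K" by (simp only: sum_distrib_right[symmetric] w mult_1)
  also have "\<dots> = 2 * exp (\<epsilon> - \<beta> * \<epsilon> / 2)"
    by (simp add: K_def mult_exp_exp algebra_simps)
  \<comment> \<open>A factor \<open>exp \<epsilon>\<close> is given away here to reach the form with
    \<open>\<beta> - 4\<close>.\<close>
  also have "\<dots> \<le> p_block"
    using \<epsilon> unfolding p_block_def by (simp add: algebra_simps)
  finally show ?thesis .
qed

section \<open>Lower bounds on the expected occupancy\<close>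

lemma integrable_occupancy: "integrable Path (\<lambda>w. real (fst (state s w i)))"
proof -
  have le: "real (fst (v i)) \<le> exp (real (fst (v i) + snd (v i)))" for v :: "'i \<Rightarrow> nat \<times> nat"
  proof -
    have "real (fst (v i)) \<le> 1 + real (fst (v i) + snd (v i))" by simp
    also have "\<dots> \<le> exp (real (fst (v i) + snd (v i)))" by (rule exp_ge_add_one_self)
    finally show ?thesis .
  qed
  show ?thesis
    by (rule expectation_state_bound[where i = i and t = s and C = 1 and \<kappa> = 1
          and g = "\<lambda>v. real (fst (v i))"]) (use le in simp_all)
qed

text \<open>The total count gains one at rate \<open>lam i\<close> whatever the decision and loses
  one at rate \<open>mu i\<close> per request, as in an infinite-server queue.\<close>

lemma total_generator:
  "generator i (\<lambda>q. f q - real (fst q + snd q)) v = generator i f v - lam i + mu i * real (fst (v i) + snd (v i))"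
proof -
  obtain x y where v: "v i = (x, y)" by (cases "v i")
  have x: "real x * ((g - real (x - 1 + y)) - (h - real (x + y))) = real x * (g - h) + real x" for g h
    by (cases x) (simp_all add: algebra_simps)
  have y: "real y * ((g - real (x + (y - 1))) - (h - real (x + y))) = real y * (g - h) + real y" for g h
    by (cases y) (simp_all add: algebra_simps)
  show ?thesis
    unfolding generator_eq v fst_conv snd_conv mult.assoc x y by (simp add: algebra_simps)
qed

text \<open>The bounds on \<open>y\<close> and on the total are merged in the single function
  \<open>f = G - (x + y)\<close>. Up to a constant \<open>G\<close> dominates \<open>y\<close>, so
  \<open>f\<close> dominates \<open>- x\<close>, and an upper bound on the mean of \<open>f\<close>
  is a lower bound on the mean of \<open>x\<close>.\<close>

lemma expected_occupancy_partial:
  assumes "\<alpha> i < 1" and t: "0 \<le> t"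
  shows "(\<integral>w. real (fst (state t w i)) \<partial>Path) \<ge>
    (1 - \<alpha> i) * (lam i / mu i) + \<alpha> i * (lam i / mu i) * (1 - exp (- mu i * t))
      - p_block * (lam i / mu i) * (1 - exp (- mu i * t)) - ln K / d i"
proof -
  interpret Path: prob_space Path by (rule prob_space_Path)
  have d: "0 < d i" by (rule d_pos[OF assms(1)])
  \<comment> \<open>With this \<gamma> the function \<open>\<gamma> * exp (d i * y)\<close> has
    slope one at \<open>d i * y = ln K\<close>, with tangent \<open>y - (ln K - 1) / d i\<close>.
    The drift constant \<open>mu i * \<gamma> * K\<close> becomes \<open>mu i / d i\<close>, and the
    two terms add up to \<open>ln K / d i\<close>.\<close>
  define \<gamma> where "\<gamma> = 1 / (d i * K)"
  have \<gamma>: "0 \<le> \<gamma>" "\<gamma> * K = 1 / d i" using d K_pos by (simp_all add: \<gamma>_def)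
  define G where "G = relaxed 1 \<gamma> (a i) (d i)"
  define f where "f = (\<lambda>q. G q - real (fst q + snd q))"
  define c where "c = (\<lambda>v. lam i * of_bool (capacity_blocked i v) + (mu i / d i - lam i))"
  have growth: "\<bar>G (x, y)\<bar> \<le> 2 * \<gamma> * exp (\<epsilon> * real (x + y))" for x y
    unfolding G_def by (rule relaxed_growth[OF assms(1)]) (use \<gamma> in auto)
  have f_growth: "\<bar>f (x, y)\<bar> \<le> (2 * \<gamma> + 1) * exp (1 * real (x + y))" for x y
  proof -
    have "real (x + y) \<le> exp (real (x + y))" using exp_ge_add_one_self[of "real (x + y)"] by linarith
    moreover have "exp (\<epsilon> * real (x + y)) \<le> exp (real (x + y))" using \<epsilon> by (simp add: mult_left_le_one_le)
    then have "2 * \<gamma> * exp (\<epsilon> * real (x + y)) \<le> 2 * \<gamma> * exp (real (x + y))"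
      using \<gamma> by (intro mult_left_mono) auto
    ultimately show ?thesis using growth[of x y] unfolding f_def by (simp add: algebra_simps)
  qed
  have drift: "generator i f v \<le> c v - mu i * f (v i)" for v
  proof -
    have "generator i f v = generator i G v - lam i + mu i * real (fst (v i) + snd (v i))"
      unfolding f_def by (rule total_generator)
    also have "generator i G v \<le> (1 * lam i * of_bool (capacity_blocked i v) + mu i * \<gamma> * K) - mu i * G (v i)"
      unfolding G_def by (rule generator_relaxed_le[OF assms(1)]) (use \<gamma> in auto)
    finally have "generator i f v \<le> ((1 * lam i * of_bool (capacity_blocked i v) + mu i * \<gamma> * K) - mu i * G (v i))
        - lam i + mu i * real (fst (v i) + snd (v i))" by simp
    also have "mu i * \<gamma> * K = mu i / d i" using \<gamma>(2) by (simp add: mult.assoc)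
    finally show ?thesis unfolding c_def f_def by (simp add: algebra_simps)
  qed
  have "(\<integral>w. f (state t w i) \<partial>Path) \<le> f (0, y0 i) * exp (- mu i * t) +
      (lam i * p_block + (mu i / d i - lam i)) / mu i * (1 - exp (- mu i * t))"
  proof (rule drift_bound[where c = c and \<kappa> = 1 and C = "2 * \<gamma> + 1" and B = "lam i + \<bar>mu i / d i - lam i\<bar>"])
    show "\<bar>f (x, y)\<bar> \<le> (2 * \<gamma> + 1) * exp (1 * real (x + y))" for x y by (rule f_growth)
    show "generator i f v \<le> c v - mu i * f (v i)" for v by (rule drift)
    show "\<bar>c v\<bar> \<le> lam i + \<bar>mu i / d i - lam i\<bar>" for v
      using lam_pos[of i] unfolding c_def by (auto simp: of_bool_def)
    fix s :: real assume s: "0 \<le> s"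
    have int: "integrable Path (\<lambda>w. of_bool (capacity_blocked i (state s w)) :: real)"
      by (rule integrable_bounded_state[where B = 1]) auto
    have "(\<integral>w. c (state s w) \<partial>Path) =
        lam i * (\<integral>w. of_bool (capacity_blocked i (state s w)) \<partial>Path) + (mu i / d i - lam i)"
      unfolding c_def using int by (simp add: Path.prob_space)
    then show "(\<integral>w. c (state s w) \<partial>Path) \<le> lam i * p_block + (mu i / d i - lam i)"
      using prob_capacity_blocked_le[OF s, of i] lam_pos[of i] by simp
  qed (use t in auto)
  also have "(lam i * p_block + (mu i / d i - lam i)) / mu i = p_block * (lam i / mu i) + 1 / d i - lam i / mu i"
    using mu_pos[of i] by (simp add: field_simps)
  also have "f (0, y0 i) * exp (- mu i * t) \<le> (1 / d i - (1 - \<alpha> i) * (lam i / mu i)) * exp (- mu i * t)"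
  proof (rule mult_right_mono)
    have "G (0, y0 i) \<le> \<gamma> * potential (a i) (d i) 0 (y0 i)"
      unfolding G_def using relaxed_le[of 0 "y0 i" 1 \<gamma> "a i" "d i" 0] by simp
    also have "\<dots> \<le> \<gamma> * K" using initial_potential[OF assms(1)] \<gamma> by (intro mult_left_mono) auto
    finally show "f (0, y0 i) \<le> 1 / d i - (1 - \<alpha> i) * (lam i / mu i)"
      using \<gamma>(2) y0[of i] by (simp add: f_def)
  qed simp
  finally have upper: "(\<integral>w. f (state t w i) \<partial>Path) \<le> (1 / d i - (1 - \<alpha> i) * (lam i / mu i)) * exp (- mu i * t) +
      (p_block * (lam i / mu i) + 1 / d i - lam i / mu i) * (1 - exp (- mu i * t))" by simp
  have lower: "- real x - (ln K - 1) / d i \<le> f (x, y)" for x y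
  proof (rule relaxed_attained[of y 1 \<gamma> "a i" "d i" x])
    fix D assume D: "D \<le> y"
      and eq: "relaxed 1 \<gamma> (a i) (d i) (x, y) = 1 * real D + \<gamma> * potential (a i) (d i) (x + D) (y - D)"
    \<comment> \<open>The tangent handles the \<open>y - D\<close> requests that stay; the
      \<open>D\<close> moved ones are paid for at price one each, so all \<open>y\<close> are
      covered.\<close>
    let ?s = "d i * real (y - D) - ln K"
    have "d i * real (y - D) - (ln K - 1) \<le> exp ?s" using exp_ge_add_one_self[of ?s] by linarith
    also have "\<dots> = exp (d i * real (y - D)) / K" using K_pos by (simp add: exp_diff)
    also have "\<dots> \<le> potential (a i) (d i) (x + D) (y - D) / K"
      using K_pos by (intro divide_right_mono) (auto simp: potential_def)
    finally have "(d i * real (y - D) - (ln K - 1)) / d i \<le> potential (a i) (d i) (x + D) (y - D) / K / d i"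
      using d by (intro divide_right_mono) auto
    then have "real (y - D) - (ln K - 1) / d i \<le> \<gamma> * potential (a i) (d i) (x + D) (y - D)"
      using d by (simp add: \<gamma>_def diff_divide_distrib mult.commute)
    then show ?thesis using eq D by (simp add: f_def G_def of_nat_diff)
  qed
  have int_f: "integrable Path (\<lambda>w. f (state t w i))"
    by (rule expectation_state_bound[where i = i and t = t and C = "2 * \<gamma> + 1" and \<kappa> = 1 and g = "\<lambda>v. f (v i)"])
       (use f_growth[of "fst (v i)" "snd (v i)" for v] in simp_all)
  have "- (\<integral>w. real (fst (state t w i)) \<partial>Path) - (ln K - 1) / d i =
      (\<integral>w. - real (fst (state t w i)) - (ln K - 1) / d i \<partial>Path)"
    using integrable_occupancy by (simp add: Path.prob_space)
  also have "\<dots> \<le> (\<integral>w. f (state t w i) \<partial>Path)"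
    using int_f integrable_occupancy lower[of "fst q" "snd q" for q] by (intro integral_mono) auto
  finally have "(\<integral>w. real (fst (state t w i)) \<partial>Path) \<ge> - ((ln K - 1) / d i)
      - ((1 / d i - (1 - \<alpha> i) * (lam i / mu i)) * exp (- mu i * t) +
        (p_block * (lam i / mu i) + 1 / d i - lam i / mu i) * (1 - exp (- mu i * t)))"
    using upper by linarith
  then show ?thesis by (simp add: algebra_simps diff_divide_distrib)
qed

text \<open>By the convention for \<open>c1 i = 0\<close> only lack of capacity rejects a request,
  so the drift of \<open>- x\<close> is explicit and blocking is its only uncertain term.\<close>

lemma expected_occupancy_full:
  assumes \<alpha>1: "\<alpha> i = 1" and t: "0 \<le> t"
  shows "(\<integral>w. real (fst (state t w i)) \<partial>Path) \<ge>
    lam i / mu i * (1 - exp (- mu i * t)) - p_block * (lam i / mu i) * (1 - exp (- mu i * t))"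
proof -
  interpret Path: prob_space Path by (rule prob_space_Path)
  define f where "f = (\<lambda>q :: nat \<times> nat. - real (fst q))"
  define c where "c = (\<lambda>v. lam i * of_bool (capacity_blocked i v) - lam i)"
  have "c1 i = 0" by (simp add: c1 \<alpha>1)
  then have adm: "admit i v \<longleftrightarrow> \<not> capacity_blocked i v" for v
    by (auto simp: admit_iff penalty_condition_def)
  have "(\<integral>w. f (state t w i) \<partial>Path) \<le> f (0, y0 i) * exp (- mu i * t) +
      (lam i * p_block - lam i) / mu i * (1 - exp (- mu i * t))"
  proof (rule drift_bound[where c = c and \<kappa> = 1 and C = 1 and B = "lam i"])
    show "\<bar>f (x, y)\<bar> \<le> 1 * exp (1 * real (x + y))" for x y
    proof -
      have "real (x + y) \<le> exp (real (x + y))" using exp_ge_add_one_self[of "real (x + y)"] by linarith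
      then show ?thesis by (simp add: f_def)
    qed
    show "generator i f v \<le> c v - mu i * f (v i)" for v
    proof -
      have "generator i f v \<le> c v + mu i * (real (fst (v i)) * (real (fst (v i)) - real (fst (v i) - 1)))"
        unfolding generator_eq f_def c_def fst_conv adm by (simp add: mult.assoc)
      also have "real (fst (v i)) * (real (fst (v i)) - real (fst (v i) - 1)) = real (fst (v i))"
        by (cases "fst (v i)") simp_all
      finally show ?thesis by (simp add: f_def)
    qed
    show "\<bar>c v\<bar> \<le> lam i" for v
      using lam_pos[of i] unfolding c_def by (auto simp: of_bool_def)
    fix s :: real assume s: "0 \<le> s"
    have int: "integrable Path (\<lambda>w. of_bool (capacity_blocked i (state s w)) :: real)"
      by (rule integrable_bounded_state[where B = 1]) auto
    have "(\<integral>w. c (state s w) \<partial>Path) = lam i * (\<integral>w. of_bool (capacity_blocked i (state s w)) \<partial>Path) - lam i"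
      unfolding c_def using int by (simp add: Path.prob_space)
    then show "(\<integral>w. c (state s w) \<partial>Path) \<le> lam i * p_block - lam i"
      using prob_capacity_blocked_le[OF s, of i] lam_pos[of i] by simp
  qed (use t in auto)
  moreover have "(lam i * p_block - lam i) / mu i = p_block * (lam i / mu i) - lam i / mu i"
    by (simp add: diff_divide_distrib mult.commute)
  ultimately show ?thesis by (simp add: f_def algebra_simps)
qed

lemma expected_occupancy:
  assumes t: "0 \<le> t"
  shows "(\<integral>w. real (fst (state t w i)) \<partial>Path) \<ge>
    \<alpha> i * (lam i / mu i) * (1 - exp (- mu i * t))
      - ((ln 2 / \<beta> + 1 - \<epsilon> / 2) * (1 + 4 * \<epsilon>) - 1) * ((1 - \<alpha> i) * (lam i / mu i))
      - p_block * (lam i / mu i) * (1 - exp (- mu i * t))"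
proof (cases "\<alpha> i < 1")
  case True
  \<comment> \<open>The origin of \<zeta>: \<open>ln K / d i\<close> is a multiple of the initial
    load \<open>(1 - \<alpha> i) * (lam i / mu i)\<close>, and the lower bound contains that load
    once with positive sign, whence the final \<open>- 1\<close>.\<close>
  have "ln K / \<beta> = ln 2 / \<beta> + 1 - \<epsilon> / 2"
    using \<beta>_pos by (simp add: K_def ln_mult field_simps)
  moreover have "ln K / d i = ln K / \<beta> * ((1 + 4 * \<epsilon>) * ((1 - \<alpha> i) * (lam i / mu i)))"
    using b[of i] \<beta>_pos by (simp add: d_def c1)
  ultimately have "ln K / d i = (ln 2 / \<beta> + 1 - \<epsilon> / 2) * (1 + 4 * \<epsilon>) * ((1 - \<alpha> i) * (lam i / mu i))"
    by (simp only: mult.assoc)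
  then show ?thesis using expected_occupancy_partial[OF True t] by (simp only: left_diff_distrib mult_1)
next
  case False
  then have "\<alpha> i = 1" using \<alpha>[of i] by simp
  then show ?thesis using expected_occupancy_full[of i t] t by simp
qed

end

section \<open>Transfer to the given primitives\<close>

lemma x_state_before:
  assumes pos: "\<And>n. acc i n w \<Longrightarrow> 0 < Z (Service i n) w"
    and "\<And>n. arrival_time Z i n w \<noteq> t" "\<And>n. arrival_time Z i n w + Z (Service i n) w \<noteq> t"
  shows "x_state Z acc i t w = x_before Z acc i t w"
proof -
  have "{n. acc i n w \<and> arrival_time Z i n w \<le> t \<and> t < arrival_time Z i n w + Z (Service i n) w} =
     {n. acc i n w \<and> arrival_time Z i n w < t \<and> t \<le> arrival_time Z i n w + Z (Service i n) w}"
    using assms(2,3) by (auto simp: less_le)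
  then show ?thesis by (simp add: x_state_def x_before_def)
qed

context loss_system
begin

lemma borel_measurable_loss_primitives:
  assumes "loss_primitives M lam mu y0 Z" "p \<in> Prims"
  shows "Z p \<in> borel_measurable M"
proof -
  have "distributed M lborel (Z p) (exponential_density (rate p))"
    using assms by (simp add: loss_primitives_def)
  from distributed_measurable[OF this] show ?thesis by simp
qed

text \<open>Independence says that the joint law is the product of the marginals. The restriction to
  \<open>Prims\<close> makes the family a point of the product space, whose elements are
  \<open>undefined\<close> off the index set.\<close>

lemma distr_loss_primitives:
  assumes "loss_primitives M lam mu y0 Z"
  shows "(\<lambda>w. restrict (\<lambda>p. Z p w) Prims) \<in> M \<rightarrow>\<^sub>M Path"
    and "distr M Path (\<lambda>w. restrict (\<lambda>p. Z p w) Prims) = Path"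
proof -
  interpret M: prob_space M using assms by (simp add: loss_primitives_def)
  have indep: "M.indep_vars (\<lambda>_. borel) Z Prims"
    and dist: "\<And>p. p \<in> Prims \<Longrightarrow> distributed M lborel (Z p) (exponential_density (rate p))"
    using assms by (auto simp: loss_primitives_def)
  have rv: "Z p \<in> borel_measurable M" if "p \<in> Prims" for p
    by (rule borel_measurable_loss_primitives[OF assms that])
  have ne: "Prims \<noteq> {}" using primitives_simps(1)[of undefined undefined y0] by blast
  have clock: "distr M borel (Z p) = clock p" if "p \<in> Prims" for p
    using distributed_distr_eq_density[OF dist[OF that]] unfolding clock_def
    by (simp add: distr_cong[of M M lborel borel])
  have sets: "sets Path = sets (PiM Prims (\<lambda>_. borel :: real measure))" by (rule sets_Path)
  show "(\<lambda>w. restrict (\<lambda>p. Z p w) Prims) \<in> M \<rightarrow>\<^sub>M Path"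
    using rv by (subst measurable_cong_sets[OF refl sets]) (intro measurable_restrict)
  have "distr M Path (\<lambda>w. restrict (\<lambda>p. Z p w) Prims) =
      distr M (PiM Prims (\<lambda>_. borel)) (\<lambda>w. restrict (\<lambda>p. Z p w) Prims)"
    by (intro distr_cong refl sets)
  also have "\<dots> = PiM Prims (\<lambda>p. distr M borel (Z p))"
    using M.indep_vars_iff_distr_eq_PiM'[OF ne rv] indep by simp
  also have "\<dots> = Path" unfolding Path_def by (intro PiM_cong clock refl)
  finally show "distr M Path (\<lambda>w. restrict (\<lambda>p. Z p w) Prims) = Path" .
qed

text \<open>The acceptance rule has only one solution when arrivals do not accumulate, so the given routing
  decisions are a function of the primitives.\<close>

lemma x_state_eq_occupancy:
  assumes prim: "loss_primitives M lam mu y0 Z"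
    and acc: "AE w in M. \<forall>i n. acc i n w \<longleftrightarrow>
      admit i (\<lambda>j. (x_before Z acc j (arrival_time Z i n w) w, y_before Z acc y0 j (arrival_time Z i n w) w))"
  shows "AE w in M. x_state Z acc i t w = fst (state t (restrict (\<lambda>p. Z p w) Prims) i)"
proof -
  let ?R = "\<lambda>w. restrict (\<lambda>p. Z p w) Prims"
  note R = distr_loss_primitives[OF prim]
  have *: "AE w in M. P (?R w)" if "AE w in Path. P w" for P
  proof -
    have "AE w in distr M Path ?R. P w" unfolding R(2) by (rule that)
    then show ?thesis by (rule AE_distrD[OF R(1)])
  qed
  \<comment> \<open>The time \<open>t\<close> is fixed, so almost surely no clock rings at
    \<open>t\<close> and the right-continuous state agrees with its left limit.\<close>
  have never: "AE w in Path. \<forall>p\<in>Prims. ring p w \<noteq> t"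
    by (simp only: AE_ball_countable[OF countable_primitives]) (simp add: AE_ring_neq_const)
  show ?thesis
    using *[OF AE_positive] *[OF AE_locally_finite] *[OF never] acc
  proof eventually_elim
    case (elim w)
    have arr: "arrival_time Z j n w = arrival j n (?R w)" for j n
      by (simp add: arrival_time_def)
    have occ: "(x_before Z acc j s w, y_before Z acc y0 j s w) = occupancy (\<lambda>i n _. acc i n w) y0 s (?R w) j" for j s
    proof -
      have "{k. k < y0 j \<and> s \<le> Z (Init_Service j k) w} = {k. k < y0 j \<and> s \<le> ?R w (Init_Service j k)}" by auto
      then show ?thesis
        by (simp add: occupancy_def x_before_def y_before_def arr)
    qed
    have occ_fun: "(\<lambda>j. (x_before Z acc j s w, y_before Z acc y0 j s w)) = occupancy (\<lambda>i n _. acc i n w) y0 s (?R w)" for s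
      by (rule ext) (rule occ)
    have "acc i n w = admit i (occupancy (\<lambda>i n _. acc i n w) y0 (arrival i n (?R w)) (?R w))" for i n
      using elim(4)[rule_format, of i n] unfolding occ_fun arr[of i n] .
    then have route: "acc i n w = routing i n (?R w)" for i n
      using routing_unique[OF elim(2), of "\<lambda>i n _. acc i n w"] by blast
    have "x_state Z acc i t w = x_before Z acc i t w"
    proof (rule x_state_before)
      fix n
      have p: "Interarrival i n \<in> Prims" "Service i n \<in> Prims" by auto
      show "0 < Z (Service i n) w" using elim(1) p(2) by fastforce
      show "arrival_time Z i n w \<noteq> t" using elim(3) p(1) unfolding arr by fastforce
      have "ring (Service i n) (?R w) \<noteq> t" using elim(3) p(2) by blast
      then show "arrival_time Z i n w + Z (Service i n) w \<noteq> t" by (simp add: arr ring_def)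
    qed
    also have "\<dots> = fst (occupancy (\<lambda>i n _. acc i n w) y0 t (?R w) i)" using occ[of i t] by (metis fst_conv)
    also have "occupancy (\<lambda>i n _. acc i n w) y0 t (?R w) = state t (?R w)"
      by (rule occupancy_cong) (rule route)
    finally show ?case .
  qed
qed

lemma borel_measurable_x_state:
  assumes prim: "loss_primitives M lam mu y0 Z"
    and [measurable]: "\<And>n. acc i n \<in> M \<rightarrow>\<^sub>M count_space UNIV"
  shows "(\<lambda>w. real (x_state Z acc i t w)) \<in> borel_measurable M"
proof -
  have [measurable]: "Z p \<in> borel_measurable M" if "p \<in> Prims" for p
    by (rule borel_measurable_loss_primitives[OF prim that])
  have [measurable]: "(\<lambda>w. arrival_time Z i n w) \<in> borel_measurable M" for n
    unfolding arrival_time_def by (intro borel_measurable_sum) simp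
  have "(\<lambda>w. x_state Z acc i t w) \<in> M \<rightarrow>\<^sub>M count_space UNIV"
    unfolding x_state_def by (rule measurable_card) measurable
  then show ?thesis by (rule measurable_compose) simp
qed

lemma expectation_reward_rate:
  assumes prim: "loss_primitives M lam mu y0 Z"
    and meas: "\<And>i n. acc i n \<in> M \<rightarrow>\<^sub>M count_space UNIV"
    and acc: "AE w in M. \<forall>i n. acc i n w \<longleftrightarrow>
      admit i (\<lambda>j. (x_before Z acc j (arrival_time Z i n w) w, y_before Z acc y0 j (arrival_time Z i n w) w))"
    and int: "\<And>i. integrable Path (\<lambda>w. real (fst (state t w i)))"
  shows "(\<integral>w. reward_rate r Z acc t w \<partial>M) = (\<Sum>i\<in>UNIV. r i * (\<integral>w. real (fst (state t w i)) \<partial>Path))"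
proof -
  let ?R = "\<lambda>w. restrict (\<lambda>p. Z p w) Prims"
  let ?g = "\<lambda>w. \<Sum>i\<in>UNIV. r i * real (fst (state t w i))"
  note R = distr_loss_primitives[OF prim]
  have "AE w in M. \<forall>i. x_state Z acc i t w = fst (state t (?R w) i)"
    using x_state_eq_occupancy[OF prim acc] by (subst AE_all_countable) auto
  then have ae: "AE w in M. reward_rate r Z acc t w = ?g (?R w)"
    by eventually_elim (simp add: reward_rate_def)
  have g: "?g \<in> borel_measurable Path"
    using borel_measurable_state(2)[where g = "\<lambda>v. \<Sum>i\<in>UNIV. r i * real (fst (v i))"] .
  have "(\<integral>w. reward_rate r Z acc t w \<partial>M) = (\<integral>w. ?g (?R w) \<partial>M)"
  proof (rule integral_cong_AE[OF _ _ ae])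
    show "reward_rate r Z acc t \<in> borel_measurable M"
      unfolding reward_rate_def
      by (intro borel_measurable_sum borel_measurable_times borel_measurable_const borel_measurable_x_state prim meas)
    show "(\<lambda>w. ?g (?R w)) \<in> borel_measurable M"
      by (rule measurable_compose[OF R(1) g])
  qed
  also have "\<dots> = (\<integral>w. ?g w \<partial>distr M Path ?R)"
    by (rule integral_distr[symmetric, OF R(1) g])
  also have "\<dots> = (\<Sum>i\<in>UNIV. r i * (\<integral>w. real (fst (state t w i)) \<partial>Path))"
    unfolding R(2) using int by simp
  finally show ?thesis .
qed

end

section \<open>The bound on the reward rate\<close>

theorem theorem2:
  fixes M :: "'w measure"
    and lam mu b r \<rho> \<alpha>star \<alpha> c0 c1 :: "'i::finite \<Rightarrow> real"
    and cap \<epsilon> \<beta> \<zeta> :: real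
    and y0 :: "'i \<Rightarrow> nat"
    and Z :: "'i primitive \<Rightarrow> 'w \<Rightarrow> real"
    and acc :: "'i \<Rightarrow> nat \<Rightarrow> 'w \<Rightarrow> bool"
  assumes "cap > 0"
    and "\<And>i. lam i > 0" and "\<And>i. mu i > 0" and "\<And>i. b i > 0" and "\<And>i. r i \<ge> 0"
    and "\<And>i. \<rho> i = lam i / mu i"
    and "lp_optimal r b \<rho> cap \<alpha>star" and "\<And>i. \<alpha>star i > 0"
    and "0 < \<epsilon>" and "\<epsilon> < 1 / 4"
    and "lp_optimal r b \<rho> (cap / (1 + 4 * \<epsilon>)) \<alpha>"
    and "\<And>i. c0 i = (1 + 4 * \<epsilon>) * \<alpha> i * b i * \<rho> i"
    and "\<And>i. c1 i = (1 + 4 * \<epsilon>) * (1 - \<alpha> i) * b i * \<rho> i"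
    and "\<beta> > 0"
    and "\<beta> \<le> \<epsilon> * Min ({c0 i / b i |i. True} \<union> {c1 i / b i |i. \<alpha> i < 1})"
    and "\<And>i. real (y0 i) = (1 - \<alpha> i) * \<rho> i"
    and "loss_primitives M lam mu y0 Z"
    and "penalty_policy M b cap \<beta> c0 c1 y0 Z acc"
    and "\<zeta> = (ln 2 / \<beta> + 1 - \<epsilon> / 2) * (1 + 4 * \<epsilon>) - 1"
  shows "\<forall>t\<ge>0. prob_space.expectation M (reward_rate r Z acc t) \<ge>
    max ((\<Sum>i\<in>UNIV. \<alpha> i * r i * \<rho> i * (1 - exp (- mu i * t)))
         - \<zeta> * (\<Sum>i\<in>UNIV. (1 - \<alpha> i) * r i * \<rho> i)
         - 2 * exp (- (\<epsilon> / 2) * (\<beta> - 4)) * (\<Sum>i\<in>UNIV. r i * \<rho> i * (1 - exp (- mu i * t))))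
        0"
proof (intro allI impI)
  fix t :: real assume t: "0 \<le> t"
  note cap = assms(1) and lam = assms(2) and mu = assms(3) and b = assms(4) and r = assms(5) and \<rho> = assms(6)
    and \<epsilon> = assms(9,10) and opt = assms(11) and c0 = assms(12) and c1 = assms(13) and \<beta> = assms(14,15)
    and y0 = assms(16) and prim = assms(17) and policy = assms(18) and \<zeta> = assms(19)
  interpret M: prob_space M using prim by (simp add: loss_primitives_def)
  let ?e = "\<lambda>i. 1 - exp (- mu i * t)" and ?p = "2 * exp (- (\<epsilon> / 2) * (\<beta> - 4))"
  let ?L = "(\<Sum>i\<in>UNIV. \<alpha> i * r i * \<rho> i * ?e i) - \<zeta> * (\<Sum>i\<in>UNIV. (1 - \<alpha> i) * r i * \<rho> i)
      - ?p * (\<Sum>i\<in>UNIV. r i * \<rho> i * ?e i)"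
  have \<rho>_pos: "0 < \<rho> i" for i using lam mu by (simp add: \<rho>)
  have e: "0 \<le> ?e i" for i using t mu[of i] by simp
  have \<alpha>: "0 \<le> \<alpha> i" "\<alpha> i \<le> 1" for i
    using opt by (auto simp: lp_optimal_def lp_feasible_def)
  have reward_nonneg: "0 \<le> M.expectation (reward_rate r Z acc t)"
    using r by (intro Bochner_Integration.integral_nonneg) (auto simp: reward_rate_def intro!: sum_nonneg)
  have "?L \<le> M.expectation (reward_rate r Z acc t)"
  proof (cases "\<beta> < 4")
    case True
    have "0 \<le> - (\<epsilon> / 2) * (\<beta> - 4)" using True \<epsilon> by (intro mult_nonpos_nonpos) auto
    then have "1 \<le> exp (- (\<epsilon> / 2) * (\<beta> - 4))" by (simp only: one_le_exp_iff)
    then have "1 \<le> ?p" by linarith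
    have "(\<Sum>i\<in>UNIV. \<alpha> i * r i * \<rho> i * ?e i) \<le> ?p * (\<Sum>i\<in>UNIV. r i * \<rho> i * ?e i)"
      unfolding sum_distrib_left
    proof (rule sum_mono)
      fix i
      have "\<alpha> i * (r i * \<rho> i * ?e i) \<le> ?p * (r i * \<rho> i * ?e i)"
        using \<alpha>(2)[of i] \<open>1 \<le> ?p\<close> r[of i] \<rho>_pos[of i] e[of i]
        by (intro mult_right_mono mult_nonneg_nonneg) auto
      then show "\<alpha> i * r i * \<rho> i * ?e i \<le> ?p * (r i * \<rho> i * ?e i)" by (simp only: mult.assoc)
    qed
    moreover have "0 \<le> \<zeta>"
    proof -
      have "\<zeta> = ln 2 / \<beta> * (1 + 4 * \<epsilon>) + \<epsilon> * (7 / 2 - 2 * \<epsilon>)"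
        unfolding \<zeta> by (simp add: algebra_simps)
      then show ?thesis using \<beta>(1) \<epsilon> by (simp add: add_nonneg_nonneg)
    qed
    then have "0 \<le> \<zeta> * (\<Sum>i\<in>UNIV. (1 - \<alpha> i) * r i * \<rho> i)"
      using \<alpha> r less_imp_le[OF \<rho>_pos] by (intro mult_nonneg_nonneg sum_nonneg) auto
    ultimately show ?thesis using reward_nonneg by linarith
  next
    case False
    let ?S = "{c0 i / b i |i. True} \<union> {c1 i / b i |i. \<alpha> i < 1}"
    have "?S \<subseteq> range (\<lambda>i. c0 i / b i) \<union> range (\<lambda>i. c1 i / b i)" by auto
    then have fin: "finite ?S" by (rule finite_subset) simp
    have \<beta>_le: "\<beta> * b i \<le> \<epsilon> * c" if "c / b i \<in> ?S" for c i
    proof -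
      have "\<beta> \<le> \<epsilon> * (c / b i)"
        using \<beta>(2) mult_left_mono[OF Min_le[OF fin that], of \<epsilon>] \<epsilon> by linarith
      then show ?thesis using b[of i] by (simp add: field_simps)
    qed
    have \<beta>_c0: "\<beta> * b i \<le> \<epsilon> * c0 i" for i by (rule \<beta>_le) auto
    \<comment> \<open>A vanishing \<open>\<alpha> i\<close> would make \<open>c0 i\<close> zero and
      leave no room for a positive \<beta> below the minimum.\<close>
    have \<alpha>_pos: "0 < \<alpha> i" for i
    proof (rule ccontr)
      assume "\<not> 0 < \<alpha> i"
      then have "c0 i = 0" using \<alpha>[of i] by (simp add: c0)
      then have "\<beta> * b i \<le> 0" using \<beta>_c0[of i] by simp
      then show False using mult_pos_pos[OF \<beta>(1) b[of i]] by linarith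
    qed
    define admit where "admit = (\<lambda>i (v :: 'i \<Rightarrow> nat \<times> nat).
      penalty_condition \<beta> (b i) (c0 i) (c1 i) (real (fst (v i))) (real (snd (v i))) \<and>
      (\<Sum>j\<in>UNIV. b j * real (fst (v j))) + b i \<le> cap)"
    interpret P: penalty_system lam mu y0 admit b \<alpha> c0 c1 cap \<epsilon> \<beta>
    proof
      \<comment> \<open>The factor \<open>1 + 4 * \<epsilon>\<close> in \<open>c0\<close> is the one
        by which the perturbed program tightens the capacity.\<close>
      show "(\<Sum>j\<in>UNIV. c0 j) \<le> cap"
      proof -
        have "(\<Sum>i\<in>UNIV. b i * \<rho> i * \<alpha> i) \<le> cap / (1 + 4 * \<epsilon>)"
          using opt by (simp add: lp_optimal_def lp_feasible_def)
        then have "(1 + 4 * \<epsilon>) * (\<Sum>i\<in>UNIV. b i * \<rho> i * \<alpha> i) \<le> cap"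
          using \<epsilon> by (simp add: le_divide_eq mult.commute)
        then show ?thesis by (simp add: c0 sum_distrib_left mult_ac)
      qed
      show "\<beta> * b i \<le> \<epsilon> * c1 i" if "\<alpha> i < 1" for i using that by (intro \<beta>_le) auto
    qed (use False \<epsilon> lam mu b \<alpha>_pos \<alpha> \<beta>_c0 y0 c0 c1 \<rho> in \<open>auto simp: admit_def\<close>)
    have acc: "AE w in M. \<forall>i n. acc i n w \<longleftrightarrow>
      admit i (\<lambda>j. (x_before Z acc j (arrival_time Z i n w) w, y_before Z acc y0 j (arrival_time Z i n w) w))"
      using policy by (simp add: penalty_policy_def admit_def Let_def)
    have meas: "acc i n \<in> M \<rightarrow>\<^sub>M count_space UNIV" for i n
      using policy by (simp add: penalty_policy_def)
    have "?L = (\<Sum>i\<in>UNIV. r i * (\<alpha> i * \<rho> i * ?e i - \<zeta> * ((1 - \<alpha> i) * \<rho> i) - ?p * \<rho> i * ?e i))"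
      by (simp add: sum_distrib_left sum_subtractf[symmetric] algebra_simps)
    also have "\<dots> \<le> (\<Sum>i\<in>UNIV. r i * (\<integral>w. real (fst (P.state t w i)) \<partial>P.Path))"
      using P.expected_occupancy[OF t] r
      by (intro sum_mono mult_left_mono) (simp_all only: P.p_block_def \<rho> \<zeta>)
    also have "\<dots> = M.expectation (reward_rate r Z acc t)"
      by (rule P.expectation_reward_rate[symmetric, OF prim meas acc P.integrable_occupancy])
    finally show ?thesis .
  qed
  with reward_nonneg show "max ?L 0 \<le> M.expectation (reward_rate r Z acc t)" by simp
qed

end
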